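(* Let $a,b,c$ be the three elements of $\{0,1,t\}$ in some order ($a\ne b\ne c\ne a$), and let $(\mathrm{He})$, $(\mathrm{He}')$ be the pair of Heun equations with the related parameters described in the context. (i) If $\epsilon_a'\in\mathbb{Z}_{\ge2}$, $\eta\notin\mathbb{Z}$ and the singularity $w=a$ of $(\mathrm{He}')$ is apparent, then there exists a non-zero solution of $(\mathrm{He})$ of the form $(z-a)^{1-\epsilon_a}h(z)$ where $h(z)$ is a polynomial of degree no more than $\epsilon_a'-2$. Moreover, if $\alpha',\beta'\notin\mathbb{Z}$, then $\deg h(z)=\epsilon_a'-2$. (ii) If $\epsilon_a'\in\mathbb{Z}_{\le0}$, $\eta\notin\mathbb{Z}$, $\alpha',\beta',\epsilon_b,\epsilon_c\notin\mathbb{Z}$ and the singularity $w=a$ of $(\mathrm{He}')$ is apparent, then there exists a non-zero solution of $(\mathrm{He})$ of the form $(z-b)^{1-\epsilon_b}(z-c)^{1-\epsilon_c}h(z)$ where $h(z)$ is a polynomial with $\deg h(z)=-\epsilon_a'$. (iii) If $\epsilon_a\in\mathbb{Z}_{\ge2}$, $\alpha,\beta\notin\mathbb{Z}$ and there exists a non-zero solution of $(\mathrm{He}')$ which is a product of $(w-a)^{1-\epsilon_a'}$ and a polynomial, then the singularity $z=a$ of $(\mathrm{He})$ is apparent. (iv) If $\epsilon_a\in\mathbb{Z}_{\le0}$, $\alpha,\beta,\epsilon_b',\epsilon_c'\notin\mathbb{Z}$ and there exists a non-zero solution of $(\mathrm{He}')$ of the form $(w-b)^{1-\epsilon_b'}(w-c)^{1-\epsilon_c'}h(w)$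 where $h(w)$ is a polynomial, then the singularity $z=a$ of $(\mathrm{He})$ is apparent. (v) If $\alpha+\beta-\eta\in\mathbb{Z}_{\le0}$, $\eta\notin\mathbb{Z}$ and the singularity $w=\infty$ of $(\mathrm{He}')$ is apparent, then there exists a non-zero solution of $(\mathrm{He})$ which is a polynomial of degree $\eta-\alpha-\beta$. (vi) If $\alpha+\beta-\eta\in\mathbb{Z}_{\ge2}$, $\eta,\epsilon_0,\epsilon_1,\epsilon_t\notin\mathbb{Z}$ and the singularity $w=\infty$ of $(\mathrm{He}')$ is apparent, then there exists a non-zero solution of $(\mathrm{He})$ of the form $z^{1-\epsilon_0}(z-1)^{1-\epsilon_1}(z-t)^{1-\epsilon_t}h(z)$ where $h(z)$ is a polynomial of degree $\alpha+\beta-\eta-2$. (vii) If $\alpha+\beta-2\eta\in\mathbb{Z}_{\le-1}$, $\eta,\epsilon_0'\notin\mathbb{Z}$ and there exists a non-zero solution of $(\mathrm{He}')$ which is a polynomial in $w$, then the singularity $z=\infty$ of $(\mathrm{He})$ is apparent. (viii) If $\alpha+\beta-2\eta\in\mathbb{Z}_{\ge1}$, $\eta,\epsilon_0',\epsilon_1',\epsilon_t'\notin\mathbb{Z}$ and there exists a non-zero solution of $(\mathrm{He}')$ of the form $w^{1-\epsilon_0'}(w-1)^{1-\epsilon_1'}(w-t)^{1-\epsilon_t'}h(w)$ where $h(w)$ is a polynomial, then the singularity $z=\infty$ of $(\mathrm{He})$ is apparent.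
   Context: Fix $t\in\mathbb{C}\setminus\{0,1\}$. Let $\alpha,\beta,\epsilon_0,\epsilon_1,\epsilon_t,q\in\mathbb{C}$ with $\epsilon_0+\epsilon_1+\epsilon_t=\alpha+\beta+1$, let $\eta\in\{\alpha,\beta\}$, $\epsilon_p'=\epsilon_p-\eta+1$ ($p=0,1,t$), $\{\alpha',\beta'\}=\{2-\eta,\alpha+\beta-2\eta+1\}$, $q'=q+(1-\eta)(\epsilon_t+\epsilon_1t+(\epsilon_0-\eta)(t+1))$. The equations are $(\mathrm{He})$: $y''+\big(\frac{\epsilon_0}{z}+\frac{\epsilon_1}{z-1}+\frac{\epsilon_t}{z-t}\big)y'+\frac{\alpha\beta z-q}{z(z-1)(z-t)}y=0$ (in the variable $z$); $(\mathrm{He}')$: $v''+\big(\frac{\epsilon_0'}{w}+\frac{\epsilon_1'}{w-1}+\frac{\epsilon_t'}{w-t}\big)v'+\frac{\alpha'\beta'w-q'}{w(w-1)(w-t)}v=0$ (in the variable $w$). A regular singularity of a second-order linear differential equation is called apparent if the monodromy matrix of the equation around it is a scalar matrix. $\mathbb{Z}_{\ge n}$ (resp. $\mathbb{Z}_{\le n}$) is the set of integers $\ge n$ (resp. $\le n$). *)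

theory Defs
  imports "HOL-Complex_Analysis.Complex_Analysis"
begin

section \<open>Second-order linear differential equations \<open>y'' + P y' + Q y = 0\<close>\<close>

definition lde2_solution_on ::
  "(complex \<Rightarrow> complex) \<Rightarrow> (complex \<Rightarrow> complex) \<Rightarrow> complex set \<Rightarrow> (complex \<Rightarrow> complex) \<Rightarrow> bool" where
  "lde2_solution_on P Q U y \<longleftrightarrow>
     open U \<and> y holomorphic_on U \<and>
     (\<forall>z\<in>U. deriv (deriv y) z + P z * deriv y z + Q z * y z = 0)"

definition fundamental_system ::
  "(complex \<Rightarrow> complex) \<Rightarrow> (complex \<Rightarrow> complex) \<Rightarrow> complex set \<Rightarrow> (2 \<Rightarrow> complex \<Rightarrow> complex) \<Rightarrow> bool" where
  "fundamental_system P Q U Y \<longleftrightarrow>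
     (\<forall>j. lde2_solution_on P Q U (Y j)) \<and>
     (\<forall>k :: 2 \<Rightarrow> complex. (\<forall>z\<in>U. (\<Sum>j\<in>UNIV. k j * Y j z) = 0) \<longrightarrow> (\<forall>j. k j = 0))"

text \<open>
  \<open>F s\<close> represents the germ at \<open>\<gamma> s\<close> obtained by continuing the germ of \<open>F 0\<close> at \<open>\<gamma> 0\<close>
  along \<open>\<gamma>\<close>; only its values near \<open>\<gamma> s\<close> matter.
\<close>

definition analytic_continuation_along ::
  "(real \<Rightarrow> complex) \<Rightarrow> (real \<Rightarrow> complex \<Rightarrow> complex) \<Rightarrow> bool" where
  "analytic_continuation_along \<gamma> F \<longleftrightarrow>
     (\<forall>s\<in>{0..1}. \<exists>r>0. F s holomorphic_on ball (\<gamma> s) r \<and>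
        (\<exists>d>0. \<forall>s'\<in>{0..1}. \<bar>s' - s\<bar> < d \<longrightarrow>
            \<gamma> s' \<in> ball (\<gamma> s) r \<and> (\<forall>\<^sub>F z in nhds (\<gamma> s'). F s' z = F s z)))"

text \<open>
  \<open>M\<close> is the monodromy matrix along the closed path \<open>\<gamma>\<close> with respect to some fundamental
  system \<open>(F 1 0, F 2 0)\<close> near the base point: continuation along \<open>\<gamma>\<close> turns the row vector
  \<open>(y\<^sub>1, y\<^sub>2)\<close> into \<open>(y\<^sub>1, y\<^sub>2) M\<close>.
\<close>

definition monodromy_matrix ::
  "(complex \<Rightarrow> complex) \<Rightarrow> (complex \<Rightarrow> complex) \<Rightarrow> (real \<Rightarrow> complex) \<Rightarrow> complex^2^2 \<Rightarrow> bool" where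
  "monodromy_matrix P Q \<gamma> M \<longleftrightarrow>
     (\<exists>F :: 2 \<Rightarrow> real \<Rightarrow> complex \<Rightarrow> complex. \<exists>\<rho>>0.
        fundamental_system P Q (ball (pathstart \<gamma>) \<rho>) (\<lambda>j. F j 0) \<and>
        (\<forall>j. analytic_continuation_along \<gamma> (F j)) \<and>
        (\<forall>j. \<forall>\<^sub>F z in nhds (pathfinish \<gamma>). F j 1 z = (\<Sum>i\<in>UNIV. F i 0 z * M $ i $ j)))"

text \<open>
  \<open>S\<close> is the set of finite singularities. Changing the fundamental system, the radius or the
  base point only conjugates the monodromy matrix, so whether it is scalar does not depend on
  these choices.
\<close>

definition apparent_at ::
  "(complex \<Rightarrow> complex) \<Rightarrow> (complex \<Rightarrow> complex) \<Rightarrow> complex set \<Rightarrow> complex \<Rightarrow> bool" where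
  "apparent_at P Q S a \<longleftrightarrow>
     (\<exists>r>0. S \<inter> cball a r \<subseteq> {a} \<and> (\<exists>k. monodromy_matrix P Q (circlepath a r) (mat k)))"

definition apparent_at_infinity ::
  "(complex \<Rightarrow> complex) \<Rightarrow> (complex \<Rightarrow> complex) \<Rightarrow> complex set \<Rightarrow> bool" where
  "apparent_at_infinity P Q S \<longleftrightarrow>
     (\<exists>R>0. S \<subseteq> ball 0 R \<and>
        (\<exists>k. monodromy_matrix P Q (reversepath (circlepath 0 R)) (mat k)))"


section \<open>Heun's equation\<close>

text \<open>The exponent parameters \<open>\<epsilon>\<^sub>0, \<epsilon>\<^sub>1, \<epsilon>\<^sub>t\<close> are the values of a function \<open>\<epsilon>\<close> at the points \<open>0, 1, t\<close>.\<close>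

definition heun_P :: "complex \<Rightarrow> (complex \<Rightarrow> complex) \<Rightarrow> complex \<Rightarrow> complex" where
  "heun_P t \<epsilon> z = \<epsilon> 0 / z + \<epsilon> 1 / (z - 1) + \<epsilon> t / (z - t)"

definition heun_Q :: "complex \<Rightarrow> complex \<Rightarrow> complex \<Rightarrow> complex \<Rightarrow> complex \<Rightarrow> complex" where
  "heun_Q t \<alpha> \<beta> q z = (\<alpha> * \<beta> * z - q) / (z * (z - 1) * (z - t))"

definition heun_solution_on ::
  "complex \<Rightarrow> (complex \<Rightarrow> complex) \<Rightarrow> complex \<Rightarrow> complex \<Rightarrow> complex \<Rightarrow>
   complex set \<Rightarrow> (complex \<Rightarrow> complex) \<Rightarrow> bool" where
  "heun_solution_on t \<epsilon> \<alpha> \<beta> q U y \<longleftrightarrow>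
     U \<subseteq> - {0, 1, t} \<and> lde2_solution_on (heun_P t \<epsilon>) (heun_Q t \<alpha> \<beta> q) U y"

definition heun_apparent_at ::
  "complex \<Rightarrow> (complex \<Rightarrow> complex) \<Rightarrow> complex \<Rightarrow> complex \<Rightarrow> complex \<Rightarrow> complex \<Rightarrow> bool" where
  "heun_apparent_at t \<epsilon> \<alpha> \<beta> q a \<longleftrightarrow>
     apparent_at (heun_P t \<epsilon>) (heun_Q t \<alpha> \<beta> q) {0, 1, t} a"

definition heun_apparent_at_infinity ::
  "complex \<Rightarrow> (complex \<Rightarrow> complex) \<Rightarrow> complex \<Rightarrow> complex \<Rightarrow> complex \<Rightarrow> bool" where
  "heun_apparent_at_infinity t \<epsilon> \<alpha> \<beta> q \<longleftrightarrow>
     apparent_at_infinity (heun_P t \<epsilon>) (heun_Q t \<alpha> \<beta> q) {0, 1, t}"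

definition heun_polynomial_solution ::
  "complex \<Rightarrow> (complex \<Rightarrow> complex) \<Rightarrow> complex \<Rightarrow> complex \<Rightarrow> complex \<Rightarrow> complex poly \<Rightarrow> bool" where
  "heun_polynomial_solution t \<epsilon> \<alpha> \<beta> q h \<longleftrightarrow>
     heun_solution_on t \<epsilon> \<alpha> \<beta> q (- {0, 1, t}) (poly h)"

text \<open>
  The multivalued function \<open>(\<Prod>p\<in>S. (z - p)^(\<nu> p)) * h z\<close> solves Heun's equation, i.e. each of
  its branches does. Here \<open>L p\<close> is a branch of \<open>log (z - p)\<close> on \<open>U\<close>, which gives the
  branch \<open>exp (\<nu> p * L p z)\<close> of \<open>(z - p)^(\<nu> p)\<close>.
\<close>

definition heun_product_solution ::
  "complex \<Rightarrow> (complex \<Rightarrow> complex) \<Rightarrow> complex \<Rightarrow> complex \<Rightarrow> complex \<Rightarrow>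
   complex set \<Rightarrow> (complex \<Rightarrow> complex) \<Rightarrow> complex poly \<Rightarrow> bool" where
  "heun_product_solution t \<epsilon> \<alpha> \<beta> q S \<nu> h \<longleftrightarrow>
     (\<forall>U L. open U \<longrightarrow> U \<subseteq> - {0, 1, t} \<longrightarrow>
        (\<forall>p\<in>S. L p holomorphic_on U \<and> (\<forall>z\<in>U. exp (L p z) = z - p)) \<longrightarrow>
        heun_solution_on t \<epsilon> \<alpha> \<beta> q U (\<lambda>z. (\<Prod>p\<in>S. exp (\<nu> p * L p z)) * poly h z))"

end

theory Submission
  imports Defs
begin

text \<open>
  In a local parameter \<open>x\<close> at a singular point, Heun's equation becomes \<open>(\<Sum>i\<le>2. x^i P\<^sub>i(\<theta>)) y = 0\<close>
  with \<open>\<theta> = x d/dx\<close> and quadratic \<open>P\<^sub>i\<close>, so a series \<open>\<Sum>n. c n x^(\<mu> + n)\<close> solves it iff \<open>c\<close> satisfies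
  a three-term recurrence. When the local exponents differ by a positive integer, the singularity is apparent iff the
  recurrence started at the lower exponent is consistent at the upper one, i.e. iff no logarithm occurs.
  Euler's integral transformation, which maps \<open>(He')\<close> to \<open>(He)\<close>, acts on coefficients by quotients of Gamma
  functions, \<open>d n = g n * c n\<close> with \<open>g n / g (n - 1)\<close> rational in \<open>n\<close>. Where the multiplier \<open>g\<close> vanishes the
  transformed series is truncated, and consistency of one recurrence at the upper exponent is
  exactly the existence of a polynomial solution of the other one. For the products of powers at
  two or three singular points the same holds after gauging the powers away, with the
  tridiagonal recurrence read from the other end.
\<close>

section \<open>Fourier coefficients on a circle\<close>

text \<open>Monodromy is defined by germs continued along one circle, so no function on a punctured
  disc is at hand for a Laurent expansion. What exists is the function that takes s to the value of
  the germ at the s-th point of the circle. Scalar monodromy multiplies it by a constant in one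
  turn, so it has Fourier coefficients with a fixed complex shift of the frequencies, and
  integration by parts turns the equation into the recurrence. That these coefficients vanish far to
  the left comes from the circle separating the point from all other singular points. Completeness
  of the Fourier system excludes nonzero solutions without any coefficient. For the converse
  direction the radius is free, so the circle is placed inside the region of convergence of the
  series. The transformation is never written as an integral: it reduces to polynomial identities in
  the index n, while the nonintegrality assumptions keep factors of the multiplier and of the
  recurrences away from 0.\<close>

definition ee :: "complex \<Rightarrow> real \<Rightarrow> complex" where
  "ee z s = exp (2 * of_real pi * \<i> * z * of_real s)"

lemma ee_add: "ee (z + w) s = ee z s * ee w s"
  by (simp add: ee_def exp_add [symmetric] algebra_simps)

lemma ee_0 [simp]: "ee z 0 = 1" "ee 0 s = 1"
  by (simp_all add: ee_def)

lemma ee_int_1 [simp]: "ee (of_int n) 1 = 1"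
  using exp_integer_2pi[of "of_int n"] by (simp add: ee_def algebra_simps)

lemma continuous_on_ee [continuous_intros]: "continuous_on S (ee z)"
  unfolding ee_def by (intro continuous_intros)

lemma ee_has_vector_derivative [derivative_intros]:
  "(ee z has_vector_derivative (2 * of_real pi * \<i> * z * ee z s)) (at s within S)"
  unfolding ee_def
  by (auto intro!: derivative_eq_intros has_vector_derivative_real_field simp: algebra_simps)

lemma continuous_on_compose_ee:
  assumes "\<And>z. isCont p z"
  shows "continuous_on S (\<lambda>s. p (ee 1 s))"
  by (rule continuous_on_compose2[OF continuous_at_imp_continuous_on[of UNIV p] continuous_on_ee])
     (use assms in auto)

lemma norm_ee_of_int [simp]: "norm (ee (of_int n) s) = 1" "norm (ee (- of_int n) s) = 1"
  by (simp_all add: ee_def)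

text \<open>A real-linear function on the circle is a combination of \<open>ee 1\<close> and
  \<open>ee (-1)\<close>, so multiplying by it only shifts frequencies. The hypotheses on
  \<open>\<phi>\<close> belong to the induction claim because the product case replaces
  \<open>\<phi>\<close> by \<open>\<phi>\<close> times the first factor.\<close>

lemma fourier_mult_real_polynomial:
  fixes p :: "complex \<Rightarrow> real"
  assumes "real_polynomial_function p"
  shows "continuous_on {0..1} \<phi> \<Longrightarrow> (\<And>n::int. integral {0..1} (\<lambda>s. \<phi> s * ee (of_int n) s) = 0) \<Longrightarrow>
     integral {0..1} (\<lambda>s. \<phi> s * of_real (p (ee 1 s)) * ee (of_int n) s) = 0"
  using assms
proof (induction p arbitrary: \<phi> n rule: real_polynomial_function.induct)
  case (linear f)
  interpret bounded_linear f by fact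
  have f: "f z = Re z * f 1 + Im z * f \<i>" for z
  proof -
    have "z = Re z *\<^sub>R 1 + Im z *\<^sub>R \<i>" by (simp add: complex_eq_iff)
    then have "f z = f (Re z *\<^sub>R 1 + Im z *\<^sub>R \<i>)" by simp
    then show ?thesis by (simp only: add scaleR) simp
  qed
  have int: "(\<lambda>s. \<phi> s * ee (of_int n) s) integrable_on {0..1}" for n
    by (intro integrable_continuous_real continuous_intros linear.prems)
  have eq: "of_real (f (ee 1 s)) = (of_real (f 1) - \<i> * of_real (f \<i>)) / 2 * ee (of_int 1) s
     + (of_real (f 1) + \<i> * of_real (f \<i>)) / 2 * ee (of_int (-1)) s" for s
  proof -
    have a: "ee 1 s = cis (2 * pi * s)" "ee (-1) s = cis (- (2 * pi * s))"
      by (simp_all add: ee_def cis_conv_exp algebra_simps)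
    have "f (ee 1 s) = cos (2 * pi * s) * f 1 + sin (2 * pi * s) * f \<i>"
      unfolding a by (subst f) simp
    then show ?thesis by (simp add: a complex_eq_iff field_simps)
  qed
  have "(\<lambda>s. \<phi> s * of_real (f (ee 1 s)) * ee (of_int n) s) =
    (\<lambda>s. (of_real (f 1) - \<i> * of_real (f \<i>)) / 2 * (\<phi> s * ee (of_int (n + 1)) s)
     + (of_real (f 1) + \<i> * of_real (f \<i>)) / 2 * (\<phi> s * ee (of_int (n - 1)) s))"
    by (simp only: eq of_int_add of_int_diff diff_conv_add_uminus of_int_minus ee_add of_int_1)
       (auto simp: algebra_simps)
  moreover have hi: "((\<lambda>s. \<phi> s * ee (of_int n) s) has_integral 0) {0..1}" for n
    using integrable_integral[OF int] linear.prems(2) by simp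
  ultimately have "((\<lambda>s. \<phi> s * of_real (f (ee 1 s)) * ee (of_int n) s) has_integral
    ((of_real (f 1) - \<i> * of_real (f \<i>)) / 2 * 0 + (of_real (f 1) + \<i> * of_real (f \<i>)) / 2 * 0)) {0..1}"
    by (simp only:) (intro has_integral_add has_integral_mult_right hi)
  then show ?case by (simp add: integral_unique)
next
  case (const c)
  then show ?case by (simp add: mult.assoc mult.left_commute)
next
  case (add f g)
  have c: "continuous_on {0..1} (\<lambda>s. f (ee 1 s))" "continuous_on {0..1} (\<lambda>s. g (ee 1 s))"
    by (rule continuous_on_compose_ee, rule continuous_real_polymonial_function, rule add)+
  have int: "(\<lambda>s. \<phi> s * of_real (f (ee 1 s)) * ee (of_int n) s) integrable_on {0..1}"
     "(\<lambda>s. \<phi> s * of_real (g (ee 1 s)) * ee (of_int n) s) integrable_on {0..1}"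
    by (intro integrable_continuous_real continuous_intros add c)+
  show ?case using integral_add[OF int] add.IH[OF add.prems] by (simp add: algebra_simps)
next
  case (mult f g)
  have c: "continuous_on {0..1} (\<lambda>s. f (ee 1 s))"
    by (rule continuous_on_compose_ee, rule continuous_real_polymonial_function, rule mult)
  have "integral {0..1} (\<lambda>s. (\<phi> s * of_real (f (ee 1 s))) * of_real (g (ee 1 s)) * ee (of_int n) s) = 0"
    by (rule mult.IH(2)) (intro continuous_intros mult.prems c, rule mult.IH(1)[OF mult.prems])
  then show ?case by (simp add: algebra_simps)
qed

text \<open>Stone-Weierstrass on the circle: the conjugate of \<open>\<phi>\<close> is uniformly
  close to a polynomial function, and the integral of \<open>\<phi>\<close> against any such
  function is 0; hence the integral of its squared modulus is arbitrarily small.\<close>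

lemma fourier_uniqueness:
  fixes \<phi> :: "real \<Rightarrow> complex"
  assumes cont: "continuous_on {0..1} \<phi>" and per: "\<phi> 1 = \<phi> 0"
    and zero: "\<And>n::int. integral {0..1} (\<lambda>s. \<phi> s * ee (of_int n) s) = 0"
    and s: "s \<in> {0..1}"
  shows "\<phi> s = 0"
proof -
  let ?g = "\<phi> \<circ> (\<lambda>z. Arg2pi z / (2 * pi))"
  \<comment> \<open>The trivial homotopy yields continuity of \<open>?g\<close> on the whole circle,
    including at 1, where \<open>Arg2pi\<close> jumps.\<close>
  have "homotopic_loops UNIV \<phi> \<phi>"
    using cont per by (simp add: homotopic_loops_refl path_def pathfinish_def pathstart_def)
  from homotopic_loops_imp_homotopic_circlemaps[OF this]
  have cg: "continuous_on (sphere 0 1) ?g"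
    using homotopic_with_imp_continuous by blast
  have g_eq: "?g (ee 1 s) = \<phi> s" if "s \<in> {0..1}" for s
  proof (cases "s = 1")
    case True
    then have "ee 1 s = 1" using ee_int_1[of 1] by simp
    then show ?thesis using per True Arg2pi_of_real[of 1] by (simp del: ee_int_1)
  next
    case False
    then have "Arg2pi (ee 1 s) = 2 * pi * s"
      using that by (intro Arg2pi_unique[of 1]) (auto simp: ee_def algebra_simps)
    then show ?thesis by simp
  qed
  have bound: "integral {0..1} (\<lambda>s. norm (\<phi> s) ^ 2) \<le> e * integral {0..1} (\<lambda>s. norm (\<phi> s))" if e: "e > 0" for e
  proof -
    obtain p where p: "polynomial_function p"
       "\<And>x. x \<in> sphere 0 1 \<Longrightarrow> norm (cnj (?g x) - p x) < e"
      using Stone_Weierstrass_polynomial_function[OF compact_sphere continuous_on_cnj[OF cg] e]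
      by blast
    have rp: "real_polynomial_function (\<lambda>z. Re (p z))" "real_polynomial_function (\<lambda>z. Im (p z))"
      using p(1) bounded_linear_Re bounded_linear_Im
      unfolding polynomial_function_def o_def by blast+
    have pc: "continuous_on {0..1} (\<lambda>s. p (ee 1 s))"
      by (rule continuous_on_compose_ee, rule continuous_polymonial_function, rule p)
    have i1: "integral {0..1} (\<lambda>s. \<phi> s * of_real (Re (p (ee 1 s)))) = 0"
      using fourier_mult_real_polynomial[OF rp(1) cont zero, of 0] by simp
    have i2: "integral {0..1} (\<lambda>s. \<phi> s * of_real (Im (p (ee 1 s)))) = 0"
      using fourier_mult_real_polynomial[OF rp(2) cont zero, of 0] by simp
    have "integral {0..1} (\<lambda>s. \<phi> s * p (ee 1 s)) =
       integral {0..1} (\<lambda>s. \<phi> s * of_real (Re (p (ee 1 s))) + \<i> * (\<phi> s * of_real (Im (p (ee 1 s)))))"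
      by (intro integral_cong) (simp add: complex_eq_iff algebra_simps)
    also have "\<dots> = 0"
    proof (subst integral_add)
      show "(\<lambda>s. \<phi> s * of_real (Re (p (ee 1 s)))) integrable_on {0..1}"
        by (intro integrable_continuous_real continuous_intros cont pc)
      show "(\<lambda>s. \<i> * (\<phi> s * of_real (Im (p (ee 1 s))))) integrable_on {0..1}"
        by (intro integrable_continuous_real continuous_intros cont pc)
    qed (simp add: i1 i2)
    finally have i0: "integral {0..1} (\<lambda>s. \<phi> s * p (ee 1 s)) = 0" .
    have "complex_of_real (integral {0..1} (\<lambda>s. norm (\<phi> s) ^ 2)) = integral {0..1} (\<lambda>s. of_real (norm (\<phi> s) ^ 2))"
    proof -
      have "(\<lambda>s. norm (\<phi> s) ^ 2) integrable_on {0..1}"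
        by (intro integrable_continuous_real continuous_intros cont)
      from integral_linear[OF this bounded_linear_of_real[where 'a = complex]]
      show ?thesis by (simp only: o_def)
    qed
    also have "\<dots> = integral {0..1} (\<lambda>s. \<phi> s * cnj (\<phi> s)) - integral {0..1} (\<lambda>s. \<phi> s * p (ee 1 s))"
      by (simp only: complex_norm_square i0 diff_zero)
    also have "\<dots> = integral {0..1} (\<lambda>s. \<phi> s * cnj (\<phi> s) - \<phi> s * p (ee 1 s))"
      by (rule integral_diff[symmetric]; intro integrable_continuous_real continuous_intros cont pc)
    finally have eq: "complex_of_real (integral {0..1} (\<lambda>s. norm (\<phi> s) ^ 2)) = \<dots>" .
    have "norm (complex_of_real (integral {0..1} (\<lambda>s. norm (\<phi> s) ^ 2))) \<le> integral {0..1} (\<lambda>s. e * norm (\<phi> s))"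
      unfolding eq
    proof (rule integral_norm_bound_integral)
      fix s :: real assume s: "s \<in> {0..1}"
      have "norm (\<phi> s * cnj (\<phi> s) - \<phi> s * p (ee 1 s)) = norm (\<phi> s) * norm (cnj (?g (ee 1 s)) - p (ee 1 s))"
        using g_eq[OF s] by (simp flip: norm_mult add: algebra_simps)
      also have "\<dots> \<le> norm (\<phi> s) * e"
        using p(2)[of "ee 1 s"] norm_ee_of_int[of 1 s] by (intro mult_left_mono) (auto simp: less_imp_le)
      finally show "norm (\<phi> s * cnj (\<phi> s) - \<phi> s * p (ee 1 s)) \<le> e * norm (\<phi> s)" by (simp add: mult.commute)
    qed (intro integrable_continuous_real continuous_intros cont pc)+
    then show ?thesis by (simp add: integral_mult_right)
  qed
  have nn: "integral {0..1} (\<lambda>s. norm (\<phi> s) ^ 2) \<ge> 0"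
    by (intro integral_nonneg integrable_continuous_real continuous_intros cont) auto
  have nn2: "integral {0..1} (\<lambda>s. norm (\<phi> s)) \<ge> 0"
    by (intro integral_nonneg integrable_continuous_real continuous_intros cont) auto
  have "integral {0..1} (\<lambda>s. norm (\<phi> s) ^ 2) \<le> 0"
  proof (rule field_le_epsilon)
    fix e :: real assume e: "e > 0"
    define J where "J = integral {0..1} (\<lambda>s. norm (\<phi> s))"
    have J: "J \<ge> 0" using nn2 by (simp add: J_def)
    have "e / (J + 1) * J \<le> e" using e J by (simp add: field_simps)
    then show "integral {0..1} (\<lambda>s. norm (\<phi> s) ^ 2) \<le> 0 + e"
      using bound[of "e / (J + 1)"] e J unfolding J_def[symmetric] by (simp add: divide_pos_pos)
  qed
  with nn have "integral {0..1} (\<lambda>s. norm (\<phi> s) ^ 2) = 0" by simp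
  then have "((\<lambda>s. norm (\<phi> s) ^ 2) has_integral 0) (cbox 0 1)"
    using integrable_integral[OF integrable_continuous_real[of 0 1 "\<lambda>s. norm (\<phi> s) ^ 2"]] cont
    by (simp add: continuous_on_power continuous_on_norm)
  then have "norm (\<phi> s) ^ 2 = 0"
    using s by (intro has_integral_0_cbox_imp_0[of 0 1 "\<lambda>s. norm (\<phi> s) ^ 2"])
       (auto intro!: continuous_intros cont)
  then show ?thesis by simp
qed

section \<open>Three-term recurrences\<close>

definition quad :: "(nat \<Rightarrow> nat \<Rightarrow> complex) \<Rightarrow> nat \<Rightarrow> complex \<Rightarrow> complex" where
  "quad k i \<rho> = k i 0 + k i 1 * \<rho> + k i 2 * \<rho>\<^sup>2"

definition euler_op :: "(nat \<Rightarrow> nat \<Rightarrow> complex) \<Rightarrow> complex \<Rightarrow> complex \<Rightarrow> complex \<Rightarrow> complex \<Rightarrow> complex" where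
  "euler_op k x y0 y1 y2 = (\<Sum>i\<le>2. x ^ i * (k i 0 * y0 + k i 1 * y1 + k i 2 * y2))"

text \<open>
  With \<open>\<theta> = x d/dx\<close> and \<open>P\<^sub>i = quad k i\<close>, the equation \<open>(\<Sum>i\<le>2. x^i P\<^sub>i(\<theta>)) y = 0\<close> reads
  \<open>euler_op k x y (\<theta> y) (\<theta>\<^sup>2 y) = 0\<close>, and \<open>frob_at k \<mu> c n\<close> says that the coefficient of
  \<open>x^(\<mu> + n)\<close> vanishes for \<open>y = \<Sum>n. c n x^(\<mu> + n)\<close>.
\<close>

definition frob_at :: "(nat \<Rightarrow> nat \<Rightarrow> complex) \<Rightarrow> complex \<Rightarrow> (int \<Rightarrow> complex) \<Rightarrow> int \<Rightarrow> bool" where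
  "frob_at k \<mu> c n \<longleftrightarrow> (\<Sum>i\<le>2. quad k i (\<mu> + of_int (n - int i)) * c (n - int i)) = 0"

lemma sum_le_2: "(\<Sum>i\<le>2. f i) = f 0 + f 1 + f (2::nat)"
  by (simp add: numeral_2_eq_2)

text \<open>
  Both characteristic roots lie inside the unit disc, so going backwards a nonzero solution would
  grow: the suprema over \<open>{..n}\<close> of \<open>b\<close> and of \<open>b n - e b (n - 1)\<close> bound each other with total factor below 1.
\<close>

lemma bounded_recurrence_vanishes:
  fixes b p q :: "int \<Rightarrow> complex"
  assumes rec: "\<And>n. n \<le> m \<Longrightarrow> b n = p n * b (n - 1) + q n * b (n - 2)"
    and bdd: "\<And>n. norm (b n) \<le> M"
    and p: "(p \<longlongrightarrow> e + f) at_bot" and q: "(q \<longlongrightarrow> - (e * f)) at_bot"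
    and e: "norm e < 1" and f: "norm f < 1"
  shows "\<exists>n1. \<forall>n\<le>n1. b n = 0"
proof -
  \<comment> \<open>Chosen so that \<open>T\<close> is at most \<open>(1 - norm e) / 2 * S\<close>;
    with \<open>S \<le> norm e * S + T\<close> this leaves \<open>S \<le> 0\<close>.\<close>
  define \<delta> where "\<delta> = (1 - norm e) * (1 - norm f) / 4"
  have \<delta>: "\<delta> > 0" using e f by (simp add: \<delta>_def)
  have "\<forall>\<^sub>F n in at_bot. dist (p n) (e + f) < \<delta> \<and> dist (q n) (- (e * f)) < \<delta> \<and> n \<le> m"
    using tendstoD[OF p \<delta>] tendstoD[OF q \<delta>] eventually_le_at_bot[of m] by eventually_elim auto
  then obtain n1 where n1: "\<And>n. n \<le> n1 \<Longrightarrow> norm (p n - (e + f)) < \<delta> \<and> norm (q n + e * f) < \<delta> \<and> n \<le> m"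
    unfolding eventually_at_bot_linorder by (auto simp: dist_norm)
  define B where "B = (\<lambda>n. norm (b n)) ` {..n1}"
  define S where "S = Sup B"
  have bdd_B: "bdd_above B" using bdd by (auto simp: B_def bdd_above_def)
  have S: "norm (b n) \<le> S" if "n \<le> n1" for n
    unfolding S_def using that by (intro cSup_upper bdd_B) (auto simp: B_def)
  \<comment> \<open>The limiting characteristic polynomial is (X - e)(X - f). Splitting off X - e
    leaves for \<open>d\<close> a first-order recurrence with factor \<open>f\<close>, up to errors
    controlled by \<open>\<delta>\<close>.\<close>
  define d where "d n = b n - e * b (n - 1)" for n
  define D where "D = (\<lambda>n. norm (d n)) ` {..n1}"
  define T where "T = Sup D"
  have "norm (d n) \<le> M + norm e * M" for n
    unfolding d_def using norm_triangle_ineq4[of "b n" "e * b (n - 1)"] bdd[of n]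
      mult_left_mono[OF bdd[of "n - 1"], of "norm e"] by (simp add: norm_mult)
  then have bdd_D: "bdd_above D" by (auto simp: D_def bdd_above_def)
  have T: "norm (d n) \<le> T" if "n \<le> n1" for n
    unfolding T_def using that by (intro cSup_upper bdd_D) (auto simp: D_def)
  have S0: "S \<ge> 0" using S[of n1] norm_ge_zero[of "b n1"] by linarith
  have "norm (d n) \<le> norm f * T + 2 * \<delta> * S" if n: "n \<le> n1" for n
  proof -
    have "d n = f * d (n - 1) + ((p n - (e + f)) * b (n - 1) + (q n + e * f) * b (n - 2))"
      using rec[of n] n1[OF n] by (simp add: d_def algebra_simps)
    then have "norm (d n) \<le> norm (f * d (n - 1)) + (norm ((p n - (e + f)) * b (n - 1)) + norm ((q n + e * f) * b (n - 2)))"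
      by (metis add_left_mono norm_triangle_ineq order_trans)
    also have "\<dots> \<le> norm f * T + (\<delta> * S + \<delta> * S)"
      unfolding norm_mult using n1[OF n] T[of "n-1"] S[of "n-1"] S[of "n-2"] n \<delta>
      by (intro add_mono mult_mono) auto
    finally show ?thesis by (simp add: mult_ac)
  qed
  then have "T \<le> norm f * T + 2 * \<delta> * S"
    unfolding T_def D_def by (intro cSup_least) auto
  then have "T * (1 - norm f) \<le> ((1 - norm e) / 2 * S) * (1 - norm f)" by (simp add: \<delta>_def field_simps)
  then have T2: "T \<le> (1 - norm e) / 2 * S" using f by simp
  have "norm (b n) \<le> norm e * S + T" if n: "n \<le> n1" for n
  proof -
    have "b n = e * b (n - 1) + d n" by (simp add: d_def)
    then have "norm (b n) \<le> norm e * norm (b (n - 1)) + norm (d n)"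
      by (metis norm_mult norm_triangle_ineq)
    also have "\<dots> \<le> norm e * S + T" using S[of "n-1"] T[of n] n by (intro add_mono mult_left_mono) auto
    finally show ?thesis .
  qed
  then have "S \<le> norm e * S + T" unfolding S_def B_def by (intro cSup_least) auto
  with T2 have "S * (1 - norm e) \<le> 0" by (simp add: field_simps)
  then have "S \<le> 0" using e by (simp add: mult_le_0_iff)
  then have "b n = 0" if "n \<le> n1" for n
    using S[OF that] by (metis norm_le_zero_iff order_trans)
  then show ?thesis by blast
qed

text \<open>The filter is arbitrary because the same limit serves integers tending to minus infinity
  and natural numbers tending to infinity.\<close>

lemma quad_ratio_tendsto:
  assumes k: "k 0 2 \<noteq> 0" and inf: "filterlim g at_infinity F"
  shows "((\<lambda>n. quad k i (\<mu> + (g n - j)) / quad k 0 (\<mu> + g n)) \<longlongrightarrow> k i 2 / k 0 2) F"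
proof -
  have inv: "((\<lambda>n. inverse (g n)) \<longlongrightarrow> 0) F"
    by (rule filterlim_compose[OF tendsto_inverse_0 inf])
  have ne: "\<forall>\<^sub>F n in F. g n \<noteq> 0"
    using filterlim_at_infinity_imp_eventually_ne[OF inf] .
  have lim: "((\<lambda>n. quad k i (\<mu> + (g n - j)) / g n ^ 2) \<longlongrightarrow> k i 2) F" for i j
  proof -
    have "((\<lambda>n. k i 0 * inverse (g n) ^ 2 + k i 1 * inverse (g n) * ((\<mu> - j) * inverse (g n) + 1)
       + k i 2 * ((\<mu> - j) * inverse (g n) + 1) ^ 2) \<longlongrightarrow>
       k i 0 * 0 ^ 2 + k i 1 * 0 * ((\<mu> - j) * 0 + 1) + k i 2 * ((\<mu> - j) * 0 + 1) ^ 2) F"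
      by (intro tendsto_intros inv)
    moreover have "\<forall>\<^sub>F n in F. k i 0 * inverse (g n) ^ 2 + k i 1 * inverse (g n) * ((\<mu> - j) * inverse (g n) + 1)
       + k i 2 * ((\<mu> - j) * inverse (g n) + 1) ^ 2 = quad k i (\<mu> + (g n - j)) / g n ^ 2"
      using ne by eventually_elim (simp add: quad_def field_simps power2_eq_square)
    ultimately show ?thesis by (auto dest: Lim_transform_eventually)
  qed
  have "((\<lambda>n. (quad k i (\<mu> + (g n - j)) / g n ^ 2) / (quad k 0 (\<mu> + (g n - 0)) / g n ^ 2)) \<longlongrightarrow> k i 2 / k 0 2) F"
    by (intro tendsto_divide lim k)
  moreover have "\<forall>\<^sub>F n in F. (quad k i (\<mu> + (g n - j)) / g n ^ 2) / (quad k 0 (\<mu> + (g n - 0)) / g n ^ 2)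
     = quad k i (\<mu> + (g n - j)) / quad k 0 (\<mu> + g n)"
    using ne by eventually_elim auto
  ultimately show ?thesis by (rule Lim_transform_eventually)
qed

lemma filterlim_complex_of_int_at_bot: "filterlim complex_of_int at_infinity at_bot"
  unfolding filterlim_at_infinity_conv_norm_at_top filterlim_at_top
proof
  fix Z :: real
  show "\<forall>\<^sub>F n in at_bot. Z \<le> norm (complex_of_int n)"
    using eventually_le_at_bot[of "- \<lceil>\<bar>Z\<bar>\<rceil>"]
  proof eventually_elim
    case (elim n)
    then have "\<bar>Z\<bar> \<le> of_int (- n)" using le_of_int_ceiling[of "\<bar>Z\<bar>"] by linarith
    then show ?case by (simp add: norm_of_int)
  qed
qed

text \<open>The second-order terms add up to \<open>k 0 2 * (1 - e * x) * (1 - f * x)\<close>, so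
  \<open>e\<close> and \<open>f\<close> are the reciprocals of the other singular points, and the
  last two assumptions place these outside the circle of radius \<open>r\<close>. After scaling by
  \<open>r powi n\<close> the characteristic roots become \<open>e * r\<close> and
  \<open>f * r\<close>.\<close>

lemma frob_bounded_below:
  assumes rec: "\<And>n. frob_at k \<mu> c n" and bdd: "\<And>n::int. norm (c n * of_real r powi n) \<le> M" and r: "r > 0"
    and k: "k 0 2 \<noteq> 0" and ef: "k 1 2 = - k 0 2 * (e + f)" "k 2 2 = k 0 2 * (e * f)"
    and e: "norm e * r < 1" and f: "norm f * r < 1"
  shows "\<exists>n1. \<forall>n\<le>n1. c n = 0"
proof -
  define b where "b n = c n * of_real r powi n" for n
  define P where "P n i = quad k i (\<mu> + of_int (n - int i)) / quad k 0 (\<mu> + of_int n)" for n i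
  define R where "R = complex_of_real r"
  have R: "R \<noteq> 0" using r by (simp add: R_def)
  have lim: "((\<lambda>n. P n i) \<longlongrightarrow> k i 2 / k 0 2) at_bot" for i
    unfolding P_def of_int_diff by (rule quad_ratio_tendsto[OF _ filterlim_complex_of_int_at_bot]) (fact k)
  have "\<forall>\<^sub>F n in at_bot. P n 0 \<noteq> 0"
    by (rule tendsto_imp_eventually_ne[OF lim]) (use k in auto)
  then have "\<forall>\<^sub>F n in at_bot. quad k 0 (\<mu> + of_int n) \<noteq> 0"
    by (rule eventually_mono) (auto simp: P_def)
  then obtain n0 where n0: "\<And>n. n \<le> n0 \<Longrightarrow> quad k 0 (\<mu> + of_int n) \<noteq> 0"
    unfolding eventually_at_bot_linorder by blast
  have "\<exists>n1. \<forall>n\<le>n1. b n = 0"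
  proof (rule bounded_recurrence_vanishes[where m = n0 and p = "\<lambda>n. - P n 1 * R" and q = "\<lambda>n. - P n 2 * R ^ 2" and e = "e * R" and f = "f * R" and M = M])
    fix n assume n: "n \<le> n0"
    have "quad k 0 (\<mu> + of_int n) * c n =
      - (quad k 1 (\<mu> + of_int (n - 1)) * c (n - 1) + quad k 2 (\<mu> + of_int (n - 2)) * c (n - 2))"
      using rec[of n] unfolding frob_at_def sum_le_2 by (subst eq_neg_iff_add_eq_0) (simp add: add.assoc)
    then have "c n = - P n 1 * c (n - 1) - P n 2 * c (n - 2)"
      using n0[OF n] by (simp add: P_def field_simps)
    moreover have R2: "R powi n = R powi (n - 2) * R ^ 2" "R powi (n - 1) = R powi (n - 2) * R"
      using R by (simp_all add: power_int_diff power2_eq_square)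
    ultimately show "b n = - P n 1 * R * b (n - 1) + - P n 2 * R\<^sup>2 * b (n - 2)"
      unfolding b_def R_def[symmetric] R2 by (simp only:) (simp add: algebra_simps power2_eq_square)
  next
    have "- (k 1 2 / k 0 2) * R = e * R + f * R" "- (k 2 2 / k 0 2) * R ^ 2 = - (e * R * (f * R))"
      unfolding ef using k by (simp_all add: field_simps power2_eq_square)
    moreover have "((\<lambda>n. - P n 1 * R) \<longlongrightarrow> - (k 1 2 / k 0 2) * R) at_bot"
      "((\<lambda>n. - P n 2 * R ^ 2) \<longlongrightarrow> - (k 2 2 / k 0 2) * R ^ 2) at_bot"
      by (intro tendsto_intros lim)+
    ultimately show "((\<lambda>n. - P n 1 * R) \<longlongrightarrow> e * R + f * R) at_bot"
      "((\<lambda>n. - P n 2 * R ^ 2) \<longlongrightarrow> - (e * R * (f * R))) at_bot"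
      by simp_all
  qed (use bdd e f r in \<open>auto simp: b_def R_def norm_mult\<close>)
  then show ?thesis using r by (auto simp: b_def)
qed

text \<open>Above two vanishing neighbours the recurrence reduces to its leading term, so a nonzero
  coefficient can first appear only at a root of \<open>quad k 0\<close>.\<close>

lemma frob_vanish:
  assumes rec: "\<And>n. frob_at k \<mu> c n" and z: "\<forall>n\<le>n1. c n = 0"
    and nz: "\<And>n. n \<le> N \<Longrightarrow> quad k 0 (\<mu> + of_int n) \<noteq> 0 \<or> c n = 0" and n: "n \<le> N"
  shows "c n = 0"
proof -
  have "n \<le> N \<longrightarrow> c n = 0" for n
  proof (cases "n \<le> n1")
    case False
    then have "n1 \<le> n" by simp
    then have "\<forall>m\<le>n. m \<le> N \<longrightarrow> c m = 0"
    proof (induction n rule: int_ge_induct)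
      case (step i)
      show ?case
      proof (intro allI impI)
        fix m assume m: "m \<le> i + 1" "m \<le> N"
        show "c m = 0"
        proof (cases "m = i + 1")
          case True
          then have "c (m - 1) = 0" "c (m - 2) = 0" using step.IH m by auto
          then show ?thesis using rec[of m] nz[OF m(2)] by (auto simp: frob_at_def sum_le_2)
        qed (use step.IH m in auto)
      qed
    qed (use z in auto)
    then show ?thesis by auto
  qed (use z in auto)
  then show ?thesis using n by blast
qed

section \<open>Fourier coefficients of a solution along a circle\<close>

lemma has_vector_derivative_imp_cont01:
  "(\<And>s. s \<in> {0..1::real} \<Longrightarrow> (f has_vector_derivative f' s) (at s within {0..1})) \<Longrightarrow> continuous_on {0..1} (f :: real \<Rightarrow> complex)"
  by (meson continuous_on_eq_continuous_within has_vector_derivative_continuous)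

lemma ee_neg_cancel: "ee \<mu> s * ee (- \<mu>) s = 1"
  by (simp flip: ee_add)

text \<open>The boundary term cancels because the twist by \<open>- \<mu>\<close> undoes the factor
  that \<open>f\<close> picks up in one turn. This is why the Euler operator acts on the n-th
  coefficient as multiplication by \<open>\<mu> + of_int n\<close>.\<close>

lemma ee_ibp:
  fixes f g :: "real \<Rightarrow> complex" and n :: int
  assumes d: "\<And>s. s \<in> {0..1} \<Longrightarrow> (f has_vector_derivative (2 * of_real pi * \<i> * g s)) (at s within {0..1})"
    and g: "continuous_on {0..1} g" and f1: "f 1 = ee \<mu> 1 * f 0"
  shows "integral {0..1} (\<lambda>s. g s * ee (- (\<mu> + of_int n)) s) = (\<mu> + of_int n) * integral {0..1} (\<lambda>s. f s * ee (- (\<mu> + of_int n)) s)"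
proof -
  define \<nu> where "\<nu> = - (\<mu> + of_int n)"
  have f: "continuous_on {0..1} f" by (rule has_vector_derivative_imp_cont01[OF d])
  have 1: "((\<lambda>s. 2 * of_real pi * \<i> * (g s * ee \<nu> s + \<nu> * (f s * ee \<nu> s))) has_integral (f 1 * ee \<nu> 1 - f 0 * ee \<nu> 0)) {0..1}"
  proof (rule fundamental_theorem_of_calculus)
    fix s :: real assume s: "s \<in> {0..1}"
    have e: "(ee \<nu> has_vector_derivative 2 * of_real pi * \<i> * \<nu> * ee \<nu> s) (at s within {0..1})"
      by (rule ee_has_vector_derivative)
    show "((\<lambda>s. f s * ee \<nu> s) has_vector_derivative 2 * of_real pi * \<i> * (g s * ee \<nu> s + \<nu> * (f s * ee \<nu> s))) (at s within {0..1})"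
      using has_vector_derivative_mult[OF d[OF s] e] by (simp add: algebra_simps)
  qed simp
  have "f 1 * ee \<nu> 1 = f 0"
  proof -
    have "ee \<nu> 1 = ee (- \<mu>) 1" unfolding \<nu>_def minus_add_distrib
      by (subst ee_add) (metis ee_int_1 mult.right_neutral of_int_minus)
    then show ?thesis by (simp add: f1 mult.commute mult.left_commute ee_neg_cancel flip: mult.assoc)
  qed
  with 1 have "((\<lambda>s. 2 * of_real pi * \<i> * (g s * ee \<nu> s + \<nu> * (f s * ee \<nu> s))) has_integral 0) {0..1}" by simp
  from has_integral_mult_right[OF this, of "1 / (2 * of_real pi * \<i>)"]
  have "integral {0..1} (\<lambda>s. g s * ee \<nu> s + \<nu> * (f s * ee \<nu> s)) = 0"
    by (simp add: integral_unique)
  moreover have "integral {0..1} (\<lambda>s. g s * ee \<nu> s + \<nu> * (f s * ee \<nu> s)) =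
     integral {0..1} (\<lambda>s. g s * ee \<nu> s) + \<nu> * integral {0..1} (\<lambda>s. f s * ee \<nu> s)"
    by (subst integral_add) (auto intro!: integrable_continuous_real continuous_intros f g)
  ultimately show ?thesis unfolding \<nu>_def[symmetric] by (simp add: \<nu>_def eq_neg_iff_add_eq_0 add_eq_0_iff algebra_simps)
qed

text \<open>Along \<open>x = r * ee 1 s\<close> this is the coefficient of
  \<open>x^(\<mu> + n)\<close> in \<open>f\<close>, up to the constant factor
  \<open>r^\<mu>\<close>, which a linear recurrence does not see.\<close>

definition fcoeff :: "real \<Rightarrow> complex \<Rightarrow> (real \<Rightarrow> complex) \<Rightarrow> int \<Rightarrow> complex" where
  "fcoeff r \<mu> f n = integral {0..1} (\<lambda>s. f s * ee (- (\<mu> + of_int n)) s) * of_real r powi (- n)"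

text \<open>The functions \<open>f\<close>, \<open>g\<close>, \<open>h\<close> stand for y and its
  first two images under the Euler operator, which on the circle is d/ds divided by 2 pi i. The
  factor \<open>x ^ i\<close> moves the index from \<open>n\<close> to \<open>n - i\<close>, so
  integrating the equation against each character gives the recurrence.\<close>

lemma fcoeff_frob:
  fixes f g h :: "real \<Rightarrow> complex"
  assumes df: "\<And>s. s \<in> {0..1} \<Longrightarrow> (f has_vector_derivative (2 * of_real pi * \<i> * g s)) (at s within {0..1})"
    and dg: "\<And>s. s \<in> {0..1} \<Longrightarrow> (g has_vector_derivative (2 * of_real pi * \<i> * h s)) (at s within {0..1})"
    and h: "continuous_on {0..1} h"
    and f1: "f 1 = ee \<mu> 1 * f 0" and g1: "g 1 = ee \<mu> 1 * g 0"
    and ode: "\<And>s. s \<in> {0..1} \<Longrightarrow> euler_op k (of_real r * ee 1 s) (f s) (g s) (h s) = 0" and r: "r > 0"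
  shows "frob_at k \<mu> (fcoeff r \<mu> f) n"
proof -
  have f: "continuous_on {0..1} f" by (rule has_vector_derivative_imp_cont01[OF df])
  have g: "continuous_on {0..1} g" by (rule has_vector_derivative_imp_cont01[OF dg])
  define I where "I y n = integral {0..1} (\<lambda>s. y s * ee (- (\<mu> + of_int n)) s)" for y :: "real \<Rightarrow> complex" and n :: int
  have Ig: "I g m = (\<mu> + of_int m) * I f m" for m unfolding I_def by (rule ee_ibp[OF df g f1])
  have Ih: "I h m = (\<mu> + of_int m)\<^sup>2 * I f m" for m
    using ee_ibp[OF dg h g1, of m] Ig[of m] by (simp add: I_def power2_eq_square)
  have trm: "((\<lambda>s. (of_real r * ee 1 s) ^ i * (k i 0 * f s + k i 1 * g s + k i 2 * h s) * ee (- (\<mu> + of_int n)) s)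
      has_integral of_real r ^ i * (quad k i (\<mu> + of_int (n - int i)) * I f (n - int i))) {0..1}" for i
  proof -
    have e: "ee 1 s ^ i * ee (- (\<mu> + of_int n)) s = ee (- (\<mu> + of_int (n - int i))) s" for s
      by (simp add: ee_def algebra_simps flip: exp_add exp_of_nat_mult)
    have int: "((\<lambda>s. y s * ee (- (\<mu> + of_int (n - int i))) s) has_integral I y (n - int i)) {0..1}" if "continuous_on {0..1} y" for y
      unfolding I_def by (intro integrable_integral integrable_continuous_real continuous_intros that)
    have "((\<lambda>s. of_real r ^ i * (k i 0 * (f s * ee (- (\<mu> + of_int (n - int i))) s) + k i 1 * (g s * ee (- (\<mu> + of_int (n - int i))) s) + k i 2 * (h s * ee (- (\<mu> + of_int (n - int i))) s)))
      has_integral of_real r ^ i * (k i 0 * I f (n - int i) + k i 1 * I g (n - int i) + k i 2 * I h (n - int i))) {0..1}"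
      by (intro has_integral_mult_right has_integral_add int f g h)
    moreover have "of_real r ^ i * (k i 0 * (f s * ee (- (\<mu> + of_int (n - int i))) s) + k i 1 * (g s * ee (- (\<mu> + of_int (n - int i))) s) + k i 2 * (h s * ee (- (\<mu> + of_int (n - int i))) s))
      = (of_real r * ee 1 s) ^ i * (k i 0 * f s + k i 1 * g s + k i 2 * h s) * ee (- (\<mu> + of_int n)) s" for s
      unfolding e[symmetric] power_mult_distrib by (simp only: ring_distribs mult_ac)
    moreover have "k i 0 * I f (n - int i) + k i 1 * I g (n - int i) + k i 2 * I h (n - int i) =
      quad k i (\<mu> + of_int (n - int i)) * I f (n - int i)"
      unfolding Ig Ih quad_def by (simp only: ring_distribs mult_ac)
    ultimately show ?thesis by simp
  qed
  have "((\<lambda>s. \<Sum>i\<le>2. (of_real r * ee 1 s) ^ i * (k i 0 * f s + k i 1 * g s + k i 2 * h s) * ee (- (\<mu> + of_int n)) s)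
      has_integral (\<Sum>i\<le>2. of_real r ^ i * (quad k i (\<mu> + of_int (n - int i)) * I f (n - int i)))) {0..1}"
    by (intro has_integral_sum trm) auto
  note h1 = this
  have h2: "(\<Sum>i\<le>2. (of_real r * ee 1 s) ^ i * (k i 0 * f s + k i 1 * g s + k i 2 * h s) * ee (- (\<mu> + of_int n)) s) = 0" if "s \<in> {0..1}" for s
    using ode[OF that] by (simp flip: sum_distrib_right add: euler_op_def)
  have "((\<lambda>s::real. 0) has_integral (\<Sum>i\<le>2. of_real r ^ i * (quad k i (\<mu> + of_int (n - int i)) * I f (n - int i)))) {0..1}"
    by (rule has_integral_eq[OF h2 h1])
  then have "(\<Sum>i\<le>2. complex_of_real r ^ i * (quad k i (\<mu> + of_int (n - int i)) * I f (n - int i))) = 0"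
    by (rule has_integral_unique[OF _ has_integral_0])
  moreover have "quad k i (\<mu> + of_int (n - int i)) * fcoeff r \<mu> f (n - int i) = 
     of_real r powi (- n) * (of_real r ^ i * (quad k i (\<mu> + of_int (n - int i)) * I f (n - int i)))" for i
  proof -
    have "complex_of_real r powi (- (n - int i)) = of_real r powi (- n) * of_real r ^ i"
      using r by (simp add: power_int_diff power_int_minus field_simps)
    then show ?thesis unfolding fcoeff_def I_def[symmetric] by (simp add: algebra_simps)
  qed
  ultimately show ?thesis unfolding frob_at_def by (simp only: sum_distrib_left [symmetric] mult_zero_right)
qed

text \<open>The bound is uniform in \<open>n\<close>, as \<open>frob_bounded_below\<close>
  requires.\<close>

lemma fcoeff_bound:
  assumes f: "continuous_on {0..1} f" and r: "r > 0"
  shows "norm (fcoeff r \<mu> f n * of_real r powi n) \<le> integral {0..1} (\<lambda>s. norm (f s * ee (- \<mu>) s))"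
proof -
  have ee: "ee (- (\<mu> + of_int n)) s = ee (- \<mu>) s * ee (- of_int n) s" for s
    by (simp flip: ee_add)
  have "norm (fcoeff r \<mu> f n * of_real r powi n) = norm (integral {0..1} (\<lambda>s. f s * ee (- (\<mu> + of_int n)) s))"
    using r by (simp add: fcoeff_def power_int_minus field_simps)
  also have "\<dots> \<le> integral {0..1} (\<lambda>s. norm (f s * ee (- \<mu>) s))"
    by (intro integral_norm_bound_integral integrable_continuous_real continuous_intros f)
       (simp only: ee norm_mult norm_ee_of_int mult_1_right order_refl)
  finally show ?thesis .
qed

lemma fcoeff_uniqueness:
  assumes f: "continuous_on {0..1} f" and f1: "f 1 = ee \<mu> 1 * f 0" and r: "r > 0"
    and z: "\<And>n. fcoeff r \<mu> f n = 0" and s: "s \<in> {0..1}"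
  shows "f s = 0"
proof -
  have "f s * ee (- \<mu>) s = 0"
  proof (rule fourier_uniqueness[where \<phi> = "\<lambda>s. f s * ee (- \<mu>) s"])
    fix n :: int
    have "integral {0..1} (\<lambda>s. f s * ee (- (\<mu> + of_int (- n))) s) = 0"
      using z[of "- n"] r by (simp add: fcoeff_def)
    then show "integral {0..1} (\<lambda>s. f s * ee (- \<mu>) s * ee (of_int n) s) = 0"
      by (simp add: mult.assoc flip: ee_add)
  next
    show "f 1 * ee (- \<mu>) 1 = f 0 * ee (- \<mu>) 0"
      using ee_neg_cancel[of \<mu> 1] by (simp add: f1)
  qed (use s in \<open>auto intro!: continuous_intros f\<close>)
  then show ?thesis using ee_neg_cancel[of \<mu> s] by auto
qed

lemma fcoeff_linear:
  assumes "continuous_on {0..1} f" "continuous_on {0..1} g"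
  shows "fcoeff r \<mu> (\<lambda>s. x * f s + y * g s) n = x * fcoeff r \<mu> f n + y * fcoeff r \<mu> g n"
proof -
  have "((\<lambda>s. x * (f s * ee (- (\<mu> + of_int n)) s) + y * (g s * ee (- (\<mu> + of_int n)) s)) has_integral
    x * integral {0..1} (\<lambda>s. f s * ee (- (\<mu> + of_int n)) s) + y * integral {0..1} (\<lambda>s. g s * ee (- (\<mu> + of_int n)) s)) {0..1}"
    by (intro has_integral_add has_integral_mult_right integrable_integral integrable_continuous_real continuous_intros assms)
  then show ?thesis by (simp add: fcoeff_def integral_unique algebra_simps)
qed

lemma frob_at_linear:
  "frob_at k \<mu> c n \<Longrightarrow> frob_at k \<mu> d n \<Longrightarrow> frob_at k \<mu> (\<lambda>n. x * c n + y * d n) n"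
proof -
  assume 1: "frob_at k \<mu> c n" and 2: "frob_at k \<mu> d n"
  have "(\<Sum>i\<le>2. quad k i (\<mu> + of_int (n - int i)) * (x * c (n - int i) + y * d (n - int i))) =
     x * (\<Sum>i\<le>2. quad k i (\<mu> + of_int (n - int i)) * c (n - int i)) + y * (\<Sum>i\<le>2. quad k i (\<mu> + of_int (n - int i)) * d (n - int i))"
    by (simp add: sum_le_2 algebra_simps)
  then show ?thesis using 1 2 by (simp add: frob_at_def)
qed

text \<open>
  The Fourier coefficients of a solution satisfy the recurrence and are bounded, so they vanish far
  to the left and start at an indicial root. Two independent solutions cannot both start at the upper root.
\<close>

lemma scalar_monodromy_imp_frob:
  fixes f g h :: "bool \<Rightarrow> real \<Rightarrow> complex" and N :: nat
  assumes df: "\<And>j s. s \<in> {0..1} \<Longrightarrow> (f j has_vector_derivative (2 * of_real pi * \<i> * g j s)) (at s within {0..1})"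
    and dg: "\<And>j s. s \<in> {0..1} \<Longrightarrow> (g j has_vector_derivative (2 * of_real pi * \<i> * h j s)) (at s within {0..1})"
    and h: "\<And>j. continuous_on {0..1} (h j)"
    and \<kappa>: "\<kappa> \<noteq> 0" and f1: "\<And>j. f j 1 = \<kappa> * f j 0" and g1: "\<And>j. g j 1 = \<kappa> * g j 0"
    and ode: "\<And>j s. s \<in> {0..1} \<Longrightarrow> euler_op k (of_real r * ee 1 s) (f j s) (g j s) (h j s) = 0" and r: "r > 0"
    and ind: "\<And>x y. (\<And>s. s \<in> {0..1} \<Longrightarrow> x * f True s + y * f False s = 0) \<Longrightarrow> x = 0 \<and> y = 0"
    and quad0: "\<And>\<rho>. quad k 0 \<rho> = k 0 2 * (\<rho> - \<mu>) * (\<rho> - \<mu> - of_nat N)" and N: "N > 0"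
    and k: "k 0 2 \<noteq> 0" and ef: "k 1 2 = - k 0 2 * (u + v)" "k 2 2 = k 0 2 * (u * v)"
    and u: "norm u * r < 1" and v: "norm v * r < 1"
  shows "\<exists>c. (\<forall>n<0. c n = 0) \<and> c 0 \<noteq> 0 \<and> (\<forall>n. frob_at k \<mu> c n)"
proof -
  \<comment> \<open>Any logarithm of the scalar serves as exponent; it is fixed only up to an
    integer.\<close>
  define \<nu> where "\<nu> = Ln \<kappa> / (2 * of_real pi * \<i>)"
  have \<nu>: "ee \<nu> 1 = \<kappa>" using \<kappa> by (simp add: ee_def \<nu>_def)
  have f: "continuous_on {0..1} (f j)" for j by (rule has_vector_derivative_imp_cont01[OF df])
  define C where "C j = fcoeff r \<nu> (f j)" for j
  have fC: "frob_at k \<nu> (C j) n" for j n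
    unfolding C_def by (rule fcoeff_frob[OF df dg h _ _ ode r]) (use \<nu> f1 g1 in auto)
  have low: "\<exists>m. \<forall>n\<le>m. C j n = 0" for j
    by (rule frob_bounded_below[OF fC _ r k ef u v]) (unfold C_def, rule fcoeff_bound[OF f r])
  have zero: "f j s = 0" if "\<And>n. C j n = 0" "s \<in> {0..1}" for j s
    by (rule fcoeff_uniqueness[OF f _ r]) (use \<nu> f1 that in \<open>auto simp: C_def\<close>)
  have "\<exists>n. C True n \<noteq> 0" using zero[of True] ind[of 1 0] by auto
  then obtain n where n: "C True n \<noteq> 0" by blast
  from low obtain m where m: "\<forall>n\<le>m. C True n = 0" by blast
  \<comment> \<open>A nonzero series must begin at an indicial root, so \<open>\<nu>\<close> differs
    from \<open>\<mu>\<close> by an integer and the coefficients can be reindexed relative to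
    \<open>\<mu>\<close>.\<close>
  have "\<exists>i. quad k 0 (\<nu> + of_int i) = 0"
    using frob_vanish[OF fC m, of n n] n by auto
  then obtain i where "\<nu> + of_int i - \<mu> = 0 \<or> \<nu> + of_int i - \<mu> - of_nat N = 0"
    unfolding quad0 using k by auto
  then have "\<nu> = \<mu> + of_int (- i) \<or> \<nu> = \<mu> + of_int (int N - i)"
    by (auto simp: algebra_simps eq_diff_eq)
  then obtain d :: int where d: "\<nu> = \<mu> + of_int d" by blast
  define c where "c j n = C j (n - d)" for j n
  have fc: "frob_at k \<mu> (c j) n" for j n
    using fC[of j "n - d"] by (simp add: frob_at_def c_def d algebra_simps)
  have lowc: "\<exists>m. \<forall>n\<le>m. c j n = 0" for j
  proof -
    from low obtain m where "\<forall>n\<le>m. C j n = 0" by blast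
    then show ?thesis by (intro exI[of _ "m + d"]) (simp add: c_def)
  qed
  have q0: "quad k 0 (\<mu> + of_int n) = 0 \<longleftrightarrow> n = 0 \<or> n = int N" for n
  proof -
    have "quad k 0 (\<mu> + of_int n) = k 0 2 * of_int n * of_int (n - int N)" by (simp add: quad0)
    moreover have "complex_of_int n = of_nat N \<longleftrightarrow> n = int N"
      by (metis of_int_eq_iff of_int_of_nat_eq)
    ultimately show ?thesis using k by auto
  qed
  have neg: "c j n = 0" if "n < 0" for j n
  proof -
    from lowc obtain m where m: "\<forall>n\<le>m. c j n = 0" by blast
    show ?thesis by (rule frob_vanish[OF fc m, of "-1"]) (use that q0 in auto)
  qed
  have "\<exists>j. c j 0 \<noteq> 0"
  proof (rule ccontr)
    assume "\<not> ?thesis"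
    then have c0: "c j 0 = 0" for j by blast
    have c1: "c j n = 0" if "n < int N" for j n
    proof -
      from lowc obtain m where m: "\<forall>n\<le>m. c j n = 0" by blast
      show ?thesis by (rule frob_vanish[OF fc m, of "int N - 1"]) (use that q0 c0 in auto)
    qed
    obtain x y where xy: "x \<noteq> 0 \<or> y \<noteq> 0" "x * c True (int N) + y * c False (int N) = 0"
    proof (cases "c True (int N) = 0")
      case True then show thesis using that[of 1 0] by auto
    next
      case False then show thesis using that[of "c False (int N)" "- c True (int N)"] by auto
    qed
    \<comment> \<open>This combination vanishes at the upper exponent as well, hence everywhere,
      against the independence of the two solutions.\<close>
    define e where "e n = x * c True n + y * c False n" for n
    have fe: "frob_at k \<mu> e n" for n unfolding e_def by (rule frob_at_linear[OF fc fc])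
    have "\<forall>n\<le>-1. e n = 0" using neg by (simp add: e_def)
    then have e0: "e n = 0" for n
      by (rule frob_vanish[OF fe _ _ order_refl]) (use q0 xy c0 in \<open>auto simp: e_def\<close>)
    have "fcoeff r \<nu> (\<lambda>s. x * f True s + y * f False s) n = 0" for n
      using e0[of "n + d"] by (simp add: fcoeff_linear f e_def c_def C_def)
    then have "x * f True s + y * f False s = 0" if "s \<in> {0..1}" for s
      by (intro fcoeff_uniqueness[OF _ _ r _ that, of "\<lambda>s. x * f True s + y * f False s" \<nu>])
         (auto intro!: continuous_intros f simp: \<nu> f1 algebra_simps)
    then show False using ind xy(1) by blast
  qed
  then show ?thesis using neg fc by blast
qed

section \<open>Analytic continuation along a path\<close>

lemma holomorphic_zero_on_ball:
  assumes hol: "f holomorphic_on ball w r" and p: "p \<in> ball w r" and z: "\<forall>\<^sub>F z in nhds p. f z = 0" and x: "x \<in> ball w r"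
  shows "f x = (0::complex)"
proof -
  from z obtain S where S: "open S" "p \<in> S" "\<And>z. z \<in> S \<Longrightarrow> f z = 0" unfolding eventually_nhds by blast
  show ?thesis
    by (rule analytic_continuation_open[of "S \<inter> ball w r" "ball w r" f "\<lambda>_. 0"])
       (use S p x hol in auto)
qed

lemma eventually_deriv_cong:
  assumes "\<forall>\<^sub>F z in nhds x. f z = (g z :: complex)"
  shows "\<forall>\<^sub>F z in nhds x. deriv f z = deriv g z"
proof -
  from assms have "\<forall>\<^sub>F z in nhds x. \<forall>\<^sub>F w in nhds z. f w = g w"
    by (simp add: eventually_eventually)
  then show ?thesis by (rule eventually_mono) (auto intro: deriv_cong_ev)
qed

lemma continuation_deriv:
  assumes "analytic_continuation_along \<gamma> F"
  shows "analytic_continuation_along \<gamma> (\<lambda>s. deriv (F s))"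
  unfolding analytic_continuation_along_def
proof
  fix s :: real assume s: "s \<in> {0..1}"
  obtain r d where r: "r > 0" "F s holomorphic_on ball (\<gamma> s) r" and d: "d > 0"
    "\<And>s'. s' \<in> {0..1} \<Longrightarrow> \<bar>s' - s\<bar> < d \<Longrightarrow> \<gamma> s' \<in> ball (\<gamma> s) r \<and> (\<forall>\<^sub>F z in nhds (\<gamma> s'). F s' z = F s z)"
    using assms s unfolding analytic_continuation_along_def by metis
  show "\<exists>r>0. deriv (F s) holomorphic_on ball (\<gamma> s) r \<and>
            (\<exists>d>0. \<forall>s'\<in>{0..1}. \<bar>s' - s\<bar> < d \<longrightarrow> \<gamma> s' \<in> ball (\<gamma> s) r \<and> (\<forall>\<^sub>F z in nhds (\<gamma> s'). deriv (F s') z = deriv (F s) z))"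
  proof (rule exI[of _ r], intro conjI exI[of _ d] ballI impI)
    fix s' :: real assume s': "s' \<in> {0..1}" "\<bar>s' - s\<bar> < d"
    show "\<gamma> s' \<in> ball (\<gamma> s) r" using d(2)[OF s'] by blast
    show "\<forall>\<^sub>F z in nhds (\<gamma> s'). deriv (F s') z = deriv (F s) z"
      using d(2)[OF s'] by (intro eventually_deriv_cong) blast
  qed (use r d(1) in \<open>auto intro: holomorphic_deriv\<close>)
qed

text \<open>For \<open>p0 = 1\<close>, \<open>p1 = p2 = 0\<close> this says that the germ vanishes at one end iff it vanishes at the other.\<close>

lemma continuation_lde_const:
  assumes F: "analytic_continuation_along \<gamma> F"
    and p: "p0 holomorphic_on UNIV" "p1 holomorphic_on UNIV" "p2 holomorphic_on UNIV"
    and s: "s \<in> {0..1}" "s' \<in> {0..1}"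
  shows "(\<forall>\<^sub>F z in nhds (\<gamma> s). p0 z * F s z + p1 z * deriv (F s) z + p2 z * deriv (deriv (F s)) z = 0) \<longleftrightarrow>
    (\<forall>\<^sub>F z in nhds (\<gamma> s'). p0 z * F s' z + p1 z * deriv (F s') z + p2 z * deriv (deriv (F s')) z = 0)"
proof -
  define E where "E f z = p0 z * f z + p1 z * deriv f z + p2 z * deriv (deriv f) z" for f z
  define Z where "Z s \<longleftrightarrow> (\<forall>\<^sub>F z in nhds (\<gamma> s). E (F s) z = 0)" for s
  \<comment> \<open>The property is locally constant in \<open>s\<close>: neighbouring germs agree,
    and on the ball of definition the identity theorem spreads vanishing from any one point. The
    interval is connected.\<close>
  have "Z s = Z s'"
  proof (rule connected_local_const[of "{0..1}"])
    show "\<forall>a\<in>{0..1::real}. \<forall>\<^sub>F b in at a within {0..1}. Z a = Z b"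
    proof
      fix s :: real assume s: "s \<in> {0..1}"
      obtain r d where r: "r > 0" "F s holomorphic_on ball (\<gamma> s) r" and d: "d > 0"
        "\<And>s'. s' \<in> {0..1} \<Longrightarrow> \<bar>s' - s\<bar> < d \<Longrightarrow> \<gamma> s' \<in> ball (\<gamma> s) r \<and> (\<forall>\<^sub>F z in nhds (\<gamma> s'). F s' z = F s z)"
        using F s unfolding analytic_continuation_along_def by metis
      have hol: "E (F s) holomorphic_on ball (\<gamma> s) r"
        unfolding E_def by (intro holomorphic_intros holomorphic_on_subset[OF p(1)] holomorphic_on_subset[OF p(2)] holomorphic_on_subset[OF p(3)] r) auto
      have "\<forall>\<^sub>F b in at s within {0..1}. \<bar>b - s\<bar> < d \<and> b \<in> {0..1}"
        using d(1) unfolding eventually_at by (auto simp: dist_real_def)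
      then show "\<forall>\<^sub>F b in at s within {0..1}. Z s = Z b"
      proof eventually_elim
        case (elim b)
        have b: "\<gamma> b \<in> ball (\<gamma> s) r" "\<forall>\<^sub>F z in nhds (\<gamma> b). F b z = F s z" using d(2) elim by auto
        note b' = eventually_deriv_cong[OF b(2)]
        from b(2) b' eventually_deriv_cong[OF b']
        have "\<forall>\<^sub>F z in nhds (\<gamma> b). E (F b) z = E (F s) z"
          by eventually_elim (simp add: E_def)
        then have Zb: "Z b \<longleftrightarrow> (\<forall>\<^sub>F z in nhds (\<gamma> b). E (F s) z = 0)"
          unfolding Z_def by (intro eventually_cong) (auto elim: eventually_mono)
        have nb: "\<forall>\<^sub>F z in nhds p. z \<in> ball (\<gamma> s) r" if "p \<in> ball (\<gamma> s) r" for p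
          using that by (intro eventually_nhds_in_open) auto
        have ball: "(\<forall>\<^sub>F z in nhds p. E (F s) z = 0) \<longleftrightarrow> (\<forall>z\<in>ball (\<gamma> s) r. E (F s) z = 0)"
          if "p \<in> ball (\<gamma> s) r" for p
          using holomorphic_zero_on_ball[OF hol that] nb[OF that] by (auto elim: eventually_mono)
        show ?case unfolding Zb unfolding Z_def ball[OF b(1)] using ball[of "\<gamma> s"] r(1) by simp
      qed
    qed
  qed (use s in auto)
  then show ?thesis by (simp add: Z_def E_def)
qed

text \<open>The germ itself varies with \<open>s\<close>, but germs at nearby parameters agree with
  \<open>F s\<close> at their path points, so the ordinary chain rule applies.\<close>

lemma continuation_has_vector_derivative:
  assumes F: "analytic_continuation_along \<gamma> F" and s: "s \<in> {0..1}"
    and \<gamma>: "(\<gamma> has_vector_derivative \<gamma>') (at s within {0..1})"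
  shows "((\<lambda>s. F s (\<gamma> s)) has_vector_derivative \<gamma>' * deriv (F s) (\<gamma> s)) (at s within {0..1})"
proof -
  obtain r d where r: "r > 0" "F s holomorphic_on ball (\<gamma> s) r" and d: "d > 0"
    "\<And>s'. s' \<in> {0..1} \<Longrightarrow> \<bar>s' - s\<bar> < d \<Longrightarrow> \<gamma> s' \<in> ball (\<gamma> s) r \<and> (\<forall>\<^sub>F z in nhds (\<gamma> s'). F s' z = F s z)"
    using F s unfolding analytic_continuation_along_def by metis
  have "(F s has_field_derivative deriv (F s) (\<gamma> s)) (at (\<gamma> s))"
    using r by (intro holomorphic_derivI[of _ "ball (\<gamma> s) r"]) auto
  then have "((F s \<circ> \<gamma>) has_vector_derivative \<gamma>' * deriv (F s) (\<gamma> s)) (at s within {0..1})"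
    by (intro field_vector_diff_chain_within \<gamma>) (rule has_field_derivative_at_within)
  then show ?thesis
  proof (rule has_vector_derivative_transform_within[OF _ d(1) s])
    fix s' assume "s' \<in> {0..1}" "dist s' s < d"
    then show "(F s \<circ> \<gamma>) s' = F s' (\<gamma> s')"
      using d(2)[of s'] eventually_nhds_x_imp_x by (fastforce simp: dist_real_def)
  qed
qed

lemma continuation_near_start:
  assumes F: "analytic_continuation_along \<gamma> F"
  shows "\<exists>d>0. \<forall>s\<in>{0..<d}. s \<le> 1 \<longrightarrow> F s (\<gamma> s) = F 0 (\<gamma> s)"
proof -
  obtain d where d: "d > 0"
    "\<And>s'. s' \<in> {0..1} \<Longrightarrow> \<bar>s' - 0\<bar> < d \<Longrightarrow> (\<forall>\<^sub>F z in nhds (\<gamma> s'). F s' z = F 0 z)"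
    using F unfolding analytic_continuation_along_def by (metis atLeastAtMost_iff order_refl zero_le_one)
  then show ?thesis using eventually_nhds_x_imp_x by (intro exI[of _ d]) fastforce
qed

text \<open>The relation involves only values of the germs on the path. Near the start these are
  values of the initial germs, and the path points accumulate at \<open>\<gamma> 0\<close>, so the
  identity theorem carries the relation to the ball.\<close>

lemma continuation_independent:
  assumes F: "analytic_continuation_along \<gamma> F" and G: "analytic_continuation_along \<gamma> G"
    and hF: "F 0 holomorphic_on ball (\<gamma> 0) \<rho>" and hG: "G 0 holomorphic_on ball (\<gamma> 0) \<rho>" and \<rho>: "\<rho> > 0"
    and \<gamma>: "continuous (at 0) \<gamma>" and ne: "\<And>s. 0 < s \<Longrightarrow> s < 1 \<Longrightarrow> \<gamma> s \<noteq> \<gamma> 0"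
    and z: "\<And>s. s \<in> {0..1} \<Longrightarrow> x * F s (\<gamma> s) + y * G s (\<gamma> s) = 0" and w: "w \<in> ball (\<gamma> 0) \<rho>"
  shows "x * F 0 w + y * G 0 w = 0"
proof -
  obtain d1 where d1: "d1 > 0" "\<And>s. s \<in> {0..<d1} \<Longrightarrow> s \<le> 1 \<Longrightarrow> F s (\<gamma> s) = F 0 (\<gamma> s)"
    using continuation_near_start[OF F] by blast
  obtain d2 where d2: "d2 > 0" "\<And>s. s \<in> {0..<d2} \<Longrightarrow> s \<le> 1 \<Longrightarrow> G s (\<gamma> s) = G 0 (\<gamma> s)"
    using continuation_near_start[OF G] by blast
  define d where "d = Min {d1, d2, 1}"
  define U where "U = \<gamma> ` {0<..<d} \<inter> ball (\<gamma> 0) \<rho>"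
  show ?thesis
  proof (rule analytic_continuation[of "\<lambda>w. x * F 0 w + y * G 0 w" "ball (\<gamma> 0) \<rho>" U "\<gamma> 0"])
    show "\<gamma> 0 islimpt U"
      unfolding islimpt_approachable
    proof (intro allI impI)
      fix e :: real assume "e > 0"
      then obtain d' where d': "d' > 0" "\<And>s. dist s 0 < d' \<Longrightarrow> dist (\<gamma> s) (\<gamma> 0) < min e \<rho>"
        using \<gamma> \<rho> unfolding continuous_at_eps_delta by (metis min_less_iff_conj)
      define s where "s = min d' d / 2"
      have s: "0 < s" "s < d" "s < d'" "s < 1" using d1(1) d2(1) d'(1) by (auto simp: s_def d_def)
      show "\<exists>x'\<in>U. x' \<noteq> \<gamma> 0 \<and> dist x' (\<gamma> 0) < e"
        using s d'(2)[of s] ne[of s] by (intro bexI[of _ "\<gamma> s"]) (auto simp: U_def dist_commute)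
    qed
    show "\<And>z. z \<in> U \<Longrightarrow> x * F 0 z + y * G 0 z = 0"
    proof -
      fix p assume "p \<in> U"
      then obtain s where "p = \<gamma> s" "0 < s" "s < d" by (auto simp: U_def)
      then show "x * F 0 p + y * G 0 p = 0" using z[of s] d1(2)[of s] d2(2)[of s] by (auto simp: d_def)
    qed
  qed (use w \<rho> in \<open>auto intro!: holomorphic_intros hF hG simp: U_def\<close>)
qed

section \<open>Scalar monodromy implies a logarithm-free series\<close>

text \<open>Under x -> 1/x the Euler operator changes sign; multiplying by the square of the new
  variable restores the polynomial form, with the three quadratics in reverse order.\<close>

definition reflect :: "(nat \<Rightarrow> nat \<Rightarrow> complex) \<Rightarrow> nat \<Rightarrow> nat \<Rightarrow> complex" where
  "reflect k i j = (- 1) ^ j * k (2 - i) j"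

lemma quad_reflect: "quad (reflect k) i \<rho> = quad k (2 - i) (- \<rho>)"
  by (simp add: quad_def reflect_def)

lemma euler_op_reflect:
  assumes "x \<noteq> 0"
  shows "euler_op (reflect k) x y0 (- y1) y2 = x\<^sup>2 * euler_op k (inverse x) y0 y1 y2"
  using assms by (simp add: euler_op_def reflect_def sum_le_2 field_simps power2_eq_square)

text \<open>\<open>\<sigma> = 1\<close> is the chart \<open>x = z - a\<close> at a finite point, \<open>\<sigma> = -1\<close> the chart \<open>x = 1 / (z - a)\<close> at infinity.\<close>

definition chart_coeffs :: "int \<Rightarrow> (nat \<Rightarrow> nat \<Rightarrow> complex) \<Rightarrow> nat \<Rightarrow> nat \<Rightarrow> complex" where
  "chart_coeffs \<sigma> k = (if \<sigma> = 1 then k else reflect k)"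

lemma euler_op_chart:
  assumes "w \<noteq> 0" "\<sigma> = 1 \<or> \<sigma> = -1"
  shows "euler_op (chart_coeffs \<sigma> k) (w powi \<sigma>) y0 (of_int \<sigma> * y1) y2 = 0 \<longleftrightarrow> euler_op k w y0 y1 y2 = 0"
  using assms euler_op_reflect[of "inverse w" k y0 y1 y2] by (auto simp: chart_coeffs_def power_int_minus)

lemma ee_neg_inverse: "ee (- z) s = inverse (ee z s)"
  by (simp add: ee_def exp_minus)

lemma ee_nonzero [simp]: "ee z s \<noteq> 0"
  by (simp add: ee_def)

text \<open>Translates monodromy of germs into the functions of one real variable treated by
  \<open>scalar_monodromy_imp_frob\<close>, for finite points and infinity together. The path runs
  in direction \<open>\<sigma>\<close>, so the chart variable \<open>(z - a) powi \<sigma>\<close>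
  turns once in the positive sense in both cases.\<close>

lemma monodromy_imp_frob:
  fixes N :: nat
  assumes mono: "monodromy_matrix P Q \<gamma> (mat \<kappa>)" and \<gamma>: "\<And>s. \<gamma> s = a + of_real R * ee (of_int \<sigma>) s"
    and R: "R > 0" and \<sigma>: "\<sigma> = 1 \<or> \<sigma> = -1"
    and ode: "\<forall>\<^sub>F z in nhds (a + of_real R). \<forall>y0 y1 y2. y2 + P z * y1 + Q z * y0 = 0 \<longrightarrow>
      euler_op k (z - a) y0 ((z - a) * y1) ((z - a) * y1 + (z - a)\<^sup>2 * y2) = 0"
    and K: "K = chart_coeffs \<sigma> k" and r: "r = R powi \<sigma>"
    and quad0: "\<And>\<rho>. quad K 0 \<rho> = K 0 2 * (\<rho> - \<mu>) * (\<rho> - \<mu> - of_nat N)" and N: "N > 0"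
    and k: "K 0 2 \<noteq> 0" and ef: "K 1 2 = - K 0 2 * (u + v)" "K 2 2 = K 0 2 * (u * v)"
    and u: "norm u * r < 1" and v: "norm v * r < 1"
  shows "\<exists>c. (\<forall>n<0. c n = 0) \<and> c 0 \<noteq> 0 \<and> (\<forall>n. frob_at K \<mu> c n)"
proof -
  obtain F :: "2 \<Rightarrow> real \<Rightarrow> complex \<Rightarrow> complex" and \<rho> where \<rho>: "\<rho> > 0"
    and fs: "fundamental_system P Q (ball (\<gamma> 0) \<rho>) (\<lambda>j. F j 0)"
    and cont: "\<And>j. analytic_continuation_along \<gamma> (F j)"
    and fin: "\<And>j. \<forall>\<^sub>F z in nhds (\<gamma> 1). F j 1 z = (\<Sum>i\<in>UNIV. F i 0 z * (mat \<kappa> :: complex^2^2) $ i $ j)"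
    using mono unfolding monodromy_matrix_def pathstart_def pathfinish_def by blast
  have \<gamma>01: "\<gamma> 1 = \<gamma> 0" "\<gamma> 0 = a + of_real R" using \<sigma> ee_int_1[of \<sigma>] by (simp_all add: \<gamma>)
  have fin: "\<forall>\<^sub>F z in nhds (\<gamma> 1). F j 1 z = \<kappa> * F j 0 z" for j
    using fin[of j] by (simp add: mat_def if_distrib sum.delta cong: if_cong) (simp add: mult.commute)
  have sol: "lde2_solution_on P Q (ball (\<gamma> 0) \<rho>) (F j 0)" for j using fs by (auto simp: fundamental_system_def)
  have hol: "F j 0 holomorphic_on ball (\<gamma> 0) \<rho>" for j using sol by (auto simp: lde2_solution_on_def)
  have indep: "x = 0 \<and> y = 0" if "\<And>z. z \<in> ball (\<gamma> 0) \<rho> \<Longrightarrow> x * F 1 0 z + y * F 2 0 z = 0" for x y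
  proof -
    define l :: "2 \<Rightarrow> complex" where "l j = (if j = 1 then x else y)" for j
    have "\<forall>z\<in>ball (\<gamma> 0) \<rho>. (\<Sum>j\<in>UNIV. l j * F j 0 z) = 0" using that by (simp add: sum_2 l_def)
    then have "\<forall>j. l j = 0" using fs unfolding fundamental_system_def by blast
    then show ?thesis using l_def[of 1] l_def[of 2] by simp
  qed
  have w0: "\<gamma> s - a \<noteq> 0" for s using R by (simp add: \<gamma>)
  have \<gamma>': "(\<gamma> has_vector_derivative 2 * of_real pi * \<i> * of_int \<sigma> * (\<gamma> s - a)) (at s within {0..1})" for s
  proof -
    have "(ee (of_int \<sigma>) has_vector_derivative 2 * of_real pi * \<i> * of_int \<sigma> * ee (of_int \<sigma>) s) (at s within {0..1})"
      by (rule ee_has_vector_derivative)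
    then have "((\<lambda>s. a + of_real R * ee (of_int \<sigma>) s) has_vector_derivative of_real R * (2 * of_real pi * \<i> * of_int \<sigma> * ee (of_int \<sigma>) s)) (at s within {0..1})"
      by (auto intro!: derivative_eq_intros)
    then show ?thesis unfolding \<gamma>[abs_def] by (simp add: algebra_simps)
  qed
  define f where "f b = F (if b then 1 else 2)" for b
  \<comment> \<open>These are y and its first two images under the Euler operator in z - a. Passing
    to the chart multiplies the first image by \<open>\<sigma>\<close> and leaves the second alone,
    because \<open>\<sigma>\<close> squares to 1.\<close>
  define y0 where "y0 b s = f b s (\<gamma> s)" for b s
  define y1 where "y1 b s = (\<gamma> s - a) * deriv (f b s) (\<gamma> s)" for b s
  define y2 where "y2 b s = (\<gamma> s - a) * deriv (f b s) (\<gamma> s) + (\<gamma> s - a)\<^sup>2 * deriv (deriv (f b s)) (\<gamma> s)" for b s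
  have cf: "analytic_continuation_along \<gamma> (f b)" for b by (simp add: f_def cont)
  note cf1 = continuation_deriv[OF cf] and cf2 = continuation_deriv[OF continuation_deriv[OF cf]]
  note vd = continuation_has_vector_derivative[OF _ _ \<gamma>']
  have d0: "(y0 b has_vector_derivative 2 * of_real pi * \<i> * (of_int \<sigma> * y1 b s)) (at s within {0..1})" if "s \<in> {0..1}" for b s
    using vd[OF cf that, of b] unfolding y0_def y1_def by (simp add: algebra_simps)
  have \<sigma>2: "of_int \<sigma> * of_int \<sigma> = (1 :: complex)" using \<sigma> by auto
  have d1: "((\<lambda>s. of_int \<sigma> * y1 b s) has_vector_derivative 2 * of_real pi * \<i> * y2 b s) (at s within {0..1})" if "s \<in> {0..1}" for b s
  proof -
    have "((\<lambda>s. of_int \<sigma> * ((\<gamma> s - a) * deriv (f b s) (\<gamma> s))) has_vector_derivative of_int \<sigma> * ((\<gamma> s - a) * (2 * of_real pi * \<i> * of_int \<sigma> * (\<gamma> s - a) * deriv (deriv (f b s)) (\<gamma> s))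
      + (2 * of_real pi * \<i> * of_int \<sigma> * (\<gamma> s - a) - 0) * deriv (f b s) (\<gamma> s))) (at s within {0..1})"
      by (intro has_vector_derivative_mult_right has_vector_derivative_mult has_vector_derivative_diff has_vector_derivative_const \<gamma>' vd[OF cf1 that])
    moreover have "of_int \<sigma> * ((\<gamma> s - a) * (2 * of_real pi * \<i> * of_int \<sigma> * (\<gamma> s - a) * deriv (deriv (f b s)) (\<gamma> s))
      + (2 * of_real pi * \<i> * of_int \<sigma> * (\<gamma> s - a) - 0) * deriv (f b s) (\<gamma> s)) = (of_int \<sigma> * of_int \<sigma>) * (2 * of_real pi * \<i> * y2 b s)"
      by (simp only: y2_def power2_eq_square ring_distribs mult_ac diff_zero add_ac)
    ultimately show ?thesis unfolding y1_def \<sigma>2 by simp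
  qed
  have c2: "continuous_on {0..1} (y2 b)" for b
  proof -
    have c: "continuous_on {0..1} (\<lambda>s. g s (\<gamma> s))" if "analytic_continuation_along \<gamma> g" for g
      by (rule has_vector_derivative_imp_cont01[OF vd[OF that]])
    have "continuous_on {0..1} \<gamma>" by (rule has_vector_derivative_imp_cont01[OF \<gamma>'])
    then show ?thesis unfolding y2_def by (intro continuous_intros c[OF cf1] c[OF cf2])
  qed
  have ode0: "\<forall>\<^sub>F z in nhds (\<gamma> 0). euler_op k (z - a) (f b 0 z) ((z - a) * deriv (f b 0) z) ((z - a) * deriv (f b 0) z + (z - a)\<^sup>2 * deriv (deriv (f b 0)) z) = 0" for b
  proof -
    have "\<forall>\<^sub>F z in nhds (\<gamma> 0). z \<in> ball (\<gamma> 0) \<rho>" using \<rho> by (intro eventually_nhds_in_open) auto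
    with ode[folded \<gamma>01(2)] show ?thesis
      by eventually_elim (use sol in \<open>auto simp: lde2_solution_on_def f_def\<close>)
  qed
  \<comment> \<open>With denominators cleared the equation has entire coefficients, as
    \<open>continuation_lde_const\<close> requires.\<close>
  define p where "p j z = (\<Sum>i\<le>2. (z - a) ^ i * k i j)" for j z
  have p_hol: "p j holomorphic_on UNIV" for j unfolding p_def by (intro holomorphic_intros)
  have E: "euler_op k (z - a) x0 ((z - a) * x1) ((z - a) * x1 + (z - a)\<^sup>2 * x2) =
    p 0 z * x0 + ((z - a) * (p 1 z + p 2 z)) * x1 + ((z - a)\<^sup>2 * p 2 z) * x2" for z x0 x1 x2
    by (simp add: euler_op_def p_def sum_le_2 algebra_simps)
  have ode1: "\<forall>\<^sub>F z in nhds (\<gamma> s). euler_op k (z - a) (f b s z) ((z - a) * deriv (f b s) z) ((z - a) * deriv (f b s) z + (z - a)\<^sup>2 * deriv (deriv (f b s)) z) = 0" if "s \<in> {0..1}" for b s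
  proof -
    have "(\<lambda>z. (z - a) * (p 1 z + p 2 z)) holomorphic_on UNIV" "(\<lambda>z. (z - a)\<^sup>2 * p 2 z) holomorphic_on UNIV"
      by (intro holomorphic_intros p_hol)+
    from continuation_lde_const[OF cf p_hol[of 0] this, of 0 s b] ode0[of b] that
    show ?thesis unfolding E by simp
  qed
  have x: "(\<gamma> s - a) powi \<sigma> = of_real r * ee 1 s" for s
    using \<sigma> R by (auto simp: \<gamma> r power_int_minus ee_neg_inverse)
  have fin': "\<forall>\<^sub>F z in nhds (\<gamma> 1). f b 1 z = \<kappa> * f b 0 z" for b using fin by (simp add: f_def)
  \<comment> \<open>A zero germ at the end could only come from a zero germ at the start.\<close>
  have "\<kappa> \<noteq> 0"
  proof
    assume "\<kappa> = 0"
    then have "\<forall>\<^sub>F z in nhds (\<gamma> 1). F 1 1 z = 0" using fin[of 1] by simp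
    then have z0: "\<forall>\<^sub>F z in nhds (\<gamma> 0). F 1 0 z = 0"
      using continuation_lde_const[OF cont[of 1], of "\<lambda>_. 1" "\<lambda>_. 0" "\<lambda>_. 0" 0 1] by simp
    then have "F 1 0 z = 0" if "z \<in> ball (\<gamma> 0) \<rho>" for z
      using holomorphic_zero_on_ball[OF hol _ z0 that] \<rho> by simp
    then show False using indep[of 1 0] by simp
  qed
  show ?thesis
  proof (rule scalar_monodromy_imp_frob[where f = y0 and g = "\<lambda>b s. of_int \<sigma> * y1 b s" and h = y2])
    show "y0 b 1 = \<kappa> * y0 b 0" for b
      using eventually_nhds_x_imp_x[OF fin'] by (simp add: y0_def \<gamma>01)
    show "of_int \<sigma> * y1 b 1 = \<kappa> * (of_int \<sigma> * y1 b 0)" for b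
    proof -
      have "deriv (f b 1) (\<gamma> 1) = deriv (\<lambda>z. \<kappa> * f b 0 z) (\<gamma> 1)"
        by (rule deriv_cong_ev[OF fin' refl])
      also have "\<dots> = \<kappa> * deriv (f b 0) (\<gamma> 1)"
        using hol \<rho> by (intro deriv_cmult holomorphic_on_imp_differentiable_at[of _ "ball (\<gamma> 0) \<rho>"]) (auto simp: f_def \<gamma>01)
      finally show ?thesis by (simp add: y1_def \<gamma>01)
    qed
    show "euler_op K (of_real r * ee 1 s) (y0 b s) (of_int \<sigma> * y1 b s) (y2 b s) = 0" if "s \<in> {0..1}" for b s
      using eventually_nhds_x_imp_x[OF ode1[OF that, of b]] euler_op_chart[OF w0[of s] \<sigma>]
      unfolding K x[symmetric] y0_def y1_def y2_def by simp
    show "x = 0 \<and> y = 0" if "\<And>s. s \<in> {0..1} \<Longrightarrow> x * y0 True s + y * y0 False s = 0" for x y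
    proof (rule indep)
      fix z assume z: "z \<in> ball (\<gamma> 0) \<rho>"
      show "x * F 1 0 z + y * F 2 0 z = 0"
      proof (rule continuation_independent[OF cont cont hol hol \<rho> _ _ _ z])
        show "continuous (at 0) \<gamma>" unfolding \<gamma>[abs_def] ee_def by (intro continuous_intros)
        show "\<gamma> s \<noteq> \<gamma> 0" if "0 < s" "s < 1" for s
        proof
          assume "\<gamma> s = \<gamma> 0"
          then have "ee (of_int \<sigma>) s = 1" using R by (simp add: \<gamma>)
          then obtain n :: int where "2 * pi * \<sigma> * s = of_int (2 * n) * pi"
            unfolding ee_def exp_eq_1 by auto
          then have "\<sigma> * s = of_int n" by simp
          then have "real_of_int (\<sigma> * n) = s" using \<sigma> by (elim disjE; simp; linarith)
          then have "0 < real_of_int (\<sigma> * n)" "real_of_int (\<sigma> * n) < 1" using that by linarith+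
          then have "0 < \<sigma> * n" "\<sigma> * n < 1" by linarith+
          then show False by linarith
        qed
      qed (use that in \<open>auto simp: y0_def f_def\<close>)
    qed
    show "0 < r" using R r by simp
  qed (use d0 d1 c2 \<open>\<kappa> \<noteq> 0\<close> quad0 N k ef u v in \<open>blast+\<close>)
qed

section \<open>Convergent series solutions\<close>

text \<open>Keeps the given coefficients up to \<open>N\<close> and solves the recurrence beyond.
  The guard matters for \<open>n = 1\<close>, where the natural number \<open>n - 2\<close> is 0 and
  would bring in a term that the recurrence does not have.\<close>

function frob_ext :: "(nat \<Rightarrow> nat \<Rightarrow> complex) \<Rightarrow> complex \<Rightarrow> (int \<Rightarrow> complex) \<Rightarrow> nat \<Rightarrow> nat \<Rightarrow> complex" where
  "frob_ext k \<mu> c N n = (if n \<le> N then c (int n) else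
     - (quad k 1 (\<mu> + (of_nat n - 1)) * frob_ext k \<mu> c N (n - 1)
        + (if n < 2 then 0 else quad k 2 (\<mu> + (of_nat n - 2)) * frob_ext k \<mu> c N (n - 2)))
     / quad k 0 (\<mu> + of_nat n))"
  by auto
termination by (relation "Wellfounded.measure (\<lambda>(_, _, _, _, n). n)") auto

declare frob_ext.simps [simp del]

text \<open>No root of \<open>quad k 0\<close> lies beyond \<open>N\<close>, so the recurrence
  determines the remaining coefficients. Its quotients converge and are therefore bounded, which
  gives at most geometric growth and some positive radius of convergence.\<close>

lemma frob_extension:
  assumes neg: "\<And>n. n < 0 \<Longrightarrow> c n = 0" and rec: "\<And>n. n \<le> int N \<Longrightarrow> frob_at k \<mu> c n"
    and nz: "\<And>n. n > int N \<Longrightarrow> quad k 0 (\<mu> + of_int n) \<noteq> 0" and k: "k 0 2 \<noteq> 0"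
  shows "\<exists>d \<rho>. (\<forall>n<0. d n = 0) \<and> (\<forall>n\<le>int N. d n = c n) \<and> (\<forall>n. frob_at k \<mu> d n) \<and>
    \<rho> > 0 \<and> (\<forall>x. norm x < \<rho> \<longrightarrow> summable (\<lambda>n. d (int n) * x ^ n))"
proof -
  define e where "e = frob_ext k \<mu> c N"
  define d where "d n = (if n < 0 then 0 else e (nat n))" for n
  have dc: "d n = c n" if "n \<le> int N" for n
    using that neg by (auto simp: d_def e_def frob_ext.simps)
  have e_rec: "quad k 0 (\<mu> + of_nat n) * e n = - (quad k 1 (\<mu> + (of_nat n - 1)) * e (n - 1)
        + (if n < 2 then 0 else quad k 2 (\<mu> + (of_nat n - 2)) * e (n - 2)))" if "n > N" for n
    using nz[of "int n"] that unfolding e_def by (subst (1) frob_ext.simps) simp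
  have d_rec: "frob_at k \<mu> d n" for n
  proof (cases "n \<le> int N")
    case True
    then show ?thesis using rec[OF True] by (simp add: frob_at_def sum_le_2 dc)
  next
    case False
    then obtain m where m: "n = int m" "m > N" by (metis not_le zero_le_imp_eq_int nat_int_comparison(2) of_nat_0_le_iff order.strict_implies_order order_le_less_trans)
    have n1: "nat (int m - 1) = m - 1" "nat (int m - 2) = m - 2" "int m - 1 \<ge> 0" using m by auto
    have "quad k 0 (\<mu> + of_nat m) * e m + quad k 1 (\<mu> + (of_nat m - 1)) * e (m - 1)
        + (if m < 2 then 0 else quad k 2 (\<mu> + (of_nat m - 2)) * e (m - 2)) = 0"
      unfolding e_rec[OF m(2)] by simp
    then show ?thesis using m n1 by (auto simp: frob_at_def sum_le_2 d_def)
  qed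
  have "\<exists>B. \<forall>n. norm (quad k i (\<mu> + (of_nat n - j)) / quad k 0 (\<mu> + of_nat n)) \<le> B" for i j
  proof -
    have "(\<lambda>n. quad k i (\<mu> + (of_nat n - j)) / quad k 0 (\<mu> + of_nat n)) \<longlonglongrightarrow> k i 2 / k 0 2"
      by (intro quad_ratio_tendsto tendsto_of_nat) (fact k)
    then have "Bseq (\<lambda>n. quad k i (\<mu> + (of_nat n - j)) / quad k 0 (\<mu> + of_nat n))"
      by (intro convergent_imp_Bseq) (auto simp: convergent_def)
    then show ?thesis unfolding Bseq_def by blast
  qed
  then obtain B1 B2 where B: "\<And>n. norm (quad k 1 (\<mu> + (of_nat n - 1)) / quad k 0 (\<mu> + of_nat n)) \<le> B1"
    "\<And>n. norm (quad k 2 (\<mu> + (of_nat n - 2)) / quad k 0 (\<mu> + of_nat n)) \<le> B2" by metis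
  have B0: "B1 \<ge> 0" "B2 \<ge> 0" using B[of 0] norm_ge_zero order_trans by blast+
  \<comment> \<open>The summand 1 ensures \<open>K \<ge> 1\<close>, so the bound for index
    \<open>n - 2\<close> is also below the one for \<open>n - 1\<close>.\<close>
  define K where "K = B1 + B2 + 1"
  have K: "K \<ge> 1" using B0 by (simp add: K_def)
  define M where "M = (\<Sum>n\<le>N. norm (c (int n)))"
  have M: "M \<ge> 0" by (auto simp: M_def intro: sum_nonneg)
  have bound: "norm (e n) \<le> M * K ^ n" for n
  proof (induction n rule: less_induct)
    case (less n)
    show ?case
    proof (cases "n \<le> N")
      case True
      then have "norm (e n) \<le> M" unfolding M_def by (auto simp: e_def frob_ext.simps intro!: member_le_sum)
      also have "\<dots> \<le> M * K ^ n" using M K by (simp add: mult_left_le_one_le mult_le_cancel_left1)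
      finally show ?thesis .
    next
      case False
      then have n: "n > N" "n > 0" by auto
      have q: "quad k 0 (\<mu> + of_nat n) \<noteq> 0" using nz[of "int n"] n by simp
      define P1 where "P1 = quad k 1 (\<mu> + (of_nat n - 1)) / quad k 0 (\<mu> + of_nat n)"
      define P2 where "P2 = quad k 2 (\<mu> + (of_nat n - 2)) / quad k 0 (\<mu> + of_nat n)"
      define g where "g = (if n < 2 then 0 else e (n - 2))"
      have KK: "K ^ (n - 2) \<le> K ^ (n - 1)" using K by (intro power_increasing) auto
      have g: "norm g \<le> M * K ^ (n - 1)"
      proof (cases "n < 2")
        case False
        then have "norm g \<le> M * K ^ (n - 2)" using less.IH[of "n - 2"] by (simp add: g_def)
        then show ?thesis using mult_left_mono[OF KK M] by linarith
      qed (use M K in \<open>simp add: g_def\<close>)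
      have "quad k 0 (\<mu> + of_nat n) * e n = - (quad k 1 (\<mu> + (of_nat n - 1)) * e (n - 1) + quad k 2 (\<mu> + (of_nat n - 2)) * g)"
        using e_rec[OF n(1)] by (auto simp: g_def)
      then have "e n = - (P1 * e (n - 1) + P2 * g)"
        using q by (simp add: P1_def P2_def field_simps)
      then have "norm (e n) \<le> norm P1 * norm (e (n - 1)) + norm P2 * norm g"
        by (metis norm_minus_cancel norm_mult norm_triangle_ineq)
      also have "\<dots> \<le> B1 * (M * K ^ (n - 1)) + B2 * (M * K ^ (n - 1))"
        using B[of n] B0 less.IH[of "n - 1"] n g by (intro add_mono mult_mono) (auto simp: P1_def P2_def)
      also have "\<dots> \<le> K * (M * K ^ (n - 1))" using M K by (simp add: K_def algebra_simps)
      also have "\<dots> = M * K ^ n" using n by (cases n) auto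
      finally show ?thesis .
    qed
  qed
  have "summable (\<lambda>n. d (int n) * x ^ n)" if x: "norm x < 1 / K" for x
  proof (rule summable_comparison_test)
    show "summable (\<lambda>n. M * (K * norm x) ^ n)"
      using x K by (intro summable_mult summable_geometric) (simp add: field_simps)
    show "\<exists>N. \<forall>n\<ge>N. norm (d (int n) * x ^ n) \<le> M * (K * norm x) ^ n"
      using bound by (intro exI[of _ 0]) (auto simp: d_def norm_mult norm_power power_mult_distrib mult.assoc[symmetric] intro!: mult_right_mono)
  qed
  then show ?thesis using d_rec dc K
    by (intro exI[of _ d] exI[of _ "1 / K"]) (auto simp: d_def)
qed

text \<open>The multivalued series \<open>x^\<mu> * (\<Sum>n. a n * x^n)\<close> as a single-valued
  function of \<open>\<zeta> = log x\<close>; in this variable the Euler operator is plain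
  differentiation.\<close>

definition frob_fun :: "(nat \<Rightarrow> complex) \<Rightarrow> complex \<Rightarrow> complex \<Rightarrow> complex" where
  "frob_fun a \<mu> \<zeta> = exp (\<mu> * \<zeta>) * (\<Sum>n. a n * exp \<zeta> ^ n)"

text \<open>Summability of the new series is part of the claim so that the lemma can be applied
  twice, once for each power of the Euler operator.\<close>

lemma frob_fun_deriv:
  assumes sum: "\<And>x. norm x < \<rho> \<Longrightarrow> summable (\<lambda>n. a n * x ^ n)" and \<zeta>: "norm (exp \<zeta>) < \<rho>"
  shows "summable (\<lambda>n. (\<mu> + of_nat n) * a n * exp \<zeta> ^ n)"
    and "(frob_fun a \<mu> has_field_derivative frob_fun (\<lambda>n. (\<mu> + of_nat n) * a n) \<mu> \<zeta>) (at \<zeta>)"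
proof -
  define x where "x = exp \<zeta>"
  define S where "S x = (\<Sum>n. a n * x ^ n)" for x
  obtain r where r: "norm x < r" "r < \<rho>" using dense[OF \<zeta>] by (auto simp: x_def)
  then have "norm (complex_of_real r) < \<rho>" "norm x < norm (complex_of_real r)"
    using norm_ge_zero[of x] by (simp_all, linarith+)
  then have dS: "(S has_field_derivative (\<Sum>n. diffs a n * x ^ n)) (at x)"
    unfolding S_def by (intro termdiffs_strong[of _ "complex_of_real r"] sum)
  have "summable (\<lambda>n. diffs a n * x ^ n)"
    by (rule termdiff_converges[of _ \<rho>]) (use sum \<zeta> in \<open>auto simp: x_def\<close>)
  from sums_mult[OF diffs_equiv[OF this], of x]
  have s1: "(\<lambda>n. of_nat n * a n * x ^ n) sums (x * (\<Sum>n. diffs a n * x ^ n))"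
  proof (rule sums_cong[THEN iffD1, rotated])
    show "x * (of_nat n * a n * x ^ (n - Suc 0)) = of_nat n * a n * x ^ n" for n
      by (cases n) auto
  qed
  have s0: "(\<lambda>n. a n * x ^ n) sums S x" unfolding S_def using sum[of x] \<zeta> by (auto simp: x_def summable_sums)
  have s: "(\<lambda>n. (\<mu> + of_nat n) * a n * x ^ n) sums (\<mu> * S x + x * (\<Sum>n. diffs a n * x ^ n))"
    using sums_add[OF sums_mult[OF s0, of \<mu>] s1] by (simp add: algebra_simps)
  then show "summable (\<lambda>n. (\<mu> + of_nat n) * a n * exp \<zeta> ^ n)" by (auto simp: x_def sums_iff)
  have "((\<lambda>\<zeta>. S (exp \<zeta>)) has_field_derivative ((\<Sum>n. diffs a n * x ^ n) * x)) (at \<zeta>)"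
    unfolding x_def by (rule DERIV_chain2[OF dS[unfolded x_def] DERIV_exp])
  then have "((\<lambda>\<zeta>. exp (\<mu> * \<zeta>) * S (exp \<zeta>)) has_field_derivative
     exp (\<mu> * \<zeta>) * (\<mu> * S x + x * (\<Sum>n. diffs a n * x ^ n))) (at \<zeta>)"
    by (auto intro!: derivative_eq_intros simp: x_def algebra_simps)
  then show "(frob_fun a \<mu> has_field_derivative frob_fun (\<lambda>n. (\<mu> + of_nat n) * a n) \<mu> \<zeta>) (at \<zeta>)"
    using s by (simp add: frob_fun_def[abs_def] S_def x_def sums_iff)
qed

lemma frob_fun_euler:
  fixes c :: "int \<Rightarrow> complex"
  assumes sum: "\<And>x. norm x < \<rho> \<Longrightarrow> summable (\<lambda>n. c (int n) * x ^ n)" and \<zeta>: "norm (exp \<zeta>) < \<rho>"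
    and neg: "\<And>n. n < 0 \<Longrightarrow> c n = 0" and rec: "\<And>n. frob_at k \<mu> c n"
  defines "a \<equiv> \<lambda>n. c (int n)"
  defines "a1 \<equiv> \<lambda>n. (\<mu> + of_nat n) * a n"
  shows "euler_op k (exp \<zeta>) (frob_fun a \<mu> \<zeta>) (frob_fun a1 \<mu> \<zeta>) (frob_fun (\<lambda>n. (\<mu> + of_nat n) * a1 n) \<mu> \<zeta>) = 0"
proof -
  define x where "x = exp \<zeta>"
  define S where "S a = (\<Sum>n. a n * x ^ n)" for a :: "nat \<Rightarrow> complex"
  define a2 where "a2 = (\<lambda>n. (\<mu> + of_nat n) * a1 n)"
  have sum1: "summable (\<lambda>n. a1 n * y ^ n)" if "norm y < \<rho>" for y
  proof (cases "y = 0")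
    case False
    then show ?thesis using frob_fun_deriv(1)[of \<rho> a "Ln y" \<mu>] sum that by (simp add: a_def a1_def)
  qed (auto simp: summable_0_powser)
  have s0: "(\<lambda>n. a n * x ^ n) sums S a" and s1: "(\<lambda>n. a1 n * x ^ n) sums S a1" and s2: "(\<lambda>n. a2 n * x ^ n) sums S a2"
    unfolding S_def using sum \<zeta> sum1 frob_fun_deriv(1)[OF sum1 \<zeta>, of \<mu>]
    by (auto simp: x_def a_def a2_def intro!: summable_sums)
  have trm: "(\<lambda>n. quad k i (\<mu> + of_int (int n - int i)) * c (int n - int i) * x ^ n) sums (x ^ i * (k i 0 * S a + k i 1 * S a1 + k i 2 * S a2))" for i
  proof -
    have "(\<lambda>n. x ^ i * (k i 0 * (a n * x ^ n) + k i 1 * (a1 n * x ^ n) + k i 2 * (a2 n * x ^ n))) sums (x ^ i * (k i 0 * S a + k i 1 * S a1 + k i 2 * S a2))"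
      by (intro sums_mult sums_add s0 s1 s2)
    also have "(\<lambda>n. x ^ i * (k i 0 * (a n * x ^ n) + k i 1 * (a1 n * x ^ n) + k i 2 * (a2 n * x ^ n))) =
       (\<lambda>n. quad k i (\<mu> + of_int (int (n + i) - int i)) * c (int (n + i) - int i) * x ^ (n + i))"
      by (auto simp: fun_eq_iff quad_def a2_def a1_def a_def power_add algebra_simps power2_eq_square)
    \<comment> \<open>Shifting the index by \<open>i\<close> adds only terms with a negative index
      of \<open>c\<close>, which are 0.\<close>
    finally show ?thesis
      by (subst (asm) sums_zero_iff_shift) (use neg in auto)
  qed
  have "(\<lambda>n. \<Sum>i\<le>2. quad k i (\<mu> + of_int (int n - int i)) * c (int n - int i) * x ^ n) sums (\<Sum>i\<le>2. x ^ i * (k i 0 * S a + k i 1 * S a1 + k i 2 * S a2))"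
    by (intro sums_sum trm)
  moreover have "(\<Sum>i\<le>2. quad k i (\<mu> + of_int (int n - int i)) * c (int n - int i) * x ^ n) = 0" for n
    using rec[of "int n"] unfolding frob_at_def by (simp only: sum_distrib_right[symmetric] mult_zero_left)
  ultimately have "euler_op k x (S a) (S a1) (S a2) = 0"
    by (simp add: euler_op_def sums_iff)
  moreover have "euler_op k x (exp (\<mu> * \<zeta>) * y0) (exp (\<mu> * \<zeta>) * y1) (exp (\<mu> * \<zeta>) * y2) = exp (\<mu> * \<zeta>) * euler_op k x y0 y1 y2" for y0 y1 y2
    by (simp add: euler_op_def sum_le_2 algebra_simps)
  ultimately show ?thesis by (simp add: frob_fun_def S_def x_def a2_def)
qed

section \<open>A logarithm-free series implies scalar monodromy\<close>

lemma exp_eq_1_small: "exp w = (1 :: complex) \<Longrightarrow> norm w < 2 * pi \<Longrightarrow> w = 0"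
proof -
  assume "exp w = (1 :: complex)" and n: "norm w < 2 * pi"
  then obtain m :: int where m: "Re w = 0" "Im w = of_int (2 * m) * pi" by (auto simp: exp_eq_1)
  have "\<bar>Im w\<bar> < 2 * pi" using abs_Im_le_cmod[of w] n by linarith
  then have "\<bar>real_of_int m\<bar> * pi < 1 * pi" using m by (simp add: abs_mult)
  then have "\<bar>real_of_int m\<bar> < 1" by (subst (asm) mult_less_cancel_right_pos) auto
  then have "m = 0" by linarith
  then show "w = 0" using m by (simp add: complex_eq_iff)
qed

text \<open>The branch of \<open>log (z - a)\<close> near \<open>a + R exp (2\<pi>\<i>\<sigma>s)\<close> reached by continuing \<open>ln R\<close> along the circle.\<close>

definition branch :: "complex \<Rightarrow> real \<Rightarrow> int \<Rightarrow> real \<Rightarrow> complex \<Rightarrow> complex" where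
  "branch a R \<sigma> s z = of_real (ln R) + 2 * of_real pi * \<i> * of_int \<sigma> * of_real s
     + Ln ((z - a) / (of_real R * ee (of_int \<sigma>) s))"

text \<open>At distance below \<open>R / 2\<close> from the path point w, the quotient
  \<open>(z - a) / w\<close> has positive real part, so the principal logarithm is holomorphic
  there.\<close>

lemma branch:
  assumes R: "R > 0" and z: "z \<in> ball (a + of_real R * ee (of_int \<sigma>) s) (R / 2)"
  shows "exp (branch a R \<sigma> s z) = z - a"
    and "(branch a R \<sigma> s has_field_derivative inverse (z - a)) (at z)"
    and "R / 2 < norm (z - a)" and "norm (z - a) < 2 * R"
proof -
  define w where "w = of_real R * ee (of_int \<sigma>) s"
  have w: "w \<noteq> 0" "norm w = R" using R by (simp_all add: w_def norm_mult)
  have d: "norm (z - a - w) < R / 2" using z by (simp add: w_def dist_norm norm_minus_commute algebra_simps)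
  show "R / 2 < norm (z - a)" "norm (z - a) < 2 * R"
    using d w R norm_triangle_ineq2[of w "w - (z - a)"] norm_triangle_ineq2[of "z - a" w]
    by (simp_all add: norm_minus_commute)
  then have za: "z - a \<noteq> 0" using R by auto
  have "norm ((z - a) / w - 1) < 1"
  proof -
    have "(z - a) / w - 1 = (z - a - w) / w" using w by (simp add: field_simps)
    then have "norm ((z - a) / w - 1) = norm (z - a - w) / R" using w by (simp add: norm_divide)
    also have "\<dots> < 1" using d R by (subst divide_less_eq_1_pos) auto
    finally show ?thesis .
  qed
  then have "\<bar>Re ((z - a) / w - 1)\<bar> < 1" using abs_Re_le_cmod order_le_less_trans by blast
  then have "Re ((z - a) / w) > 0" by simp
  then have nn: "(z - a) / w \<notin> \<real>\<^sub>\<le>\<^sub>0" using complex_nonpos_Reals_iff by force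
  have "exp (of_real (ln R) + 2 * of_real pi * \<i> * of_int \<sigma> * of_real s) = w"
    using R by (simp add: w_def exp_add ee_def exp_of_real[symmetric] flip: exp_of_real) (simp add: exp_of_real)
  then show "exp (branch a R \<sigma> s z) = z - a"
    unfolding branch_def w_def[symmetric] exp_add using w za by (simp add: exp_Ln)
  show "(branch a R \<sigma> s has_field_derivative inverse (z - a)) (at z)"
    unfolding branch_def w_def[symmetric] using nn w za
    by (auto intro!: derivative_eq_intros simp: field_simps)
qed

lemma Ln_ee: "\<bar>x\<bar> < 1 / 2 \<Longrightarrow> Ln (exp (2 * of_real pi * \<i> * of_real x)) = 2 * of_real pi * \<i> * of_real x"
proof -
  assume x: "\<bar>x\<bar> < 1 / 2"
  then have "- (1 / 2) * (2 * pi) < x * (2 * pi)" "x * (2 * pi) < 1 / 2 * (2 * pi)"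
    by (intro mult_strict_right_mono; simp; linarith)+
  then show ?thesis by (intro Ln_exp) (simp_all add: algebra_simps)
qed

text \<open>Two branches of one logarithm differ by a multiple of 2 pi i. At the new path point the
  difference is 0, since \<open>\<bar>s' - s\<bar> < 1 / 2\<close> keeps the principal logarithm
  from jumping, and by continuity it stays 0 nearby.\<close>

lemma branch_agree:
  assumes R: "R > 0" and \<sigma>: "\<sigma> = 1 \<or> \<sigma> = -1" and s: "\<bar>s' - s\<bar> < 1 / 2"
    and near: "a + of_real R * ee (of_int \<sigma>) s' \<in> ball (a + of_real R * ee (of_int \<sigma>) s) (R / 2)"
  shows "\<forall>\<^sub>F z in nhds (a + of_real R * ee (of_int \<sigma>) s'). branch a R \<sigma> s' z = branch a R \<sigma> s z"
proof -
  define p where "p = a + of_real R * ee (of_int \<sigma>) s'"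
  define D where "D z = branch a R \<sigma> s z - branch a R \<sigma> s' z" for z
  define B where "B = ball (a + of_real R * ee (of_int \<sigma>) s) (R / 2) \<inter> ball p (R / 2)"
  have pB: "p \<in> B" "open B" using near R by (auto simp: B_def p_def)
  have der: "(D has_field_derivative inverse (z - a) - inverse (z - a)) (at z)" if "z \<in> B" for z
    unfolding D_def using that by (intro DERIV_diff branch(2)[OF R]) (auto simp: B_def p_def)
  have "ee (of_int \<sigma>) s' / ee (of_int \<sigma>) s = exp (2 * of_real pi * \<i> * of_real (\<sigma> * (s' - s)))"
    by (simp add: ee_def algebra_simps flip: exp_diff)
  moreover have "\<bar>\<sigma> * (s' - s)\<bar> < 1 / 2" using s \<sigma> by (auto simp: abs_mult)
  ultimately have "Ln (ee (of_int \<sigma>) s' / ee (of_int \<sigma>) s) = 2 * of_real pi * \<i> * of_real (\<sigma> * (s' - s))"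
    by (simp only: Ln_ee)
  then have Dp: "D p = 0" using R by (simp add: D_def branch_def p_def algebra_simps)
  have "isCont D p" using der[OF pB(1)] by (rule DERIV_isCont)
  then have "(D \<longlongrightarrow> D p) (nhds p)" by (simp add: isCont_def tendsto_at_iff_tendsto_nhds)
  then have "\<forall>\<^sub>F z in nhds p. dist (D z) 0 < 2 * pi" unfolding Dp by (rule tendstoD) simp
  moreover have "\<forall>\<^sub>F z in nhds p. z \<in> B" using pB by (intro eventually_nhds_in_open)
  ultimately show ?thesis unfolding p_def[symmetric]
  proof eventually_elim
    case (elim z)
    have "z - a \<noteq> 0" using branch(3)[OF R, of z a \<sigma> s] elim(2) R by (auto simp: B_def)
    moreover have "exp (branch a R \<sigma> s z) = z - a" "exp (branch a R \<sigma> s' z) = z - a"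
      using branch(1)[OF R] elim(2) by (auto simp: B_def p_def)
    ultimately have "exp (D z) = 1" by (simp add: D_def exp_diff)
    then have "D z = 0" using elim(1) by (intro exp_eq_1_small) simp_all
    then show ?case by (simp add: D_def)
  qed
qed

text \<open>Two series whose exponents differ by an integer are multiplied by the same constant in
  one turn, and their different leading exponents make them independent.\<close>

lemma frob_imp_monodromy:
  fixes c :: "bool \<Rightarrow> int \<Rightarrow> complex" and N :: nat
  assumes \<gamma>: "\<And>s. \<gamma> s = a + of_real R * ee (of_int \<sigma>) s"
    and R: "R > 0" and \<sigma>: "\<sigma> = 1 \<or> \<sigma> = -1"
    and ode: "\<And>z y0 y1 y2. z \<in> ball (a + of_real R) (R / 2) \<Longrightarrow>
      euler_op k (z - a) y0 ((z - a) * y1) ((z - a) * y1 + (z - a)\<^sup>2 * y2) = 0 \<Longrightarrow> y2 + P z * y1 + Q z * y0 = 0"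
    and K: "K = chart_coeffs \<sigma> k" and N: "N > 0"
    and \<mu>: "\<mu> True = \<mu> False + of_nat N"
    and neg: "\<And>j n. n < 0 \<Longrightarrow> c j n = 0" and c0: "\<And>j. c j 0 \<noteq> 0" and rec: "\<And>j n. frob_at K (\<mu> j) (c j) n"
    and sum: "\<And>j x. norm x < \<rho> \<Longrightarrow> summable (\<lambda>n. c j (int n) * x ^ n)" and \<rho>: "2 * R powi \<sigma> < \<rho>"
  shows "\<exists>\<kappa>. monodromy_matrix P Q \<gamma> (mat \<kappa>)"
proof -
  define b where "b j n = c j (int n)" for j n
  define b1 where "b1 j n = (\<mu> j + of_nat n) * b j n" for j n
  define b2 where "b2 j n = (\<mu> j + of_nat n) * b1 j n" for j n
  define Y where "Y j = frob_fun (b j) (\<mu> j)" for j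
  define Y1 where "Y1 j = frob_fun (b1 j) (\<mu> j)" for j
  define Y2 where "Y2 j = frob_fun (b2 j) (\<mu> j)" for j
  have sum0: "summable (\<lambda>n. b j n * x ^ n)" if "norm x < \<rho>" for j x using sum[OF that] by (simp add: b_def)
  have sum1: "summable (\<lambda>n. b1 j n * x ^ n)" if "norm x < \<rho>" for j x
  proof (cases "x = 0")
    case False
    then show ?thesis using frob_fun_deriv(1)[of \<rho> "b j" "Ln x" "\<mu> j"] sum0 that by (simp add: b1_def)
  qed (auto simp: summable_0_powser)
  have dY: "(Y j has_field_derivative Y1 j \<zeta>) (at \<zeta>)" if "norm (exp \<zeta>) < \<rho>" for j \<zeta>
    unfolding Y_def Y1_def b1_def by (rule frob_fun_deriv(2)[OF sum0 that])
  have dY1: "(Y1 j has_field_derivative Y2 j \<zeta>) (at \<zeta>)" if "norm (exp \<zeta>) < \<rho>" for j \<zeta>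
    unfolding Y1_def Y2_def b2_def by (rule frob_fun_deriv(2)[OF sum1 that])
  have eu: "euler_op K (exp \<zeta>) (Y j \<zeta>) (Y1 j \<zeta>) (Y2 j \<zeta>) = 0" if "norm (exp \<zeta>) < \<rho>" for j \<zeta>
    using frob_fun_euler[of \<rho> "c j" \<zeta> K "\<mu> j", OF sum that neg rec]
    by (simp add: Y_def Y1_def Y2_def b1_def[abs_def] b2_def[abs_def] b_def[abs_def])
  \<comment> \<open>\<open>of_int \<sigma> * branch a R \<sigma> s z\<close> is a logarithm of the
    chart variable, so continuing the germ only means following the branch of the logarithm.\<close>
  define F where "F j s z = Y j (of_int \<sigma> * branch a R \<sigma> s z)" for j s z
  define F1 where "F1 j s z = Y1 j (of_int \<sigma> * branch a R \<sigma> s z) * (of_int \<sigma> * inverse (z - a))" for j s z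
  have ex: "exp (of_int \<sigma> * branch a R \<sigma> s z) = (z - a) powi \<sigma>" "norm ((z - a) powi \<sigma>) < \<rho>" "z - a \<noteq> 0"
    if "z \<in> ball (\<gamma> s) (R / 2)" for s z
  proof -
    note br = branch[OF R, of z a \<sigma> s, folded \<gamma>, OF that]
    show za: "z - a \<noteq> 0" using br R by auto
    show "exp (of_int \<sigma> * branch a R \<sigma> s z) = (z - a) powi \<sigma>"
      using br(1) \<sigma> by (auto simp: exp_minus power_int_minus)
    \<comment> \<open>The ball lies in the annulus between \<open>R / 2\<close> and
      \<open>2 * R\<close>; this is the origin of the factor 2 in the assumption on
      \<open>\<rho>\<close>.\<close>
    have "inverse (norm (z - a)) < 2 * inverse R" using br(3) R za by (simp add: field_simps)
    then have "norm ((z - a) powi \<sigma>) < 2 * R powi \<sigma>" using br(4) \<sigma> by (auto simp: power_int_minus norm_inverse)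
    then show "norm ((z - a) powi \<sigma>) < \<rho>" using \<rho> by simp
  qed
  have dbr: "((\<lambda>z. of_int \<sigma> * branch a R \<sigma> s z) has_field_derivative of_int \<sigma> * inverse (z - a)) (at z)"
    if "z \<in> ball (\<gamma> s) (R / 2)" for s z
    by (intro DERIV_cmult branch(2)[OF R, of z a \<sigma> s, folded \<gamma>, OF that])
  have dF: "(F j s has_field_derivative F1 j s z) (at z)" if "z \<in> ball (\<gamma> s) (R / 2)" for j s z
    unfolding F_def F1_def by (rule DERIV_chain2[OF dY dbr[OF that]]) (use ex[OF that] in auto)
  have dF1: "(F1 j s has_field_derivative Y1 j (of_int \<sigma> * branch a R \<sigma> s z) * (- of_int \<sigma> * inverse (z - a) ^ 2) +
     Y2 j (of_int \<sigma> * branch a R \<sigma> s z) * (of_int \<sigma> * inverse (z - a)) * (of_int \<sigma> * inverse (z - a))) (at z)"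
    if "z \<in> ball (\<gamma> s) (R / 2)" for j s z
  proof -
    have "((\<lambda>z. Y1 j (of_int \<sigma> * branch a R \<sigma> s z)) has_field_derivative Y2 j (of_int \<sigma> * branch a R \<sigma> s z) * (of_int \<sigma> * inverse (z - a))) (at z)"
      by (rule DERIV_chain2[OF dY1 dbr[OF that]]) (use ex[OF that] in auto)
    moreover have "((\<lambda>z. of_int \<sigma> * inverse (z - a)) has_field_derivative (- of_int \<sigma> * inverse (z - a) ^ 2)) (at z)"
      using ex(3)[OF that] by (auto intro!: derivative_eq_intros simp: power2_eq_square)
    ultimately show ?thesis unfolding F1_def by (rule DERIV_mult')
  qed
  have hol: "F j s holomorphic_on ball (\<gamma> s) (R / 2)" for j s
    unfolding holomorphic_on_open[OF open_ball] using dF by blast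
  have \<sigma>2: "of_int \<sigma> * of_int \<sigma> = (1 :: complex)" using \<sigma> by auto
  have \<gamma>0: "\<gamma> 0 = a + of_real R" by (simp add: \<gamma>)
  have sol: "lde2_solution_on P Q (ball (\<gamma> 0) (R / 2)) (F j 0)" for j
    unfolding lde2_solution_on_def
  proof (intro conjI ballI hol open_ball)
    fix z assume z: "z \<in> ball (\<gamma> 0) (R / 2)"
    define \<zeta> where "\<zeta> = of_int \<sigma> * branch a R \<sigma> 0 z"
    have w: "z - a \<noteq> 0" using ex(3)[OF z] .
    have D1: "deriv (F j 0) z = F1 j 0 z" if "z \<in> ball (\<gamma> 0) (R / 2)" for z using dF[OF that] by (rule DERIV_imp_deriv)
    have "deriv (deriv (F j 0)) z = deriv (F1 j 0) z"
      by (rule deriv_cong_ev[OF _ refl]) (use z D1 eventually_nhds_in_open[of "ball (\<gamma> 0) (R / 2)" z] in \<open>auto elim: eventually_mono\<close>)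
    also have "\<dots> = Y1 j \<zeta> * (- of_int \<sigma> * inverse (z - a) ^ 2) + Y2 j \<zeta> * (of_int \<sigma> * inverse (z - a)) * (of_int \<sigma> * inverse (z - a))"
      unfolding \<zeta>_def by (rule DERIV_imp_deriv[OF dF1[OF z]])
    finally have D2: "deriv (deriv (F j 0)) z = \<dots>" .
    have y1: "(z - a) * F1 j 0 z = of_int \<sigma> * Y1 j \<zeta>" using w by (simp add: F1_def \<zeta>_def)
    have y2: "(z - a) * F1 j 0 z + (z - a)\<^sup>2 * deriv (deriv (F j 0)) z = Y2 j \<zeta>"
    proof -
      have "(z - a)\<^sup>2 * deriv (deriv (F j 0)) z = ((z - a) * inverse (z - a)) ^ 2 * (- of_int \<sigma> * Y1 j \<zeta> + of_int \<sigma> * of_int \<sigma> * Y2 j \<zeta>)"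
        unfolding D2 by (simp add: algebra_simps power2_eq_square)
      then show ?thesis unfolding y1 \<sigma>2 using w by simp
    qed
    have "euler_op K ((z - a) powi \<sigma>) (Y j \<zeta>) (of_int \<sigma> * (of_int \<sigma> * Y1 j \<zeta>)) (Y2 j \<zeta>) = 0"
      using eu[of \<zeta> j] ex[OF z] by (simp add: \<zeta>_def \<sigma>2 flip: mult.assoc)
    then have "euler_op k (z - a) (F j 0 z) ((z - a) * F1 j 0 z) ((z - a) * F1 j 0 z + (z - a)\<^sup>2 * deriv (deriv (F j 0)) z) = 0"
      unfolding K euler_op_chart[OF w \<sigma>] y2 unfolding y1 by (simp add: F_def \<zeta>_def)
    from ode[OF z[unfolded \<gamma>0] this]
    show "deriv (deriv (F j 0)) z + P z * deriv (F j 0) z + Q z * F j 0 z = 0" by (simp add: D1[OF z])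
  qed
  have cont: "analytic_continuation_along \<gamma> (F j)" for j
    unfolding analytic_continuation_along_def
  proof
    fix s :: real
    have "continuous (at s) \<gamma>" unfolding \<gamma>[abs_def] ee_def by (intro continuous_intros)
    then obtain d where d: "d > 0" "\<And>s'. dist s' s < d \<Longrightarrow> dist (\<gamma> s') (\<gamma> s) < R / 2"
      unfolding continuous_at_eps_delta using R by (metis half_gt_zero)
    show "\<exists>r>0. F j s holomorphic_on ball (\<gamma> s) r \<and> (\<exists>d>0. \<forall>s'\<in>{0..1}. \<bar>s' - s\<bar> < d \<longrightarrow>
            \<gamma> s' \<in> ball (\<gamma> s) r \<and> (\<forall>\<^sub>F z in nhds (\<gamma> s'). F j s' z = F j s z))"
    proof (rule exI[of _ "R / 2"], intro conjI hol exI[of _ "min d (1 / 2)"] ballI impI)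
      fix s' assume s': "\<bar>s' - s\<bar> < min d (1 / 2)"
      show "\<gamma> s' \<in> ball (\<gamma> s) (R / 2)" using d(2)[of s'] s' by (simp add: dist_real_def dist_commute)
      then have "\<forall>\<^sub>F z in nhds (\<gamma> s'). branch a R \<sigma> s' z = branch a R \<sigma> s z"
        unfolding \<gamma> using s' by (intro branch_agree R \<sigma>) auto
      then show "\<forall>\<^sub>F z in nhds (\<gamma> s'). F j s' z = F j s z" by eventually_elim (simp add: F_def)
    qed (use R d in auto)
  qed
  have fin: "F j 1 z = exp (2 * of_real pi * \<i> * \<mu> j) * F j 0 z" for j z
  proof -
    have "ee (of_int \<sigma>) 1 = 1" by simp
    then have "of_int \<sigma> * branch a R \<sigma> 1 z = of_int \<sigma> * branch a R \<sigma> 0 z + of_int \<sigma> * of_int \<sigma> * (2 * of_real pi * \<i>)"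
      by (simp add: branch_def algebra_simps del: ee_int_1)
    then show ?thesis
      unfolding F_def Y_def frob_fun_def \<sigma>2 by (simp add: exp_add ring_distribs mult_ac)
  qed
  define \<kappa> where "\<kappa> = exp (2 * of_real pi * \<i> * \<mu> False)"
  have \<kappa>: "exp (2 * of_real pi * \<i> * \<mu> j) = \<kappa>" for j
  proof (cases j)
    case True
    have "exp (2 * of_real pi * \<i> * of_nat N) = (1 :: complex)"
      using ee_int_1[of "int N"] by (simp add: ee_def)
    then show ?thesis using True by (simp add: \<mu> \<kappa>_def ring_distribs exp_add)
  qed (simp add: \<kappa>_def)
  have indep: "x = 0 \<and> y = 0" if xy: "\<And>z. z \<in> ball (\<gamma> 0) (R / 2) \<Longrightarrow> x * F True 0 z + y * F False 0 z = 0" for x y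
  proof -
    define S where "S j w = (\<Sum>n. b j n * w ^ n)" for j and w :: complex
    have "\<rho> > 0" using \<rho> R by (smt (verit) zero_less_power_int)
    have S0: "S j 0 = c j 0" for j by (simp add: S_def b_def)
    have holS: "S j holomorphic_on ball 0 \<rho>" for j
      unfolding S_def
    proof (rule power_series_holomorphic[of 0 \<rho> "b j"])
      fix w :: complex assume "w \<in> ball 0 \<rho>"
      then show "(\<lambda>n. b j n * (w - 0) ^ n) sums (\<Sum>n. b j n * w ^ n)"
        using sum0[of w j] by (simp add: summable_sums)
    qed
    \<comment> \<open>The common power with exponent \<open>\<mu> False\<close> is divided out of
      the relation; what remains is holomorphic on the whole disc. At 0 it gives
      \<open>y = 0\<close>, because \<open>N > 0\<close> removes the first summand, and then
      \<open>x = 0\<close> follows from \<open>c True 0 \<noteq> 0\<close>.\<close>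
    define G where "G w = x * w ^ N * S True w + y * S False w" for w
    have holG: "G holomorphic_on ball 0 \<rho>" unfolding G_def by (intro holomorphic_intros holS)
    define p where "p = complex_of_real R powi \<sigma>"
    have p: "p \<noteq> 0" "norm p = R powi \<sigma>" using R by (auto simp: p_def norm_power_int)
    have zp: "\<forall>\<^sub>F w in nhds p. G w = 0"
    proof -
      define h where "h w = a + w powi \<sigma>" for w
      have "isCont h p" unfolding h_def using p by (intro continuous_intros) auto
      then have "(h \<longlongrightarrow> h p) (nhds p)" by (simp add: isCont_def tendsto_at_iff_tendsto_nhds)
      then have "((\<lambda>w. a + w powi \<sigma>) \<longlongrightarrow> a + p powi \<sigma>) (nhds p)" by (simp add: h_def[abs_def])
      moreover have "a + p powi \<sigma> = \<gamma> 0" using \<sigma> by (auto simp: p_def \<gamma>0 power_int_minus)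
      ultimately have "\<forall>\<^sub>F w in nhds p. a + w powi \<sigma> \<in> ball (\<gamma> 0) (R / 2)"
        using R by (intro topological_tendstoD) auto
      then show ?thesis
      proof eventually_elim
        case (elim w)
        define z where "z = a + w powi \<sigma>"
        define \<zeta> where "\<zeta> = of_int \<sigma> * branch a R \<sigma> 0 z"
        have e: "exp \<zeta> = w" using ex(1)[OF elim] \<sigma> by (auto simp: \<zeta>_def z_def power_int_minus)
        have e2: "exp (\<zeta> * of_nat N) = w ^ N" unfolding e[symmetric] by (rule exp_of_nat2_mult)
        have "x * F True 0 z + y * F False 0 z = 0" using xy elim by (simp add: z_def)
        also have "x * F True 0 z + y * F False 0 z = exp (\<mu> False * \<zeta>) * G w"
          unfolding F_def Y_def frob_fun_def \<zeta>_def[symmetric] e \<mu> G_def S_def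
          by (simp add: ring_distribs exp_add e2 mult_ac)
        finally show ?case by simp
      qed
    qed
    have pb: "p \<in> ball 0 \<rho>" using p \<rho> R by (smt (verit) dist_0_norm mem_ball zero_less_power_int)
    have G0: "G w = 0" if "w \<in> ball 0 \<rho>" for w by (rule holomorphic_zero_on_ball[OF holG pb zp that])
    have y: "y = 0" using G0[of 0] \<open>\<rho> > 0\<close> N c0[of False] by (simp add: G_def S0 zero_power)
    have "x = 0"
    proof (rule ccontr)
      assume "x \<noteq> 0"
      have "S True w = 0" if "w \<in> ball 0 \<rho>" "w \<noteq> 0" for w using G0[OF that(1)] \<open>x \<noteq> 0\<close> that(2) by (simp add: G_def y)
      moreover have "\<forall>\<^sub>F w in nhds p. w \<in> ball 0 \<rho> - {0}"
        using pb p by (intro eventually_nhds_in_open) auto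
      ultimately have "\<forall>\<^sub>F w in nhds p. S True w = 0" by (auto elim: eventually_mono)
      from holomorphic_zero_on_ball[OF holS pb this, of 0] show False using \<open>\<rho> > 0\<close> S0 c0 by simp
    qed
    with y show ?thesis by simp
  qed
  define J :: "2 \<Rightarrow> bool" where "J j \<longleftrightarrow> j = 1" for j
  have "fundamental_system P Q (ball (\<gamma> 0) (R / 2)) (\<lambda>j. F (J j) 0)"
    unfolding fundamental_system_def
  proof (intro conjI allI impI sol)
    fix l :: "2 \<Rightarrow> complex" and i :: 2
    assume "\<forall>z\<in>ball (\<gamma> 0) (R / 2). (\<Sum>j\<in>UNIV. l j * F (J j) 0 z) = 0"
    then have "l 1 = 0 \<and> l 2 = 0" by (intro indep) (auto simp: sum_2 J_def)
    then show "l i = 0" using exhaust_2[of i] by auto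
  qed
  moreover have "F (J j) 1 z = (\<Sum>i\<in>UNIV. F (J i) 0 z * (mat \<kappa> :: complex^2^2) $ i $ j)" for j z
    unfolding fin \<kappa> by (simp add: mat_def if_distrib sum.delta cong: if_cong)
  ultimately show ?thesis
    unfolding monodromy_matrix_def pathstart_def using R cont
    by (intro exI[of _ \<kappa>] exI[of _ "\<lambda>j. F (J j)"] exI[of _ "R / 2"]) auto
qed

section \<open>Apparent singularities of Heun's equation\<close>

text \<open>
  Coefficients in the sense of \<^const>\<open>euler_op\<close> of Heun's equation with singular points \<open>a, b, c\<close>,
  exponent parameters \<open>ea, eb, ec\<close> and numerator \<open>p z - q\<close>, in the variable \<open>x = z - a\<close>.
\<close>

definition heunk :: "complex \<Rightarrow> complex \<Rightarrow> complex \<Rightarrow> complex \<Rightarrow> complex \<Rightarrow> complex \<Rightarrow> complex \<Rightarrow> complex \<Rightarrow> nat \<Rightarrow> nat \<Rightarrow> complex" where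
  "heunk a b c ea eb ec p q i j =
    [[0, (b - a) * (c - a) * (ea - 1), (b - a) * (c - a)],
     [p * a - q, (b - a) + (c - a) - ea * ((b - a) + (c - a)) - eb * (c - a) - ec * (b - a), - ((b - a) + (c - a))],
     [p, ea + eb + ec - 1, 1]] ! i ! j"

lemma heunk_2 [simp]:
  "heunk a b c ea eb ec p q 0 2 = (b - a) * (c - a)"
  "heunk a b c ea eb ec p q 1 2 = - ((b - a) + (c - a))"
  "heunk a b c ea eb ec p q (Suc 0) 2 = - ((b - a) + (c - a))"
  "heunk a b c ea eb ec p q 2 2 = 1"
  by (simp_all add: heunk_def)

lemma quad_heunk:
  "quad (heunk a b c ea eb ec p q) 0 \<rho> = (b - a) * (c - a) * \<rho> * (\<rho> - 1 + ea)"
  "quad (heunk a b c ea eb ec p q) 1 \<rho> = - ((b - a) + (c - a)) * \<rho> * (\<rho> - 1)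
     - (ea * ((b - a) + (c - a)) + eb * (c - a) + ec * (b - a)) * \<rho> - (q - p * a)"
  "quad (heunk a b c ea eb ec p q) 2 \<rho> = \<rho> * (\<rho> - 1) + (ea + eb + ec) * \<rho> + p"
  by (simp_all add: quad_def heunk_def algebra_simps power2_eq_square)

text \<open>Multiplying by \<open>(z - a)\<^sup>2 * (z - b) * (z - c)\<close> clears all
  denominators and turns derivatives into powers of the Euler operator. The remaining factor is
  quadratic in z - a, hence the three terms.\<close>

lemma euler_op_heunk:
  assumes "z \<noteq> a" "z \<noteq> b" "z \<noteq> c"
  shows "euler_op (heunk a b c ea eb ec p q) (z - a) y0 ((z - a) * y1) ((z - a) * y1 + (z - a)\<^sup>2 * y2) =
    (z - a) * ((z - a) * (z - b) * (z - c)) *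
    (y2 + (ea / (z - a) + eb / (z - b) + ec / (z - c)) * y1 + (p * z - q) / ((z - a) * (z - b) * (z - c)) * y0)"
proof -
  define w u v where "w = z - a" and "u = b - a" and "v = c - a"
  have z: "z = a + w" "z - a = w" "z - b = w - u" "z - c = w - v" and uv: "b - a = u" "c - a = v" by (simp_all add: w_def u_def v_def)
  have ne: "w \<noteq> 0" "w - u \<noteq> 0" "w - v \<noteq> 0" using assms by (auto simp: w_def u_def v_def)
  define X Y where "X = w - u" and "Y = w - v"
  have XY: "u = w - X" "v = w - Y" "X \<noteq> 0" "Y \<noteq> 0" using ne by (simp_all add: X_def Y_def)
  have "w * (w * X * Y) * (y2 + (ea / w + eb / X + ec / Y) * y1 + (p * (a + w) - q) / (w * X * Y) * y0) =
    w\<^sup>2 * X * Y * y2 + w * (ea * X * Y + eb * w * Y + ec * w * X) * y1 + w * (p * (a + w) - q) * y0"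
    using ne(1) XY(3,4) by (simp add: field_simps power2_eq_square)
  moreover have "euler_op (heunk a b c ea eb ec p q) w y0 (w * y1) (w * y1 + w\<^sup>2 * y2) =
    w\<^sup>2 * X * Y * y2 + w * (ea * X * Y + eb * w * Y + ec * w * X) * y1 + w * (p * (a + w) - q) * y0"
    unfolding X_def Y_def
    by (simp add: euler_op_def heunk_def sum_le_2 uv) (simp add: algebra_simps power2_eq_square)
  ultimately show ?thesis unfolding z(2-4) unfolding z(1) X_def Y_def by simp
qed

text \<open>Each expression is a sum or product over the set of singular points and so depends only
  on that set.\<close>

lemma heun_perm:
  assumes "t \<noteq> 0" "t \<noteq> (1 :: complex)" "{a, b, c} = {0, 1, t}" "a \<noteq> b" "b \<noteq> c" "c \<noteq> a"
  shows "heun_P t \<epsilon> z = \<epsilon> a / (z - a) + \<epsilon> b / (z - b) + \<epsilon> c / (z - c)"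
    and "z * (z - 1) * (z - t) = (z - a) * (z - b) * (z - c)"
    and "f 0 + f 1 + f t = f a + f b + (f c :: complex)"
proof -
  have 0: "(\<Sum>p\<in>{0, 1, t}. \<epsilon> p / (z - p)) = (\<Sum>p\<in>{a, b, c}. \<epsilon> p / (z - p))" 
    "(\<Prod>p\<in>{0, 1, t}. z - p) = (\<Prod>p\<in>{a, b, c}. z - p)" "sum f {0, 1, t} = sum f {a, b, c}"
    using assms by simp_all
  show "heun_P t \<epsilon> z = \<epsilon> a / (z - a) + \<epsilon> b / (z - b) + \<epsilon> c / (z - c)"
    using 0(1) assms(1,2,4-6) by (auto simp: heun_P_def add.assoc)
  show "z * (z - 1) * (z - t) = (z - a) * (z - b) * (z - c)"
    using 0(2) assms(1,2,4-6) by (auto simp: mult.assoc)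
  show "f 0 + f 1 + f t = f a + f b + f c"
    using 0(3) assms(1,2,4-6) by (auto simp: add.assoc)
qed

text \<open>At the upper exponent a series always exists, since no indicial root lies above it; at
  the lower one the given coefficients up to \<open>N\<close> carry the recurrence past the only
  obstruction. The index \<open>True\<close> marks the upper exponent.\<close>

lemma frob_pair:
  assumes N: "N > 0" and k: "k 0 2 \<noteq> 0" and quad0: "\<And>\<rho>. quad k 0 \<rho> = k 0 2 * (\<rho> - \<mu>) * (\<rho> - \<mu> - of_nat N)"
    and neg: "\<And>n. n < 0 \<Longrightarrow> c n = 0" and c0: "c 0 \<noteq> 0" and rec: "\<And>n. n \<le> int N \<Longrightarrow> frob_at k \<mu> c n"
  shows "\<exists>\<nu> d \<rho>. \<nu> True = \<nu> False + of_nat N \<and> (\<forall>j. \<forall>n<0. d j n = 0) \<and> (\<forall>j. d j 0 \<noteq> 0) \<and>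
     (\<forall>j n. frob_at k (\<nu> j) (d j) n) \<and> \<rho> > 0 \<and> (\<forall>j x. norm x < \<rho> \<longrightarrow> summable (\<lambda>n. d j (int n) * x ^ n))"
proof -
  have nz: "quad k 0 (\<mu> + of_int n) \<noteq> 0" if "n > int N" for n
  proof -
    have "quad k 0 (\<mu> + of_int n) = k 0 2 * of_int n * of_int (n - int N)" by (simp add: quad0)
    moreover have "n \<noteq> 0" "n - int N \<noteq> 0" using that by auto
    ultimately show ?thesis using k by (simp del: of_int_diff)
  qed
  have "\<exists>d \<rho>. (\<forall>n<0. d n = 0) \<and> (\<forall>n\<le>int N. d n = c n) \<and> (\<forall>n. frob_at k \<mu> d n) \<and>
    \<rho> > 0 \<and> (\<forall>x. norm x < \<rho> \<longrightarrow> summable (\<lambda>n. d (int n) * x ^ n))"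
    by (rule frob_extension) (fact neg rec nz k)+
  then obtain d1 \<rho>1 where 1: "\<forall>n<0. d1 n = 0" "\<forall>n\<le>int N. d1 n = c n" "\<forall>n. frob_at k \<mu> d1 n"
    "\<rho>1 > 0" "\<forall>x. norm x < \<rho>1 \<longrightarrow> summable (\<lambda>n. d1 (int n) * x ^ n)"
    by blast
  define e where "e n = (if n = 0 then 1 else 0 :: complex)" for n :: int
  have e_rec: "frob_at k (\<mu> + of_nat N) e n" if "n \<le> int 0" for n
    using that quad0[of "\<mu> + of_nat N"] by (auto simp: frob_at_def sum_le_2 e_def)
  have e_nz: "quad k 0 (\<mu> + of_nat N + of_int n) \<noteq> 0" if "n > int 0" for n
    using nz[of "int N + n"] that by (simp add: add.assoc)
  have e_neg: "e n = 0" if "n < 0" for n using that by (simp add: e_def)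
  have "\<exists>d \<rho>. (\<forall>n<0. d n = 0) \<and> (\<forall>n\<le>int 0. d n = e n) \<and> (\<forall>n. frob_at k (\<mu> + of_nat N) d n) \<and>
    \<rho> > 0 \<and> (\<forall>x. norm x < \<rho> \<longrightarrow> summable (\<lambda>n. d (int n) * x ^ n))"
    by (rule frob_extension) (fact e_neg e_rec e_nz k)+
  then obtain d2 \<rho>2 where 2: "\<forall>n<0. d2 n = 0" "\<forall>n\<le>int 0. d2 n = e n" "\<forall>n. frob_at k (\<mu> + of_nat N) d2 n"
    "\<rho>2 > 0" "\<forall>x. norm x < \<rho>2 \<longrightarrow> summable (\<lambda>n. d2 (int n) * x ^ n)"
    by blast
  show ?thesis
    by (rule exI[of _ "\<lambda>j. if j then \<mu> + of_nat N else \<mu>"], rule exI[of _ "\<lambda>j. if j then d2 else d1"], rule exI[of _ "min \<rho>1 \<rho>2"])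
       (use 1 2 c0 in \<open>auto simp: e_def\<close>)
qed

lemma chart_coeffs_1: "chart_coeffs 1 k = k" and chart_coeffs_neg_1: "chart_coeffs (-1) k = reflect k"
  by (simp_all add: chart_coeffs_def)

locale heun =
  fixes t :: complex and \<epsilon> :: "complex \<Rightarrow> complex" and \<alpha> \<beta> q a b c :: complex
  assumes t: "t \<noteq> 0" "t \<noteq> 1" and abc: "{a, b, c} = {0, 1, t}" and ne: "a \<noteq> b" "b \<noteq> c" "c \<noteq> a"
    and fuchs: "\<epsilon> 0 + \<epsilon> 1 + \<epsilon> t = \<alpha> + \<beta> + 1"
begin

lemma fuchs': "\<epsilon> a + \<epsilon> b + \<epsilon> c = \<alpha> + \<beta> + 1"
  using heun_perm(3)[OF t abc ne, of \<epsilon>] fuchs by simp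

abbreviation "k \<equiv> heunk a b c (\<epsilon> a) (\<epsilon> b) (\<epsilon> c) (\<alpha> * \<beta>) q"
abbreviation "P \<equiv> heun_P t \<epsilon>"

abbreviation "Q \<equiv> heun_Q t \<alpha> \<beta> q"

lemma euler_iff:
  assumes "z \<notin> {0, 1, t}"
  shows "euler_op k (z - a) y0 ((z - a) * y1) ((z - a) * y1 + (z - a)\<^sup>2 * y2) = 0 \<longleftrightarrow>
    y2 + P z * y1 + Q z * y0 = 0"
proof -
  have z: "z \<noteq> a" "z \<noteq> b" "z \<noteq> c" using assms unfolding abc[symmetric] by auto
  show ?thesis
    unfolding euler_op_heunk[OF z] heun_Q_def heun_perm[OF t abc ne] using z by simp
qed

lemma circlepath_ee: "circlepath a r s = a + of_real r * ee (of_int 1) s"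
  by (simp add: circlepath ee_def)

lemma apparent_imp_frob:
  assumes ap: "heun_apparent_at t \<epsilon> \<alpha> \<beta> q a"
    and N: "N > 0" and \<mu>: "\<And>\<rho>. \<rho> * (\<rho> - 1 + \<epsilon> a) = (\<rho> - \<mu>) * (\<rho> - \<mu> - of_nat N)"
  shows "\<exists>c. (\<forall>n<0. c n = 0) \<and> c 0 \<noteq> 0 \<and> (\<forall>n. frob_at k \<mu> c n)"
proof -
  obtain r \<kappa> where r: "r > 0" "{0, 1, t} \<inter> cball a r \<subseteq> {a}"
    and mono: "monodromy_matrix P Q (circlepath a r) (mat \<kappa>)"
    using ap unfolding heun_apparent_at_def apparent_at_def by blast
  have bc: "norm (b - a) > r" "norm (c - a) > r"
    using r(2) ne unfolding abc[symmetric] by (auto simp: dist_norm norm_minus_commute not_le[symmetric])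
  have u: "b - a \<noteq> 0" "c - a \<noteq> 0" using ne by auto
  show ?thesis
  \<comment> \<open>In x = z - a the other singular points are \<open>b - a\<close> and
    \<open>c - a\<close>, hence the reciprocals; \<open>bc\<close> says that they lie outside the
    circle.\<close>
  proof (rule monodromy_imp_frob[where k = k and K = k and r = r and R = r and \<mu> = \<mu> and N = N
        and u = "inverse (b - a)" and v = "inverse (c - a)" and \<sigma> = 1 and \<gamma> = "circlepath a r"
        and \<kappa> = \<kappa> and a = a and P = P and Q = Q])
    have "a + of_real r \<notin> {a, b, c}"
      using r bc by (auto simp: norm_minus_commute)
    moreover have "open (- {a, b, c})" by (intro open_Compl finite_imp_closed) auto
    ultimately have "\<forall>\<^sub>F z in nhds (a + of_real r). z \<in> - {a, b, c}"
      by (intro eventually_nhds_in_open) auto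
    then show "\<forall>\<^sub>F z in nhds (a + of_real r). \<forall>y0 y1 y2. y2 + P z * y1 + Q z * y0 = 0 \<longrightarrow>
         euler_op k (z - a) y0 ((z - a) * y1) ((z - a) * y1 + (z - a)\<^sup>2 * y2) = 0"
      by eventually_elim (use euler_iff abc in auto)
    show "quad k 0 \<rho> = k 0 2 * (\<rho> - \<mu>) * (\<rho> - \<mu> - of_nat N)" for \<rho>
      unfolding quad_heunk using \<mu>[of \<rho>] by (simp add: mult.assoc)
    show "k 0 2 \<noteq> 0" using u by simp
    show "k 1 2 = - k 0 2 * (inverse (b - a) + inverse (c - a))" "k 2 2 = k 0 2 * (inverse (b - a) * inverse (c - a))"
    proof -
      have "x * y * (inverse x + inverse y) = x + y" "x * y * (inverse x * inverse y) = 1"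
        if "x \<noteq> 0" "y \<noteq> 0" for x y :: complex
        using that by (simp_all add: field_simps)
      from this[OF u] show "k 1 2 = - k 0 2 * (inverse (b - a) + inverse (c - a))" "k 2 2 = k 0 2 * (inverse (b - a) * inverse (c - a))"
        by simp_all
    qed
    show "norm (inverse (b - a)) * r < 1" "norm (inverse (c - a)) * r < 1"
      using bc r(1) by (simp_all only: norm_inverse, simp_all add: inverse_eq_divide divide_less_eq)
    show "circlepath a r s = a + of_real r * ee (of_int 1) s" for s by (rule circlepath_ee)
    show "monodromy_matrix P Q (circlepath a r) (mat \<kappa>)" by (rule mono)
    show "k = chart_coeffs 1 k" by (simp only: chart_coeffs_1)
  qed (use r(1) N in simp_all)
qed

lemma reversepath_circlepath_ee: "reversepath (circlepath 0 R) s = 0 + of_real R * ee (of_int (-1)) s"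
proof -
  have "2 * of_real pi * \<i> * of_real (1 - s) = 2 * of_real pi * \<i> + 2 * of_real pi * \<i> * of_int (-1) * of_real s"
    by (simp add: right_diff_distrib)
  then show ?thesis
    by (simp only: circlepath reversepath_def ee_def exp_add exp_two_pi_i mult_1_left add_0)
qed

lemma quad_reflect_0: "quad (reflect k) 0 \<rho> = (\<rho> - \<alpha>) * (\<rho> - \<beta>)"
proof -
  have "quad (reflect k) 0 \<rho> = quad k 2 (- \<rho>)" by (simp add: quad_reflect)
  also have "\<dots> = (\<rho> - \<alpha>) * (\<rho> - \<beta>)"
    unfolding quad_heunk fuchs' by (simp add: algebra_simps)
  finally show ?thesis .
qed

lemma reflect_2: "reflect k 0 2 = 1" "reflect k 1 2 = - ((b - a) + (c - a))" "reflect k 2 2 = (b - a) * (c - a)"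
  by (simp_all add: reflect_def)

text \<open>With \<open>a = 0\<close> the chart is x = 1/z, matching the circle centred at 0. The
  two nonzero singular points sit at 1/b and 1/c, so their reciprocals \<open>b - a\<close> and
  \<open>c - a\<close> serve as \<open>u\<close> and \<open>v\<close>.\<close>

lemma apparent_at_infinity_imp_frob:
  assumes ap: "heun_apparent_at_infinity t \<epsilon> \<alpha> \<beta> q" and a: "a = 0"
    and N: "N > 0" and \<mu>: "\<And>\<rho>. (\<rho> - \<alpha>) * (\<rho> - \<beta>) = (\<rho> - \<mu>) * (\<rho> - \<mu> - of_nat N)"
  shows "\<exists>c. (\<forall>n<0. c n = 0) \<and> c 0 \<noteq> 0 \<and> (\<forall>n. frob_at (reflect k) \<mu> c n)"
proof -
  obtain R \<kappa> where R: "R > 0" "{0, 1, t} \<subseteq> ball 0 R"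
    and mono: "monodromy_matrix P Q (reversepath (circlepath 0 R)) (mat \<kappa>)"
    using ap unfolding heun_apparent_at_infinity_def apparent_at_infinity_def by blast
  have bc: "norm b < R" "norm c < R"
    using R(2) unfolding abc[symmetric] by auto
  show ?thesis
  proof (rule monodromy_imp_frob[where k = k and K = "reflect k" and r = "inverse R" and R = R and \<mu> = \<mu> and N = N
        and u = "b - a" and v = "c - a" and \<sigma> = "-1" and \<gamma> = "reversepath (circlepath 0 R)"
        and \<kappa> = \<kappa> and a = 0 and P = P and Q = Q])
    have "0 + of_real R \<notin> {0, 1, t}" using R by auto
    moreover have "open (- {0, 1, t})" by (intro open_Compl finite_imp_closed) auto
    ultimately have "\<forall>\<^sub>F z in nhds (0 + of_real R). z \<in> - {0, 1, t}"
      by (intro eventually_nhds_in_open) auto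
    then show "\<forall>\<^sub>F z in nhds (0 + of_real R). \<forall>y0 y1 y2. y2 + P z * y1 + Q z * y0 = 0 \<longrightarrow>
         euler_op k (z - 0) y0 ((z - 0) * y1) ((z - 0) * y1 + (z - 0)\<^sup>2 * y2) = 0"
      by eventually_elim (use euler_iff a in auto)
    show "quad (reflect k) 0 \<rho> = reflect k 0 2 * (\<rho> - \<mu>) * (\<rho> - \<mu> - of_nat N)" for \<rho>
      unfolding quad_reflect_0 reflect_2 using \<mu>[of \<rho>] by simp
    show "reflect k 0 2 \<noteq> 0" by (simp add: reflect_2)
    show "reflect k 1 2 = - reflect k 0 2 * (b - a + (c - a))" "reflect k 2 2 = reflect k 0 2 * ((b - a) * (c - a))"
      unfolding reflect_2 by simp_all
    show "norm (b - a) * inverse R < 1" "norm (c - a) * inverse R < 1"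
      using bc R(1) a by (simp_all add: field_simps)
    show "inverse R = R powi -1" by (simp add: power_int_minus)
    show "reversepath (circlepath 0 R) s = 0 + of_real R * ee (of_int (-1)) s" for s by (rule reversepath_circlepath_ee)
    show "monodromy_matrix P Q (reversepath (circlepath 0 R)) (mat \<kappa>)" by (rule mono)
    show "reflect k = chart_coeffs (-1) k" by (simp only: chart_coeffs_neg_1)
    show "0 < R" by (rule R)
    show "0 < N" by (rule N)
  qed simp
qed

lemma frob_imp_apparent:
  assumes N: "N > 0" and \<mu>: "\<And>\<rho>. \<rho> * (\<rho> - 1 + \<epsilon> a) = (\<rho> - \<mu>) * (\<rho> - \<mu> - of_nat N)"
    and neg: "\<And>n. n < 0 \<Longrightarrow> d n = 0" and d0: "d 0 \<noteq> 0" and rec: "\<And>n. n \<le> int N \<Longrightarrow> frob_at k \<mu> d n"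
  shows "heun_apparent_at t \<epsilon> \<alpha> \<beta> q a"
proof -
  have u: "b - a \<noteq> 0" "c - a \<noteq> 0" using ne by auto
  have "quad k 0 \<rho> = k 0 2 * (\<rho> - \<mu>) * (\<rho> - \<mu> - of_nat N)" for \<rho>
    unfolding quad_heunk using \<mu>[of \<rho>] by (simp add: mult.assoc)
  note quad0 = this
  have k2: "k 0 2 \<noteq> 0" using u by simp
  have "\<exists>\<nu> d \<rho>. \<nu> True = \<nu> False + of_nat N \<and> (\<forall>j. \<forall>n<0. d j n = 0) \<and> (\<forall>j. d j 0 \<noteq> 0) \<and>
     (\<forall>j n. frob_at k (\<nu> j) (d j) n) \<and> \<rho> > 0 \<and> (\<forall>j x. norm x < \<rho> \<longrightarrow> summable (\<lambda>n. d j (int n) * x ^ n))"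
    by (rule frob_pair) (fact N k2 quad0 neg d0 rec)+
  then obtain \<nu> e \<rho> where e: "\<nu> True = \<nu> False + of_nat N" "\<And>j n. n < 0 \<Longrightarrow> e j n = 0" "\<And>j. e j 0 \<noteq> 0"
    "\<And>j n. frob_at k (\<nu> j) (e j) n" "\<rho> > 0" "\<And>j x. norm x < \<rho> \<Longrightarrow> summable (\<lambda>n. e j (int n) * x ^ n)"
    by blast
  \<comment> \<open>The circle may be shrunk: \<open>2 * R\<close> is put below the radius of
    convergence and below the distances to the other singular points.\<close>
  define m where "m = min \<rho> (min (norm (b - a)) (norm (c - a)))"
  define R where "R = m / 3"
  have "m > 0" "m \<le> \<rho>" "m \<le> norm (b - a)" "m \<le> norm (c - a)" using e(5) u by (auto simp: m_def)
  then have R: "R > 0" "2 * R < \<rho>" "2 * R < norm (b - a)" "2 * R < norm (c - a)"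
    unfolding R_def by linarith+
  have "\<exists>\<kappa>. monodromy_matrix P Q (circlepath a R) (mat \<kappa>)"
  proof (rule frob_imp_monodromy[where k = k and K = k and R = R and \<sigma> = 1 and a = a and N = N and c = e and \<mu> = \<nu> and \<rho> = \<rho>])
    fix z y0 y1 y2
    assume z: "z \<in> ball (a + of_real R) (R / 2)"
      and eu: "euler_op k (z - a) y0 ((z - a) * y1) ((z - a) * y1 + (z - a)\<^sup>2 * y2) = 0"
    have n1: "norm (z - a - of_real R) < R / 2" using z by (simp add: dist_norm norm_minus_commute algebra_simps)
    have "norm (z - a) < 2 * R" using norm_triangle_ineq2[of "z - a" "of_real R"] n1 R(1) by simp
    moreover have "z \<noteq> a" using n1 R(1) by auto
    ultimately have "z \<notin> {0, 1, t}" using R unfolding abc[symmetric] by auto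
    with eu show "y2 + P z * y1 + Q z * y0 = 0" using euler_iff by blast
  next
    show "2 * R powi 1 < \<rho>" using R by simp
    show "circlepath a R s = a + of_real R * ee (of_int 1) s" for s by (rule circlepath_ee)
    show "k = chart_coeffs 1 k" by (simp only: chart_coeffs_1)
    show "0 < R" by (rule R)
    show "0 < N" by (rule N)
    show "\<nu> True = \<nu> False + of_nat N" by (rule e)
    show "e j n = 0" if "n < 0" for j n using that by (rule e)
    show "e j 0 \<noteq> 0" for j by (rule e)
    show "frob_at k (\<nu> j) (e j) n" for j n by (rule e)
    show "summable (\<lambda>n. e j (int n) * x ^ n)" if "norm x < \<rho>" for j x using that by (rule e)
  qed simp
  moreover have "{0, 1, t} \<inter> cball a R \<subseteq> {a}"
    unfolding abc[symmetric] using R by (auto simp: dist_norm norm_minus_commute)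
  ultimately show ?thesis unfolding heun_apparent_at_def apparent_at_def using R(1) by blast
qed

lemma frob_imp_apparent_at_infinity:
  assumes a: "a = 0" and N: "N > 0" and \<mu>: "\<And>\<rho>. (\<rho> - \<alpha>) * (\<rho> - \<beta>) = (\<rho> - \<mu>) * (\<rho> - \<mu> - of_nat N)"
    and neg: "\<And>n. n < 0 \<Longrightarrow> d n = 0" and d0: "d 0 \<noteq> 0" and rec: "\<And>n. n \<le> int N \<Longrightarrow> frob_at (reflect k) \<mu> d n"
  shows "heun_apparent_at_infinity t \<epsilon> \<alpha> \<beta> q"
proof -
  have "quad (reflect k) 0 \<rho> = reflect k 0 2 * (\<rho> - \<mu>) * (\<rho> - \<mu> - of_nat N)" for \<rho>
    unfolding quad_reflect_0 reflect_2 using \<mu>[of \<rho>] by simp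
  note quad0 = this
  have k2: "reflect k 0 2 \<noteq> 0" by (simp add: reflect_2)
  have "\<exists>\<nu> d \<rho>. \<nu> True = \<nu> False + of_nat N \<and> (\<forall>j. \<forall>n<0. d j n = 0) \<and> (\<forall>j. d j 0 \<noteq> 0) \<and>
     (\<forall>j n. frob_at (reflect k) (\<nu> j) (d j) n) \<and> \<rho> > 0 \<and> (\<forall>j x. norm x < \<rho> \<longrightarrow> summable (\<lambda>n. d j (int n) * x ^ n))"
    by (rule frob_pair) (fact N k2 quad0 neg d0 rec)+
  then obtain \<nu> e \<rho> where e: "\<nu> True = \<nu> False + of_nat N" "\<And>j n. n < 0 \<Longrightarrow> e j n = 0" "\<And>j. e j 0 \<noteq> 0"
    "\<And>j n. frob_at (reflect k) (\<nu> j) (e j) n" "\<rho> > 0" "\<And>j x. norm x < \<rho> \<Longrightarrow> summable (\<lambda>n. e j (int n) * x ^ n)"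
    by blast
  \<comment> \<open>Large enough that \<open>2 / R < \<rho>\<close> in the chart 1/z and that the
    ball of radius \<open>R / 2\<close> about \<open>R\<close> avoids 0, 1 and
    \<open>t\<close>.\<close>
  define R where "R = 3 * (inverse \<rho> + norm t + 1)"
  have i\<rho>: "inverse \<rho> > 0" using e(5) by simp
  have R: "R > 0" "inverse \<rho> < R / 3" "1 < R / 2" "norm t < R / 2"
    using i\<rho> by (simp_all add: R_def add_pos_nonneg, (smt (verit) norm_ge_zero)+)
  have R2: "2 * inverse R < \<rho>" using R(1,2) e(5) by (simp add: field_simps)
  have "\<exists>\<kappa>. monodromy_matrix P Q (reversepath (circlepath 0 R)) (mat \<kappa>)"
  proof (rule frob_imp_monodromy[where k = k and K = "reflect k" and R = R and \<sigma> = "-1" and a = 0 and N = N and c = e and \<mu> = \<nu> and \<rho> = \<rho>])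
    fix z y0 y1 y2
    assume z: "z \<in> ball (0 + of_real R) (R / 2)"
      and eu: "euler_op k (z - 0) y0 ((z - 0) * y1) ((z - 0) * y1 + (z - 0)\<^sup>2 * y2) = 0"
    have n1: "norm (of_real R - z) < R / 2" using z by (simp add: dist_norm)
    have "norm z > R / 2" using norm_triangle_ineq2[of "of_real R" "of_real R - z"] norm_triangle_ineq3[of "of_real R" z] n1 R(1) by simp
    then have "z \<notin> {0, 1, t}" using R by auto
    with eu show "y2 + P z * y1 + Q z * y0 = 0" using euler_iff a by simp
  next
    show "2 * R powi -1 < \<rho>" using R2 by (simp add: power_int_minus)
    show "reversepath (circlepath 0 R) s = 0 + of_real R * ee (of_int (-1)) s" for s by (rule reversepath_circlepath_ee)
    show "reflect k = chart_coeffs (-1) k" by (simp only: chart_coeffs_neg_1)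
    show "0 < R" by (rule R)
    show "0 < N" by (rule N)
    show "\<nu> True = \<nu> False + of_nat N" by (rule e)
    show "e j n = 0" if "n < 0" for j n using that by (rule e)
    show "e j 0 \<noteq> 0" for j by (rule e)
    show "frob_at (reflect k) (\<nu> j) (e j) n" for j n by (rule e)
    show "summable (\<lambda>n. e j (int n) * x ^ n)" if "norm x < \<rho>" for j x using that by (rule e)
  qed simp
  moreover have "{0, 1, t} \<subseteq> ball 0 R" using R by auto
  ultimately show ?thesis unfolding heun_apparent_at_infinity_def apparent_at_infinity_def using R(1) by blast
qed

end

section \<open>Polynomial and product solutions\<close>

text \<open>Coefficients in powers of z - a, extended by 0 to negative indices to match the
  integer-indexed recurrence.\<close>

definition icoeff :: "complex \<Rightarrow> complex poly \<Rightarrow> int \<Rightarrow> complex" where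
  "icoeff a h n = (if n < 0 then 0 else coeff (pcompose h [:a, 1:]) (nat n))"

definition poly_euler :: "(nat \<Rightarrow> nat \<Rightarrow> complex) \<Rightarrow> complex \<Rightarrow> complex poly \<Rightarrow> complex \<Rightarrow> complex" where
  "poly_euler k a h z = euler_op k (z - a) (poly h z) ((z - a) * poly (pderiv h) z)
     ((z - a) * poly (pderiv h) z + (z - a)\<^sup>2 * poly (pderiv (pderiv h)) z)"

lemma pcompose_shift_inverse: "pcompose (pcompose h [:a, 1:]) [:- a, 1:] = (h :: complex poly)"
  by (simp add: pcompose_assoc[symmetric] pcompose_pCons pcompose_idR)

text \<open>\<open>E\<close> is the operator applied to the shifted polynomial, again as a
  polynomial. Its values are those of \<open>poly_euler\<close> and its coefficients are the left
  sides of the recurrence, which ties the equation to the recurrence.\<close>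

lemma poly_euler_poly:
  defines "E \<equiv> \<lambda>k a h. \<Sum>i\<le>2. monom 1 i * (smult (k i 0) (pcompose h [:a, 1:])
      + smult (k i 1) ([:0, 1:] * pderiv (pcompose h [:a, 1:]))
      + smult (k i 2) ([:0, 1:] * pderiv ([:0, 1:] * pderiv (pcompose h [:a, 1:]))))"
  shows "poly (pcompose (E k a h) [:- a, 1:]) z = poly_euler k a h z"
    and "(\<forall>n. frob_at k 0 (icoeff a h) n) \<longleftrightarrow> E k a h = 0"
proof -
  define g where "g = pcompose h [:a, 1:]"
  have g': "pderiv g = pcompose (pderiv h) [:a, 1:]"
    by (simp add: g_def pderiv_pcompose pderiv_pCons)
  have g'': "pderiv (pderiv g) = pcompose (pderiv (pderiv h)) [:a, 1:]"
    unfolding g' by (simp add: pderiv_pcompose pderiv_pCons)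
  have p: "poly g (z - a) = poly h z" "poly (pderiv g) (z - a) = poly (pderiv h) z" "poly (pderiv (pderiv g)) (z - a) = poly (pderiv (pderiv h)) z"
    by (simp add: g_def poly_pcompose, simp add: g' poly_pcompose, simp add: g'' poly_pcompose)
  show "poly (pcompose (E k a h) [:- a, 1:]) z = poly_euler k a h z"
  proof -
    have w: "poly [:- a, 1:] z = z - a" by simp
    have T1: "poly ([:0, 1:] * pderiv g) (z - a) = (z - a) * poly (pderiv h) z"
      unfolding poly_mult p by simp
    have "pderiv ([:0, 1:] * pderiv g) = pderiv g + [:0, 1:] * pderiv (pderiv g)"
      by (simp add: pderiv_mult pderiv_pCons)
    then have T2: "poly ([:0, 1:] * pderiv ([:0, 1:] * pderiv g)) (z - a) =
        (z - a) * poly (pderiv h) z + (z - a)\<^sup>2 * poly (pderiv (pderiv h)) z"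
      by (simp only: poly_mult poly_add p) (simp add: algebra_simps power2_eq_square)
    show ?thesis
      unfolding E_def g_def[symmetric] poly_euler_def euler_op_def poly_pcompose w
      by (simp only: poly_sum poly_mult[of "monom _ _"] poly_add poly_smult poly_monom T1 T2 p mult_1_left)
  qed
  have cT: "coeff ([:0, 1:] * pderiv q) n = of_nat n * coeff q n" for q :: "complex poly" and n
    by (cases n) (simp_all add: coeff_pderiv coeff_pCons)
  have cE: "coeff (E k a h) n = (\<Sum>i\<le>2. quad k i (0 + of_int (int n - int i)) * icoeff a h (int n - int i))" for n
  proof -
    have "coeff (monom 1 i * (smult (k i 0) g + smult (k i 1) ([:0, 1:] * pderiv g) + smult (k i 2) ([:0, 1:] * pderiv ([:0, 1:] * pderiv g)))) n
      = quad k i (0 + of_int (int n - int i)) * icoeff a h (int n - int i)" for i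
    proof (cases "n < i")
      case True
      then show ?thesis by (simp add: coeff_monom_mult icoeff_def)
    next
      case False
      then have "nat (int n - int i) = n - i" "of_int (int n - int i) = (of_nat (n - i) :: complex)" by (auto simp: of_nat_diff)
      then show ?thesis using False
        by (simp only: coeff_monom_mult coeff_add coeff_smult cT icoeff_def quad_def g_def)
           (simp add: algebra_simps power2_eq_square)
    qed
    then show ?thesis unfolding E_def g_def[symmetric] by (simp add: coeff_sum)
  qed
  have neg: "frob_at k 0 (icoeff a h) n" if "n < 0" for n
    using that by (simp add: frob_at_def icoeff_def)
  show "(\<forall>n. frob_at k 0 (icoeff a h) n) \<longleftrightarrow> E k a h = 0"
  proof
    assume "\<forall>n. frob_at k 0 (icoeff a h) n"
    then have "coeff (E k a h) n = 0" for n unfolding cE frob_at_def by blast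
    then show "E k a h = 0" by (simp add: poly_eq_iff)
  next
    assume 0: "E k a h = 0"
    show "\<forall>n. frob_at k 0 (icoeff a h) n"
    proof
      fix n :: int
      show "frob_at k 0 (icoeff a h) n"
      proof (cases "n < 0")
        case False
        then obtain m where "n = int m" by (metis not_less zero_le_imp_eq_int)
        then show ?thesis using cE[of m] 0 by (simp add: frob_at_def)
      qed (rule neg)
    qed
  qed
qed

lemma frob_imp_poly_euler:
  assumes "\<And>n. frob_at k 0 (icoeff a h) n" shows "poly_euler k a h z = 0"
  using poly_euler_poly(1)[where k = k and a = a and h = h and z = z] poly_euler_poly(2)[where k = k and a = a and h = h] assms by simp

lemma poly_euler_imp_frob:
  assumes U: "open U" "U \<noteq> {}" and z: "\<And>z. z \<in> U \<Longrightarrow> poly_euler k a h z = 0"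
  shows "frob_at k 0 (icoeff a h) n"
proof -
  define E where "E = (\<Sum>i\<le>2. monom 1 i * (smult (k i 0) (pcompose h [:a, 1:])
      + smult (k i 1) ([:0, 1:] * pderiv (pcompose h [:a, 1:]))
      + smult (k i 2) ([:0, 1:] * pderiv ([:0, 1:] * pderiv (pcompose h [:a, 1:])))))"
  have "U \<subseteq> {z. poly (pcompose E [:- a, 1:]) z = 0}"
    using z poly_euler_poly(1)[where k = k and a = a and h = h] by (auto simp: E_def)
  moreover have "infinite U" using U finite_imp_not_open by blast
  ultimately have "pcompose E [:- a, 1:] = 0" using poly_roots_finite finite_subset by blast
  then have "E = 0" by (metis pcompose_0 pcompose_shift_inverse add.inverse_inverse)
  then show ?thesis using poly_euler_poly(2)[where k = k and a = a and h = h] by (simp add: E_def)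
qed

lemma icoeff_degree: "n > int (degree h) \<Longrightarrow> icoeff a h n = 0"
  by (simp add: icoeff_def coeff_eq_0 degree_pcompose)

lemma icoeff_top: "h \<noteq> 0 \<Longrightarrow> icoeff a h (int (degree h)) \<noteq> 0"
proof -
  assume "h \<noteq> 0"
  then have "pcompose h [:a, 1:] \<noteq> 0" by (metis pcompose_0 pcompose_shift_inverse)
  then have "lead_coeff (pcompose h [:a, 1:]) \<noteq> 0" by simp
  then show ?thesis by (simp add: icoeff_def degree_pcompose del: leading_coeff_0_iff)
qed

lemma icoeff_exists:
  assumes "\<And>n. n < 0 \<Longrightarrow> d n = 0" "\<And>n. n > int D \<Longrightarrow> d n = 0"
  shows "\<exists>h. icoeff a h = d \<and> degree h \<le> D"
proof -
  define g where "g = (\<Sum>n\<le>D. monom (d (int n)) n)"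
  define h where "h = pcompose g [:- a, 1:]"
  have "pcompose h [:a, 1:] = g" using pcompose_shift_inverse[of g "- a"] by (simp add: h_def)
  moreover have cg: "coeff g n = d (int n)" for n
    using assms(2)[of "int n"] by (simp add: g_def coeff_sum)
  ultimately have "icoeff a h = d" using assms(1) by (auto simp: icoeff_def fun_eq_iff)
  moreover have "degree h \<le> D" unfolding h_def degree_pcompose using assms(2) by (simp add: degree_le cg)
  ultimately show ?thesis by blast
qed

text \<open>Read from the top, the coefficients of a polynomial of degree \<open>D\<close> form a
  series in 1/(z - a) with exponent \<open>- D\<close>, and its recurrence is the reflected
  one.\<close>

lemma frob_at_reverse:
  assumes "frob_at k 0 c (D - n + 2)"
  shows "frob_at (reflect k) (- of_int D) (\<lambda>n. c (D - n)) n"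
  using assms by (simp add: frob_at_def sum_le_2 quad_reflect add_ac diff_diff_eq algebra_simps)

lemma frob_at_unreverse:
  assumes "frob_at (reflect k) (- of_int D) d (D - n + 2)"
  shows "frob_at k 0 (\<lambda>n. d (D - n)) n"
  using assms by (simp add: frob_at_def sum_le_2 quad_reflect add_ac diff_diff_eq algebra_simps)

text \<open>
  For suitable \<open>x, y\<close> these are the factors by which Euler's integral transformation multiplies
  the coefficients of a series; the zeros of \<open>x\<close> truncate the transformed series to a polynomial.
\<close>

definition gprod :: "(int \<Rightarrow> complex) \<Rightarrow> (int \<Rightarrow> complex) \<Rightarrow> int \<Rightarrow> complex" where
  "gprod x y n = (\<Prod>j\<in>{1..n}. x j / y j)"

lemma gprod_0 [simp]: "gprod x y 0 = 1"
  by (simp add: gprod_def)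

lemma gprod_step: "n \<ge> 1 \<Longrightarrow> gprod x y n = x n / y n * gprod x y (n - 1)"
proof -
  assume "n \<ge> 1"
  then have "{1..n} = insert n {1..n - 1}" by auto
  then show ?thesis by (simp add: gprod_def)
qed

lemma gprod_zero: "1 \<le> j \<Longrightarrow> j \<le> n \<Longrightarrow> x j = 0 \<Longrightarrow> gprod x y n = 0"
  by (auto simp: gprod_def intro!: prod_zero)

lemma gprod_nonzero: "(\<And>j. 1 \<le> j \<Longrightarrow> j \<le> n \<Longrightarrow> x j \<noteq> 0 \<and> y j \<noteq> 0) \<Longrightarrow> gprod x y n \<noteq> 0"
  by (auto simp: gprod_def)

text \<open>Write g for \<open>gprod x y\<close>, P for \<open>k\<close> and P' for
  \<open>k'\<close>. The assumptions give P'_0 g(n) = P_0 g(n-1), P'_1 = P_1 and P'_2 g(n-2) = P_2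
  g(n-1), each at the argument of its own term, so the new recurrence at \<open>n\<close> is g(n-1)
  times the old one. At \<open>n\<close> itself \<open>y\<close> may vanish if
  \<open>c n = 0\<close>, which is how the monodromy of the first equation is reached.\<close>

lemma frob_transfer:
  assumes neg: "\<And>n. n < 0 \<Longrightarrow> c n = 0" and rec: "frob_at k \<mu> c n"
    and start: "quad k' 0 \<mu>' = 0"
    and y: "\<And>j. 1 \<le> j \<Longrightarrow> j < n \<Longrightarrow> y j \<noteq> 0" and yn: "y n \<noteq> 0 \<or> c n = 0"
    and q0: "\<And>j::int. quad k' 0 (\<mu>' + of_int j) * x j = quad k 0 (\<mu> + of_int j) * y j"
    and q1: "\<And>j::int. quad k' 1 (\<mu>' + of_int j) = quad k 1 (\<mu> + of_int j)"
    and q2: "\<And>j::int. quad k' 2 (\<mu>' + of_int j) * y (j + 1) = quad k 2 (\<mu> + of_int j) * x (j + 1)"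
  shows "frob_at k' \<mu>' (\<lambda>n. gprod x y n * c n) n"
proof (cases "n \<ge> 1")
  case False
  then show ?thesis using neg start by (cases "n = 0") (auto simp: frob_at_def sum_le_2)
next
  case True
  define G where "G = gprod x y (n - 1)"
  have 0: "quad k' 0 (\<mu>' + of_int n) * (gprod x y n * c n) = G * (quad k 0 (\<mu> + of_int n) * c n)"
  proof (cases "c n = 0")
    case False
    then have "y n \<noteq> 0" using yn by blast
    then have "quad k' 0 (\<mu>' + of_int n) * (x n / y n) = quad k 0 (\<mu> + of_int n)" by (simp add: q0)
    moreover have "quad k' 0 (\<mu>' + of_int n) * (gprod x y n * c n) = (quad k' 0 (\<mu>' + of_int n) * (x n / y n)) * (G * c n)"
      unfolding G_def gprod_step[OF True] by (simp only: mult_ac)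
    ultimately show ?thesis by (simp only: mult_ac)
  qed simp
  have 1: "quad k' 1 (\<mu>' + of_int (n - 1)) * (gprod x y (n - 1) * c (n - 1)) = G * (quad k 1 (\<mu> + of_int (n - 1)) * c (n - 1))"
    unfolding q1 by (simp add: G_def)
  have 2: "quad k' 2 (\<mu>' + of_int (n - 2)) * (gprod x y (n - 2) * c (n - 2)) = G * (quad k 2 (\<mu> + of_int (n - 2)) * c (n - 2))"
  proof (cases "n \<ge> 2")
    case True
    then have "y (n - 1) \<noteq> 0" using y by simp
    then have "quad k' 2 (\<mu>' + of_int (n - 2)) = quad k 2 (\<mu> + of_int (n - 2)) * (x (n - 1) / y (n - 1))"
      using q2[of "n - 2"] by (simp add: eq_divide_eq)
    moreover have "G = x (n - 1) / y (n - 1) * gprod x y (n - 2)"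
      using gprod_step[of "n - 1" x y] True by (simp add: G_def)
    ultimately show ?thesis by (simp only: mult_ac)
  qed (simp add: neg)
  have e: "(\<Sum>i\<le>2. quad K i (M + of_int (n - int i)) * d (n - int i)) = quad K 0 (M + of_int n) * d n
      + quad K 1 (M + of_int (n - 1)) * d (n - 1) + quad K 2 (M + of_int (n - 2)) * d (n - 2)" for K M d
    by (simp add: sum_le_2)
  show ?thesis
    using rec unfolding frob_at_def e[of k \<mu> c] e[of k' \<mu>' "\<lambda>n. gprod x y n * c n"] 0 1 2 by (simp only: ring_distribs(1)[symmetric] mult_zero_right)
qed

section \<open>Removal of the power factors from a product solution\<close>

lemma product_solution_deriv:
  fixes L :: "complex \<Rightarrow> complex \<Rightarrow> complex" and \<nu> :: "complex \<Rightarrow> complex" and h :: "complex poly"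
  assumes U: "open U" and S: "finite S" and L: "\<And>p. p \<in> S \<Longrightarrow> L p holomorphic_on U \<and> (\<forall>z\<in>U. exp (L p z) = z - p)"
  defines "Y \<equiv> \<lambda>z. (\<Prod>p\<in>S. exp (\<nu> p * L p z)) * poly h z"
    and "m \<equiv> \<lambda>z. \<Sum>p\<in>S. \<nu> p / (z - p)" and "e \<equiv> \<lambda>z. \<Prod>p\<in>S. exp (\<nu> p * L p z)"
  assumes z: "z \<in> U"
  shows "deriv Y z = e z * (m z * poly h z + poly (pderiv h) z)"
    and "deriv (deriv Y) z = e z * ((m z ^ 2 - (\<Sum>p\<in>S. \<nu> p / (z - p)\<^sup>2)) * poly h z + 2 * m z * poly (pderiv h) z + poly (pderiv (pderiv h)) z)"
    and "Y holomorphic_on U"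
proof -
  have ne: "z \<noteq> p" if "z \<in> U" "p \<in> S" for z p using L[OF that(2)] that(1) exp_not_eq_zero[of "L p z"] by auto
  \<comment> \<open>Differentiating \<open>exp (L p z) = z - p\<close> identifies the derivative of
    any branch.\<close>
  have dL: "(L p has_field_derivative inverse (z - p)) (at z)" if "z \<in> U" "p \<in> S" for z p
  proof -
    have d: "(L p has_field_derivative deriv (L p) z) (at z)"
      using L[OF that(2)] U that(1) by (auto intro: holomorphic_derivI)
    then have "((\<lambda>z. exp (L p z)) has_field_derivative exp (L p z) * deriv (L p) z) (at z)"
      by (auto intro!: derivative_eq_intros)
    moreover have "((\<lambda>z. exp (L p z)) has_field_derivative 1) (at z)"
      by (rule has_field_derivative_transform_within_open[of "\<lambda>z. z - p" _ _ U])
         (use U that L in \<open>auto intro!: derivative_eq_intros\<close>)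
    ultimately have "exp (L p z) * deriv (L p) z = 1" by (rule DERIV_unique)
    then have "deriv (L p) z = inverse (z - p)" using L[OF that(2)] that(1)
      by (metis inverse_unique)
    then show ?thesis using d by simp
  qed
  have e: "e z = exp (\<Sum>p\<in>S. \<nu> p * L p z)" for z by (simp add: e_def exp_sum[OF S])
  have de: "(e has_field_derivative e z * m z) (at z)" if "z \<in> U" for z
    unfolding e m_def using dL[OF that]
    by (auto intro!: derivative_eq_intros simp: divide_inverse mult.commute)
  have dm: "(m has_field_derivative - (\<Sum>p\<in>S. \<nu> p / (z - p)\<^sup>2)) (at z)" if "z \<in> U" for z
    unfolding m_def using ne[OF that]
    by (auto intro!: derivative_eq_intros sum.cong simp: power2_eq_square sum_negf[symmetric])
  have Y: "Y = (\<lambda>z. e z * poly h z)" by (simp add: Y_def e_def)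
  define Y1 where "Y1 z = e z * (m z * poly h z + poly (pderiv h) z)" for z
  have dY: "(Y has_field_derivative Y1 z) (at z)" if "z \<in> U" for z
    unfolding Y Y1_def using de[OF that] by (auto intro!: derivative_eq_intros simp: algebra_simps)
  show "deriv Y z = e z * (m z * poly h z + poly (pderiv h) z)"
    using DERIV_imp_deriv[OF dY[OF z]] by (simp add: Y1_def)
  show "Y holomorphic_on U" unfolding holomorphic_on_open[OF U] using dY by blast

  have "(Y1 has_field_derivative e z * ((m z ^ 2 - (\<Sum>p\<in>S. \<nu> p / (z - p)\<^sup>2)) * poly h z + 2 * m z * poly (pderiv h) z + poly (pderiv (pderiv h)) z)) (at z)"
    unfolding Y1_def using de[OF z] dm[OF z]
    by (auto intro!: derivative_eq_intros simp: algebra_simps power2_eq_square)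
  moreover have "deriv (deriv Y) z = deriv Y1 z"
  proof (rule deriv_cong_ev[OF _ refl])
    have "\<forall>\<^sub>F w in nhds z. w \<in> U" using U z by (rule eventually_nhds_in_open)
    then show "\<forall>\<^sub>F w in nhds z. deriv Y w = Y1 w" by eventually_elim (rule DERIV_imp_deriv[OF dY])
  qed
  ultimately show "deriv (deriv Y) z = e z * ((m z ^ 2 - (\<Sum>p\<in>S. \<nu> p / (z - p)\<^sup>2)) * poly h z + 2 * m z * poly (pderiv h) z + poly (pderiv (pderiv h)) z)"
    by (simp add: DERIV_imp_deriv)
qed

text \<open>Local exponents are exactly what cancels the double poles; only mixed products survive,
  so the equation for the remaining factor is again of Heun type.\<close>

lemma product_potential_identity:
  fixes A B C :: complex
  assumes "na * (na - 1 + ea) = 0" "nb * (nb - 1 + eb) = 0" "nc * (nc - 1 + ec) = 0"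
  shows "(na * A + nb * B + nc * C)\<^sup>2 - (na * A\<^sup>2 + nb * B\<^sup>2 + nc * C\<^sup>2) + (ea * A + eb * B + ec * C) * (na * A + nb * B + nc * C)
    = (2 * na * nb + na * eb + nb * ea) * (A * B) + (2 * na * nc + na * ec + nc * ea) * (A * C) + (2 * nb * nc + nb * ec + nc * eb) * (B * C)"
proof -
  have "(na * A + nb * B + nc * C)\<^sup>2 - (na * A\<^sup>2 + nb * B\<^sup>2 + nc * C\<^sup>2) + (ea * A + eb * B + ec * C) * (na * A + nb * B + nc * C)
    = na * (na - 1 + ea) * A\<^sup>2 + nb * (nb - 1 + eb) * B\<^sup>2 + nc * (nc - 1 + ec) * C\<^sup>2 +
    ((2 * na * nb + na * eb + nb * ea) * (A * B) + (2 * na * nc + na * ec + nc * ea) * (A * C) + (2 * nb * nc + nb * ec + nc * eb) * (B * C))"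
    by (simp add: algebra_simps power2_eq_square)
  then show ?thesis unfolding assms by simp
qed

context heun
begin

text \<open>The coefficient of \<open>1 / ((z - x) * (z - y))\<close> that the power factors add to
  the potential.\<close>

definition mix :: "(complex \<Rightarrow> complex) \<Rightarrow> complex \<Rightarrow> complex \<Rightarrow> complex" where
  "mix \<nu> x y = 2 * \<nu> x * \<nu> y + \<nu> x * \<epsilon> y + \<nu> y * \<epsilon> x"

text \<open>
  Coefficients of the Heun equation for \<open>h\<close> when \<open>y = (z-a)^(\<nu> a) (z-b)^(\<nu> b) (z-c)^(\<nu> c) h\<close>,
  each \<open>\<nu> p\<close> being a local exponent, i.e. 0 or \<open>1 - \<epsilon> p\<close>.
\<close>

definition khat :: "(complex \<Rightarrow> complex) \<Rightarrow> nat \<Rightarrow> nat \<Rightarrow> complex" where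
  "khat \<nu> = heunk a b c (\<epsilon> a + 2 * \<nu> a) (\<epsilon> b + 2 * \<nu> b) (\<epsilon> c + 2 * \<nu> c)
     (\<alpha> * \<beta> + mix \<nu> a b + mix \<nu> a c + mix \<nu> b c) (q + mix \<nu> a b * c + mix \<nu> a c * b + mix \<nu> b c * a)"

text \<open>Bringing a mixed term over the common denominator multiplies it by the third linear
  factor, for example \<open>mix \<nu> a b\<close> by \<open>z - c\<close>; this yields the shifts
  of \<open>\<alpha> * \<beta>\<close> and \<open>q\<close> in \<open>khat\<close>.\<close>

lemma khat_identity:
  assumes z: "z \<notin> {0, 1, t}" and S: "S \<subseteq> {0, 1, t}"
  defines "\<nu> \<equiv> \<lambda>p. if p \<in> S then 1 - \<epsilon> p else 0"
  defines "m \<equiv> \<Sum>p\<in>S. (1 - \<epsilon> p) / (z - p)" and "m2 \<equiv> \<Sum>p\<in>S. (1 - \<epsilon> p) / (z - p)\<^sup>2"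
  shows "(m\<^sup>2 - m2) * h0 + 2 * m * h1 + h2 + P z * (m * h0 + h1) + Q z * h0 = 0 \<longleftrightarrow>
    euler_op (khat \<nu>) (z - a) h0 ((z - a) * h1) ((z - a) * h1 + (z - a)\<^sup>2 * h2) = 0"
proof -
  have zz: "z \<noteq> a" "z \<noteq> b" "z \<noteq> c" using z unfolding abc[symmetric] by auto
  define A B C where "A = inverse (z - a)" and "B = inverse (z - b)" and "C = inverse (z - c)"
  have ABC: "A * (z - a) = 1" "B * (z - b) = 1" "C * (z - c) = 1" using zz by (simp_all add: A_def B_def C_def)
  have sum: "(\<Sum>p\<in>S. (1 - \<epsilon> p) * f p) = \<nu> a * f a + \<nu> b * f b + \<nu> c * f c" for f :: "complex \<Rightarrow> complex"
  proof -
    have "(\<Sum>p\<in>S. (1 - \<epsilon> p) * f p) = (\<Sum>p\<in>{a, b, c}. \<nu> p * f p)"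
      by (rule sum.mono_neutral_cong_left) (use S abc in \<open>auto simp: \<nu>_def\<close>)
    then show ?thesis using ne by (simp add: add.assoc)
  qed
  have m: "m = \<nu> a * A + \<nu> b * B + \<nu> c * C"
    unfolding m_def divide_inverse sum A_def B_def C_def by simp
  have m2: "m2 = \<nu> a * A\<^sup>2 + \<nu> b * B\<^sup>2 + \<nu> c * C\<^sup>2"
    unfolding m2_def divide_inverse sum A_def B_def C_def by (simp add: power_inverse)
  have P: "P z = \<epsilon> a * A + \<epsilon> b * B + \<epsilon> c * C"
    unfolding heun_perm(1)[OF t abc ne] by (simp add: divide_inverse A_def B_def C_def)
  have Q: "Q z = (\<alpha> * \<beta> * z - q) * (A * B * C)"
    unfolding heun_Q_def heun_perm(2)[OF t abc ne] by (simp add: divide_inverse A_def B_def C_def)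
  have \<nu>: "\<nu> p * (\<nu> p - 1 + \<epsilon> p) = 0" for p by (simp add: \<nu>_def)
  have key: "m\<^sup>2 - m2 + P z * m = mix \<nu> a b * (A * B) + mix \<nu> a c * (A * C) + mix \<nu> b c * (B * C)"
    unfolding m m2 P mix_def by (rule product_potential_identity[OF \<nu> \<nu> \<nu>])
  define p' q' where "p' = \<alpha> * \<beta> + mix \<nu> a b + mix \<nu> a c + mix \<nu> b c"
    and "q' = q + mix \<nu> a b * c + mix \<nu> a c * b + mix \<nu> b c * a"
  have "(p' * z - q') * (A * B * C) = (\<alpha> * \<beta> * z - q) * (A * B * C) + mix \<nu> a b * (A * B) * (C * (z - c))
     + mix \<nu> a c * (A * C) * (B * (z - b)) + mix \<nu> b c * (B * C) * (A * (z - a))"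
    by (simp add: p'_def q'_def algebra_simps)
  then have Q': "(p' * z - q') / ((z - a) * (z - b) * (z - c)) = m\<^sup>2 - m2 + P z * m + Q z"
    unfolding ABC key Q by (simp add: divide_inverse A_def B_def C_def)
  have P': "(\<epsilon> a + 2 * \<nu> a) / (z - a) + (\<epsilon> b + 2 * \<nu> b) / (z - b) + (\<epsilon> c + 2 * \<nu> c) / (z - c) = P z + 2 * m"
    unfolding P m by (simp add: divide_inverse A_def B_def C_def algebra_simps)
  have "euler_op (khat \<nu>) (z - a) h0 ((z - a) * h1) ((z - a) * h1 + (z - a)\<^sup>2 * h2) =
    (z - a) * ((z - a) * (z - b) * (z - c)) * (h2 + (P z + 2 * m) * h1 + (m\<^sup>2 - m2 + P z * m + Q z) * h0)"
    unfolding khat_def p'_def[symmetric] q'_def[symmetric] euler_op_heunk[OF zz] P' Q' ..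
  also have "h2 + (P z + 2 * m) * h1 + (m\<^sup>2 - m2 + P z * m + Q z) * h0 =
    (m\<^sup>2 - m2) * h0 + 2 * m * h1 + h2 + P z * (m * h0 + h1) + Q z * h0"
    by (simp add: algebra_simps)
  finally show ?thesis using zz by simp
qed

text \<open>All branches lead to the same equation for \<open>h\<close>, so one branch on one small
  ball already gives the recurrence, and the recurrence gives every branch.\<close>

lemma product_solution_iff:
  assumes S: "S \<subseteq> {0, 1, t}"
  defines "\<nu> \<equiv> \<lambda>p. if p \<in> S then 1 - \<epsilon> p else 0"
  shows "heun_product_solution t \<epsilon> \<alpha> \<beta> q S (\<lambda>p. 1 - \<epsilon> p) h \<longleftrightarrow> (\<forall>n. frob_at (khat \<nu>) 0 (icoeff a h) n)"
proof -
  have fS: "finite S" using S finite_subset by blast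
  have sol: "heun_solution_on t \<epsilon> \<alpha> \<beta> q U (\<lambda>z. (\<Prod>p\<in>S. exp ((1 - \<epsilon> p) * L p z)) * poly h z) \<longleftrightarrow>
    (\<forall>z\<in>U. poly_euler (khat \<nu>) a h z = 0)"
    if U: "open U" "U \<subseteq> - {0, 1, t}" and L: "\<And>p. p \<in> S \<Longrightarrow> L p holomorphic_on U \<and> (\<forall>z\<in>U. exp (L p z) = z - p)" for U L
  proof -
    define Y where "Y z = (\<Prod>p\<in>S. exp ((1 - \<epsilon> p) * L p z)) * poly h z" for z
    define e where "e z = (\<Prod>p\<in>S. exp ((1 - \<epsilon> p) * L p z))" for z
    have d1: "deriv Y z = e z * ((\<Sum>p\<in>S. (1 - \<epsilon> p) / (z - p)) * poly h z + poly (pderiv h) z)" if "z \<in> U" for z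
      unfolding Y_def[abs_def] e_def by (rule product_solution_deriv(1)) (fact U(1) fS L that)+
    have d2: "deriv (deriv Y) z = e z * (((\<Sum>p\<in>S. (1 - \<epsilon> p) / (z - p))\<^sup>2 - (\<Sum>p\<in>S. (1 - \<epsilon> p) / (z - p)\<^sup>2)) * poly h z
        + 2 * (\<Sum>p\<in>S. (1 - \<epsilon> p) / (z - p)) * poly (pderiv h) z + poly (pderiv (pderiv h)) z)" if "z \<in> U" for z
      unfolding Y_def[abs_def] e_def by (rule product_solution_deriv(2)) (fact U(1) fS L that)+
    have d3: "Y holomorphic_on U" if "z \<in> U" for z
      unfolding Y_def[abs_def] by (rule product_solution_deriv(3)) (fact U(1) fS L that)+
    have d4: "e z \<noteq> 0" for z using fS by (simp add: e_def)
    have "deriv (deriv Y) z + P z * deriv Y z + Q z * Y z = 0 \<longleftrightarrow> poly_euler (khat \<nu>) a h z = 0"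
      if z: "z \<in> U" for z
    proof -
      define m where "m = (\<Sum>p\<in>S. (1 - \<epsilon> p) / (z - p))"
      define m2 where "m2 = (\<Sum>p\<in>S. (1 - \<epsilon> p) / (z - p)\<^sup>2)"
      have Yz: "Y z = e z * poly h z" by (simp add: Y_def e_def)
      have "deriv (deriv Y) z + P z * deriv Y z + Q z * Y z =
        e z * ((m\<^sup>2 - m2) * poly h z + 2 * m * poly (pderiv h) z + poly (pderiv (pderiv h)) z
         + P z * (m * poly h z + poly (pderiv h) z) + Q z * poly h z)"
        unfolding d1[OF z] d2[OF z] Yz m_def[symmetric] m2_def[symmetric] by (simp add: algebra_simps)
      moreover have "e z \<noteq> 0" by (rule d4)
      moreover have "z \<notin> {0, 1, t}" using U(2) z by auto
      ultimately show ?thesis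
        using khat_identity[of z S] S unfolding poly_euler_def \<nu>_def m_def m2_def by simp
    qed
    moreover have "Y holomorphic_on U"
    proof (cases "U = {}")
      case False
      then show ?thesis using d3 by blast
    qed (simp add: holomorphic_on_def)
    ultimately show ?thesis
      unfolding heun_solution_on_def lde2_solution_on_def Y_def[symmetric] using U by auto
  qed
  show ?thesis
  proof
    assume "\<forall>n. frob_at (khat \<nu>) 0 (icoeff a h) n"
    then have "poly_euler (khat \<nu>) a h z = 0" for z by (intro frob_imp_poly_euler) blast
    then show "heun_product_solution t \<epsilon> \<alpha> \<beta> q S (\<lambda>p. 1 - \<epsilon> p) h"
      unfolding heun_product_solution_def using sol by blast
  next
    assume H: "heun_product_solution t \<epsilon> \<alpha> \<beta> q S (\<lambda>p. 1 - \<epsilon> p) h"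
    have "open (- {0, 1, t})" by (intro open_Compl finite_imp_closed) auto
    moreover have "\<exists>z0. z0 \<notin> {0, 1, t}" by (rule ex_new_if_finite[OF infinite_UNIV_char_0]) auto
    ultimately obtain z0 \<delta> where z0: "\<delta> > 0" "ball z0 \<delta> \<subseteq> - {0, 1, t}"
      by (metis ComplI open_contains_ball)
    \<comment> \<open>A logarithm of z - p on the ball: no singular point lies in it, so the
      quotient stays in the right half plane.\<close>
    define L where "L p z = Ln ((z - p) / (z0 - p)) + Ln (z0 - p)" for p z
    have L: "L p holomorphic_on ball z0 \<delta> \<and> (\<forall>z\<in>ball z0 \<delta>. exp (L p z) = z - p)" if "p \<in> S" for p
    proof -
      have "p \<notin> ball z0 \<delta>" using that S z0(2) by auto
      then have p: "norm (z0 - p) \<ge> \<delta>" by (simp add: dist_norm)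
      then have p0: "z0 - p \<noteq> 0" using z0(1) by auto
      have nz: "(z - p) / (z0 - p) \<notin> \<real>\<^sub>\<le>\<^sub>0" if "z \<in> ball z0 \<delta>" for z
      proof -
        have "(z - p) / (z0 - p) - 1 = (z - z0) / (z0 - p)" using p0 by (simp add: field_simps)
        moreover have "norm ((z - z0) / (z0 - p)) < 1"
          unfolding norm_divide using that p z0(1) by (subst divide_less_eq_1_pos) (auto simp: dist_norm norm_minus_commute)
        ultimately have "norm ((z - p) / (z0 - p) - 1) < 1" by simp
        then have "\<bar>Re ((z - p) / (z0 - p) - 1)\<bar> < 1" using abs_Re_le_cmod order_le_less_trans by blast
        then have "Re ((z - p) / (z0 - p)) > 0" by simp
        then show ?thesis using complex_nonpos_Reals_iff by force
      qed
      have "L p holomorphic_on ball z0 \<delta>"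
        unfolding L_def using nz p0 by (intro holomorphic_intros) auto
      moreover have "exp (L p z) = z - p" if "z \<in> ball z0 \<delta>" for z
      proof -
        have "(z - p) / (z0 - p) \<noteq> 0" using nz[OF that] by auto
        then show ?thesis using p0 by (simp add: L_def exp_add)
      qed
      ultimately show ?thesis by blast
    qed
    have "heun_solution_on t \<epsilon> \<alpha> \<beta> q (ball z0 \<delta>) (\<lambda>z. (\<Prod>p\<in>S. exp ((1 - \<epsilon> p) * L p z)) * poly h z)"
      using H L z0(2) unfolding heun_product_solution_def by blast
    then have "\<forall>z\<in>ball z0 \<delta>. poly_euler (khat \<nu>) a h z = 0" using sol[OF open_ball z0(2) L] by blast
    then show "\<forall>n. frob_at (khat \<nu>) 0 (icoeff a h) n"
      using z0(1) by (intro allI poly_euler_imp_frob[of "ball z0 \<delta>"]) auto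
  qed
qed

lemma polynomial_solution_iff:
  "heun_polynomial_solution t \<epsilon> \<alpha> \<beta> q h \<longleftrightarrow> (\<forall>n. frob_at k 0 (icoeff a h) n)"
proof -
  have o: "open (- {0, 1, t})" by (intro open_Compl finite_imp_closed) auto
  have D: "deriv (poly p) = poly (pderiv p)" for p :: "complex poly"
    by (rule ext) (rule DERIV_imp_deriv[OF poly_DERIV])
  have "heun_polynomial_solution t \<epsilon> \<alpha> \<beta> q h \<longleftrightarrow> (\<forall>z\<in>- {0, 1, t}. poly_euler k a h z = 0)"
    unfolding heun_polynomial_solution_def heun_solution_on_def lde2_solution_on_def D poly_euler_def
    using euler_iff o by (auto intro!: holomorphic_intros)
  also have "\<dots> \<longleftrightarrow> (\<forall>n. frob_at k 0 (icoeff a h) n)"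
  proof
    assume H: "\<forall>z\<in>- {0, 1, t}. poly_euler k a h z = 0"
    have "\<exists>z0. z0 \<notin> {0, 1, t}" by (rule ex_new_if_finite[OF infinite_UNIV_char_0]) auto
    then show "\<forall>n. frob_at k 0 (icoeff a h) n"
      using H o by (intro allI poly_euler_imp_frob[of "- {0, 1, t}"]) auto
  qed (auto intro!: frob_imp_poly_euler)
  finally show ?thesis .
qed

end

section \<open>The Euler transformation on coefficients\<close>

text \<open>At index \<open>M + 1\<close> the leading term drops out. If \<open>c M\<close> were 0,
  the recurrence could be read downwards, since \<open>quad k 2\<close> does not vanish there, and
  would end with \<open>c 0 = 0\<close>. This makes degrees exact.\<close>

lemma frob_top_nonzero:
  assumes neg: "\<And>n. n < 0 \<Longrightarrow> c n = 0" and c0: "c 0 \<noteq> 0" and rec: "\<And>n. frob_at k \<mu> c n"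
    and top: "quad k 0 (\<mu> + of_int (int M + 1)) = 0" and nz: "\<And>j::int. 0 \<le> j \<Longrightarrow> j < int M \<Longrightarrow> quad k 2 (\<mu> + of_int j) \<noteq> 0"
  shows "c (int M) \<noteq> 0"
proof
  assume cM: "c (int M) = 0"
  have step: "c (n - 2) = 0" if "c (n - 1) = 0" "quad k 0 (\<mu> + of_int n) * c n = 0" "n - 2 < int M" for n
  proof (cases "n - 2 < 0")
    case False
    then have "quad k 2 (\<mu> + of_int (n - 2)) \<noteq> 0" using nz[of "n - 2"] that by simp
    then show ?thesis using rec[of n] that by (simp add: frob_at_def sum_le_2)
  qed (rule neg)
  have "c (int M - int j) = 0 \<and> c (int M - int j - 1) = 0" for j
  proof (induction j)
    case 0
    have "c (int M + 1 - 2) = 0" by (rule step) (use cM top in simp_all)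
    then show ?case using cM by simp
  next
    case (Suc j)
    have "c (int M - int j - 2) = 0" by (rule step[of "int M - int j"]) (use Suc in simp_all)
    then show ?case using Suc by (simp add: algebra_simps)
  qed
  from this[of M] c0 show False by simp
qed

text \<open>Two steps above the degree only the \<open>quad k 2\<close> term survives, so the degree
  is one of its roots.\<close>

lemma frob_poly_support:
  assumes h: "h \<noteq> 0" and rec: "\<And>n. frob_at k 0 (icoeff a h) n" and q2: "\<And>n::nat. quad k 2 (of_nat n) = 0 \<Longrightarrow> n = D"
  shows "degree h = D" "icoeff a h (int D) \<noteq> 0" "\<And>n. n > int D \<Longrightarrow> icoeff a h n = 0"
proof -
  have "frob_at k 0 (icoeff a h) (int (degree h) + 2)" by (rule rec)
  then have "quad k 2 (of_nat (degree h)) * icoeff a h (int (degree h)) = 0"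
    by (simp add: frob_at_def sum_le_2 icoeff_degree)
  then show D: "degree h = D" using icoeff_top[OF h] q2 by simp
  show "icoeff a h (int D) \<noteq> 0" using icoeff_top[OF h] D by blast
  show "\<And>n. n > int D \<Longrightarrow> icoeff a h n = 0" using D by (simp add: icoeff_degree)
qed

text \<open>A nonzero polynomial must start at an indicial root, and 0 is the only integer that can
  be one.\<close>

lemma frob_poly_bottom:
  assumes h: "h \<noteq> 0" and rec: "\<And>n. frob_at k 0 (icoeff a h) n" and q0: "\<And>n::int. n \<noteq> 0 \<Longrightarrow> quad k 0 (of_int n) \<noteq> 0"
  shows "icoeff a h 0 \<noteq> 0"
proof
  assume 0: "icoeff a h 0 = 0"
  have "icoeff a h n = 0" for n
  proof (rule frob_vanish[OF rec])
    show "\<forall>m\<le>-1. icoeff a h m = 0" by (simp add: icoeff_def)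
    show "quad k 0 (0 + of_int m) \<noteq> 0 \<or> icoeff a h m = 0" for m
      by (cases "m = 0") (use q0 0 in simp_all)
  qed (rule order_refl)
  then show False using icoeff_top[OF h] by blast
qed

lemma not_Ints_add:
  "(x :: complex) \<notin> \<int> \<Longrightarrow> x + of_int n \<noteq> 0" "(x :: complex) \<notin> \<int> \<Longrightarrow> of_int n + x \<noteq> 0"
  "(x :: complex) \<notin> \<int> \<Longrightarrow> x - of_int n \<noteq> 0" "(x :: complex) \<notin> \<int> \<Longrightarrow> of_int n - x \<noteq> 0"
  by (metis Ints_minus Ints_of_int add_eq_0_iff2 add_eq_0_iff eq_iff_diff_eq_0)+

lemma degree_eq_if_icoeff: "degree h \<le> D \<Longrightarrow> icoeff a h (int D) \<noteq> 0 \<Longrightarrow> degree h = D"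
  using icoeff_degree[of h "int D" a] by (metis le_neq_implies_less of_nat_less_iff)

lemma quad_reflect_simps:
  "quad (reflect k) 0 \<rho> = quad k 2 (- \<rho>)" "quad (reflect k) 1 \<rho> = quad k 1 (- \<rho>)" "quad (reflect k) 2 \<rho> = quad k 0 (- \<rho>)"
  by (simp_all add: quad_reflect)

text \<open>The case \<open>\<eta> = \<alpha>\<close>, where \<open>{\<alpha>', \<beta>'} = {2 - \<alpha>, \<beta> - \<alpha> + 1}\<close>.\<close>

locale heun_pair =
  fixes t :: complex and \<epsilon> \<epsilon>' :: "complex \<Rightarrow> complex" and \<alpha> \<beta> q q' a b c :: complex
  assumes t: "t \<noteq> 0" "t \<noteq> 1" and abc: "{a, b, c} = {0, 1, t}" and ne: "a \<noteq> b" "b \<noteq> c" "c \<noteq> a"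
    and fuchs: "\<epsilon> 0 + \<epsilon> 1 + \<epsilon> t = \<alpha> + \<beta> + 1"
    and eps': "\<And>p. p \<in> {0, 1, t} \<Longrightarrow> \<epsilon>' p = \<epsilon> p - \<alpha> + 1"
    and q': "q' = q + (1 - \<alpha>) * (\<epsilon> t + \<epsilon> 1 * t + (\<epsilon> 0 - \<alpha>) * (t + 1))"

sublocale heun_pair \<subseteq> He: heun t \<epsilon> \<alpha> \<beta> q a b c
  by unfold_locales (fact t abc ne fuchs)+

sublocale heun_pair \<subseteq> He': heun t \<epsilon>' "2 - \<alpha>" "\<beta> - \<alpha> + 1" q' a b c
  by unfold_locales (use fuchs in \<open>simp_all add: t abc ne eps' algebra_simps\<close>)

context heun_pair
begin

lemma e': "\<epsilon>' a = \<epsilon> a - \<alpha> + 1" "\<epsilon>' b = \<epsilon> b - \<alpha> + 1" "\<epsilon>' c = \<epsilon> c - \<alpha> + 1"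
  by (rule eps'; unfold abc[symmetric]; simp)+

text \<open>The given formula for \<open>q'\<close> treats 0, 1 and \<open>t\<close> unequally;
  since \<open>a\<close> is arbitrary, the comparisons of coefficients use a symmetric form.\<close>

lemma q'_sym: "q' = q + (1 - \<alpha>) * (\<epsilon> a * (b + c) + \<epsilon> b * (a + c) + \<epsilon> c * (a + b) - \<alpha> * (a + b + c))"
proof -
  have s: "1 + t = a + b + c" using heun_perm(3)[OF t abc ne, of "\<lambda>p. p"] by simp
  have r: "1 + t - a = b + c" "1 + t - b = a + c" "1 + t - c = a + b" unfolding s by simp_all
  \<comment> \<open>The weight of \<open>\<epsilon> p\<close> is \<open>1 + t - p\<close>, the sum
    of the other two points.\<close>
  have "\<epsilon> t + \<epsilon> 1 * t + \<epsilon> 0 * (1 + t) = \<epsilon> a * (b + c) + \<epsilon> b * (a + c) + \<epsilon> c * (a + b)"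
    using heun_perm(3)[OF t abc ne, of "\<lambda>p. \<epsilon> p * (1 + t - p)"] unfolding r by (simp add: add_ac)
  moreover have "\<epsilon> t + \<epsilon> 1 * t + (\<epsilon> 0 - \<alpha>) * (t + 1) = (\<epsilon> t + \<epsilon> 1 * t + \<epsilon> 0 * (1 + t)) - \<alpha> * (1 + t)"
    by (simp add: algebra_simps)
  ultimately show ?thesis unfolding q' s by simp
qed

text \<open>Eliminating \<open>\<epsilon> c\<close> by the Fuchs relation turns the comparisons of
  coefficients into polynomial identities without side conditions.\<close>

lemma ec: "\<epsilon> c = \<alpha> + \<beta> + 1 - \<epsilon> a - \<epsilon> b"
  using He.fuchs' by (simp add: algebra_simps)

lemma uv: "b - a \<noteq> 0" "c - a \<noteq> 0" "(b - a) * (c - a) \<noteq> 0"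
  using ne by auto

section \<open>The eight implications for \<open>\<eta> = \<alpha>\<close>\<close>

lemmas coeff_simps = quad_reflect_simps He.khat_def He.mix_def He'.khat_def He'.mix_def quad_heunk

text \<open>At \<open>a\<close> the lower exponent \<open>1 - m\<close> of the second equation
  corresponds to the exponent \<open>1 - \<epsilon> a\<close> of the first, whose power is gauged
  away. The factor \<open>x\<close> vanishes at \<open>m - 1\<close>, the index of the upper
  exponent 0, and leaves degree at most \<open>m - 2\<close>.\<close>

lemma part_i:
  assumes m: "\<epsilon>' a = of_int m" "m \<ge> 2" and \<alpha>: "\<alpha> \<notin> \<int>"
    and ap: "heun_apparent_at t \<epsilon>' (2 - \<alpha>) (\<beta> - \<alpha> + 1) q' a"
  shows "\<exists>h. h \<noteq> 0 \<and> heun_product_solution t \<epsilon> \<alpha> \<beta> q {a} (\<lambda>p. 1 - \<epsilon> p) h \<and> int (degree h) \<le> m - 2 \<and>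
     (2 - \<alpha> \<notin> \<int> \<and> \<beta> - \<alpha> + 1 \<notin> \<int> \<longrightarrow> int (degree h) = m - 2)"
proof -
  define N where "N = nat (m - 1)"
  have N: "N > 0" "int N = m - 1" "of_nat N = (of_int m - 1 :: complex)" using m by (auto simp: N_def)
  define D where "D = nat (m - 2)"
  have D: "int D = m - 2" using m by (simp add: D_def)
  obtain c' where c: "\<And>n. n < 0 \<Longrightarrow> c' n = 0" "c' 0 \<noteq> 0" "\<And>n. frob_at He'.k (1 - of_int m) c' n"
    using He'.apparent_imp_frob[OF ap N(1), of "1 - of_int m"] by (auto simp: m N algebra_simps)
  \<comment> \<open>With \<rho> = 1 - m + n the quotient of \<open>x\<close> by \<open>y\<close> is
    \<rho> / (\<rho> + 1 - \<alpha>): formally, integration against (z - w)^(-\<alpha>) sends (w -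
    a)^\<rho> to a constant times Gamma(\<rho> + 1) / Gamma(\<rho> + 2 - \<alpha>) times (z -
    a)^(\<rho> + 1 - \<alpha>).\<close>
  define x where "x n = 1 - of_int m + (of_int n :: complex)" for n :: int
  define y where "y n = of_int (n + 2 - m) - \<alpha>" for n :: int
  have y0: "y n \<noteq> 0" for n unfolding y_def using not_Ints_add[OF \<alpha>] by blast
  define \<nu> where "\<nu> = (\<lambda>p. if p \<in> {a} then 1 - \<epsilon> p else 0)"
  have \<nu>: "\<nu> a = 1 - \<epsilon> a" "\<nu> b = 0" "\<nu> c = 0" using ne by (auto simp: \<nu>_def)
  have ea: "\<epsilon> a = of_int m + \<alpha> - 1" using m e' by (simp add: algebra_simps)
  define d where "d n = gprod x y n * c' n" for n
  have fd: "frob_at (He.khat \<nu>) 0 d n" for n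
    unfolding d_def
  proof (rule frob_transfer[OF c(1) c(3)])
    show "quad (He.khat \<nu>) 0 0 = 0" by (simp add: He.khat_def quad_heunk)
    show "quad (He.khat \<nu>) 0 (0 + of_int j) * x j = quad He'.k 0 (1 - of_int m + of_int j) * y j" for j
      unfolding coeff_simps unfolding \<nu> x_def y_def m ea by (simp add: algebra_simps)
    show "quad (He.khat \<nu>) 1 (0 + of_int j) = quad He'.k 1 (1 - of_int m + of_int j)" for j
      unfolding coeff_simps unfolding \<nu> e' q'_sym ec ea by (simp add: algebra_simps)
    show "quad (He.khat \<nu>) 2 (0 + of_int j) * y (j + 1) = quad He'.k 2 (1 - of_int m + of_int j) * x (j + 1)" for j
      unfolding coeff_simps unfolding \<nu> e' x_def y_def ec ea by (simp add: algebra_simps)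
  qed (use y0 in auto)
  have dneg: "d n = 0" if "n < 0" for n using c(1)[OF that] by (simp add: d_def)
  have dtop: "d n = 0" if "n > int D" for n
    unfolding d_def by (subst gprod_zero[of "m - 1"]) (use that D m in \<open>auto simp: x_def\<close>)
  have "\<exists>h. icoeff a h = d \<and> degree h \<le> D" by (rule icoeff_exists) (fact dneg dtop)+
  then obtain h where h: "icoeff a h = d" "degree h \<le> D" by blast
  have h0: "h \<noteq> 0"
  proof
    assume "h = 0"
    then have "icoeff a h 0 = 0" by (simp add: icoeff_def)
    then show False using c(2) by (simp add: h d_def)
  qed
  have "heun_product_solution t \<epsilon> \<alpha> \<beta> q {a} (\<lambda>p. 1 - \<epsilon> p) h"
    using He.product_solution_iff[of "{a}" h] fd abc unfolding h \<nu>_def by auto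
  moreover have "int (degree h) = m - 2" if nI: "2 - \<alpha> \<notin> \<int>" "\<beta> - \<alpha> + 1 \<notin> \<int>"
  proof -
    \<comment> \<open>Nonintegral exponents at infinity keep \<open>quad He'.k 2\<close> from
      vanishing at integers, so the last kept coefficient is nonzero.\<close>
    have "c' (int D) \<noteq> 0"
    proof (rule frob_top_nonzero[OF c])
      show "quad He'.k 0 (1 - of_int m + of_int (int D + 1)) = 0"
        unfolding D quad_heunk unfolding m by simp
      show "quad He'.k 2 (1 - of_int m + of_int j) \<noteq> 0" for j :: int
      proof -
        have "quad He'.k 2 (1 - of_int m + of_int j) = (2 - \<alpha> + of_int (j + 1 - m)) * (\<beta> - \<alpha> + 1 + of_int (j + 1 - m))"
          unfolding coeff_simps unfolding e' ec by (simp add: algebra_simps)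
        then show ?thesis
          by (simp only: mult_eq_0_iff not_Ints_add(1)[OF nI(1)] not_Ints_add(1)[OF nI(2)] simp_thms)
      qed
    qed
    moreover have "gprod x y (int D) \<noteq> 0"
    proof (rule gprod_nonzero)
      fix j assume "1 \<le> j" "j \<le> int D"
      then have "1 - m + j \<noteq> 0" using D by simp
      then have "x j \<noteq> 0" unfolding x_def by (metis of_int_1 of_int_add of_int_diff of_int_eq_0_iff)
      with y0 show "x j \<noteq> 0 \<and> y j \<noteq> 0" by blast
    qed
    ultimately have "icoeff a h (int D) \<noteq> 0" by (simp add: h d_def)
    then show ?thesis using degree_eq_if_icoeff[OF h(2)] D by simp
  qed
  ultimately show ?thesis using h0 h(2) D by (intro exI[of _ h]) auto
qed

text \<open>The series of the second equation at \<open>a\<close> starts at exponent 0 and becomes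
  \<open>h\<close> read from its top coefficient: the target is the reflected recurrence with
  exponent \<open>m\<close>, minus the degree. The factor \<open>x\<close> vanishes at
  \<open>1 - m\<close>, one past the degree.\<close>

lemma part_ii:
  assumes m: "\<epsilon>' a = of_int m" "m \<le> 0" and nI: "\<beta> - \<alpha> + 1 \<notin> \<int>"
    and ap: "heun_apparent_at t \<epsilon>' (2 - \<alpha>) (\<beta> - \<alpha> + 1) q' a"
  shows "\<exists>h. h \<noteq> 0 \<and> heun_product_solution t \<epsilon> \<alpha> \<beta> q {b, c} (\<lambda>p. 1 - \<epsilon> p) h \<and> int (degree h) = - m"
proof -
  define N where "N = nat (1 - m)"
  have N: "N > 0" "int N = 1 - m" "of_nat N = (1 - of_int m :: complex)" using m by (auto simp: N_def)
  define D where "D = nat (- m)"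
  have D: "int D = - m" using m by (simp add: D_def)
  obtain c' where c: "\<And>n. n < 0 \<Longrightarrow> c' n = 0" "c' 0 \<noteq> 0" "\<And>n. frob_at He'.k 0 c' n"
    using He'.apparent_imp_frob[OF ap N(1), of 0] by (auto simp: m N algebra_simps)
  define x where "x n = (b - a) * (c - a) * (of_int n - 1 + of_int m)" for n :: int
  define y where "y n = of_int (n - 1) + (\<beta> - \<alpha> + 1)" for n :: int
  have y0: "y n \<noteq> 0" for n unfolding y_def using not_Ints_add[OF nI] by blast
  define \<nu> where "\<nu> = (\<lambda>p. if p \<in> {b, c} then 1 - \<epsilon> p else 0)"
  have \<nu>: "\<nu> a = 0" "\<nu> b = 1 - \<epsilon> b" "\<nu> c = 1 - \<epsilon> c" using ne by (auto simp: \<nu>_def)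
  have ea: "\<epsilon> a = of_int m + \<alpha> - 1" using m e' by (simp add: algebra_simps)
  define d where "d n = gprod x y n * c' n" for n
  have fd: "frob_at (reflect (He.khat \<nu>)) (of_int m) d n" for n
    unfolding d_def
  proof (rule frob_transfer[OF c(1) c(3)])
    show "quad (reflect (He.khat \<nu>)) 0 (of_int m) = 0"
      unfolding coeff_simps unfolding \<nu> ec ea by (simp add: algebra_simps)
    show "quad (reflect (He.khat \<nu>)) 0 (of_int m + of_int j) * x j = quad He'.k 0 (0 + of_int j) * y j" for j
      unfolding coeff_simps unfolding \<nu> x_def y_def m ec ea by (simp add: algebra_simps)
    show "quad (reflect (He.khat \<nu>)) 1 (of_int m + of_int j) = quad He'.k 1 (0 + of_int j)" for j
      unfolding coeff_simps unfolding \<nu> e' q'_sym ec ea by (simp add: algebra_simps)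
    show "quad (reflect (He.khat \<nu>)) 2 (of_int m + of_int j) * y (j + 1) = quad He'.k 2 (0 + of_int j) * x (j + 1)" for j
      unfolding coeff_simps unfolding \<nu> e' x_def y_def ec ea by (simp add: algebra_simps)
  qed (use y0 in auto)
  have dneg: "d n = 0" if "n < 0" for n using c(1)[OF that] by (simp add: d_def)
  have dtop: "d n = 0" if "n > int D" for n
    unfolding d_def by (subst gprod_zero[of "1 - m"]) (use that D m in \<open>auto simp: x_def\<close>)
  have "\<exists>h. icoeff a h = (\<lambda>n. d (int D - n)) \<and> degree h \<le> D"
    by (rule icoeff_exists) (auto intro: dneg dtop)
  then obtain h where h: "icoeff a h = (\<lambda>n. d (int D - n))" "degree h \<le> D" by blast
  have hD: "icoeff a h (int D) \<noteq> 0" using c(2) by (simp add: h d_def)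
  have "frob_at (He.khat \<nu>) 0 (icoeff a h) n" for n
    unfolding h by (rule frob_at_unreverse) (use fd in \<open>simp add: D\<close>)
  then have "heun_product_solution t \<epsilon> \<alpha> \<beta> q {b, c} (\<lambda>p. 1 - \<epsilon> p) h"
    using He.product_solution_iff[of "{b, c}" h] abc unfolding \<nu>_def by auto
  moreover have "degree h = D" by (rule degree_eq_if_icoeff[OF h(2) hD])
  moreover have "h \<noteq> 0" using hD by (auto simp: icoeff_def)
  ultimately show ?thesis using D by (intro exI[of _ h]) simp
qed

text \<open>Here \<open>y\<close> vanishes, at \<open>m - 1\<close>, the index of the upper
  exponent. The recurrence for \<open>h\<close> forces degree \<open>m - 2\<close>, so its
  coefficient there is 0 and the transferred recurrence still holds at that index; this is the
  consistency that excludes a logarithm.\<close>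

lemma part_iii:
  assumes m: "\<epsilon> a = of_int m" "m \<ge> 2" and \<alpha>: "\<alpha> \<notin> \<int>" and \<beta>: "\<beta> \<notin> \<int>"
    and h: "h \<noteq> 0" "heun_product_solution t \<epsilon>' (2 - \<alpha>) (\<beta> - \<alpha> + 1) q' {a} (\<lambda>p. 1 - \<epsilon>' p) h"
  shows "heun_apparent_at t \<epsilon> \<alpha> \<beta> q a"
proof -
  define N where "N = nat (m - 1)"
  have N: "N > 0" "int N = m - 1" "of_nat N = (of_int m - 1 :: complex)" using m by (auto simp: N_def)
  define D where "D = nat (m - 2)"
  have D: "int D = m - 2" using m by (simp add: D_def)
  define \<nu> where "\<nu> = (\<lambda>p. if p \<in> {a} then 1 - \<epsilon>' p else 0)"
  have \<nu>: "\<nu> a = 1 - \<epsilon>' a" "\<nu> b = 0" "\<nu> c = 0" using ne by (auto simp: \<nu>_def)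
  have rec: "frob_at (He'.khat \<nu>) 0 (icoeff a h) n" for n
    using He'.product_solution_iff[of "{a}" h] h(2) abc unfolding \<nu>_def by auto
  have q2: "n = D" if "quad (He'.khat \<nu>) 2 (of_nat n) = 0" for n
  proof -
    have "quad (He'.khat \<nu>) 2 (of_nat n) = of_int (int n + 2 - m) * (of_int (int n + 1 - m) + \<beta>)"
      unfolding coeff_simps unfolding \<nu> e' ec m by (simp add: algebra_simps)
    then have "int n + 2 - m = 0" using that not_Ints_add(2)[OF \<beta>] by (metis mult_eq_0_iff of_int_eq_0_iff)
    then show ?thesis using D by simp
  qed
  note sup = frob_poly_support[OF h(1) rec q2]
  have c0: "icoeff a h 0 \<noteq> 0"
  proof (rule frob_poly_bottom[OF h(1) rec])
    fix n :: int assume n: "n \<noteq> 0"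
    have "quad (He'.khat \<nu>) 0 (of_int n) = (b - a) * (c - a) * of_int n * (of_int (n - m) + \<alpha>)"
      unfolding coeff_simps unfolding \<nu> e' m by (simp add: algebra_simps)
    then show "quad (He'.khat \<nu>) 0 (of_int n) \<noteq> 0" using n uv not_Ints_add(2)[OF \<alpha>, of "n - m"] by simp
  qed
  define x where "x n = of_int (n - m) + \<alpha>" for n :: int
  define y where "y n = (of_int (1 - m + n) :: complex)" for n :: int
  have y0: "y n \<noteq> 0 \<longleftrightarrow> n \<noteq> m - 1" for n unfolding y_def of_int_eq_0_iff by auto
  define d where "d n = gprod x y n * icoeff a h n" for n
  have fd: "frob_at He.k (1 - of_int m) d n" if n: "n \<le> int N" for n
    unfolding d_def
  proof (rule frob_transfer[OF _ rec])
    show "quad He.k 0 (1 - of_int m) = 0" unfolding coeff_simps unfolding m by simp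
    show "quad He.k 0 (1 - of_int m + of_int j) * x j = quad (He'.khat \<nu>) 0 (0 + of_int j) * y j" for j
      unfolding coeff_simps unfolding \<nu> e' x_def y_def m by (simp add: algebra_simps)
    show "quad He.k 1 (1 - of_int m + of_int j) = quad (He'.khat \<nu>) 1 (0 + of_int j)" for j
      unfolding coeff_simps unfolding \<nu> e' q'_sym ec m by (simp add: algebra_simps)
    show "quad He.k 2 (1 - of_int m + of_int j) * y (j + 1) = quad (He'.khat \<nu>) 2 (0 + of_int j) * x (j + 1)" for j
      unfolding coeff_simps unfolding \<nu> e' x_def y_def ec m by (simp add: algebra_simps)
    show "y j \<noteq> 0" if "1 \<le> j" "j < n" for j using that n N y0 by auto
    show "y n \<noteq> 0 \<or> icoeff a h n = 0" using y0[of n] sup(3)[of n] D by auto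
  qed (simp add: icoeff_def)
  show ?thesis
  proof (rule He.frob_imp_apparent[OF N(1) _ _ _ fd])
    show "\<rho> * (\<rho> - 1 + \<epsilon> a) = (\<rho> - (1 - of_int m)) * (\<rho> - (1 - of_int m) - of_nat N)" for \<rho>
      unfolding m N by (simp add: algebra_simps)
    show "d n = 0" if "n < 0" for n using that by (simp add: d_def icoeff_def)
    show "d 0 \<noteq> 0" using c0 by (simp add: d_def)
  qed
qed

text \<open>As in \<open>part_iii\<close>, but \<open>h\<close> is read from the top: degree
  \<open>- m\<close> is forced, and at the critical index \<open>1 - m\<close> the reversed sequence
  asks for the coefficient of index -1, which is 0. The nonzero leading coefficient starts the
  series.\<close>

lemma part_iv:
  assumes m: "\<epsilon> a = of_int m" "m \<le> 0" and \<beta>: "\<beta> \<notin> \<int>"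
    and h: "h \<noteq> 0" "heun_product_solution t \<epsilon>' (2 - \<alpha>) (\<beta> - \<alpha> + 1) q' {b, c} (\<lambda>p. 1 - \<epsilon>' p) h"
  shows "heun_apparent_at t \<epsilon> \<alpha> \<beta> q a"
proof -
  define N where "N = nat (1 - m)"
  have N: "N > 0" "int N = 1 - m" "of_nat N = (1 - of_int m :: complex)" using m by (auto simp: N_def)
  define D where "D = nat (- m)"
  have D: "int D = - m" using m by (simp add: D_def)
  define \<nu> where "\<nu> = (\<lambda>p. if p \<in> {b, c} then 1 - \<epsilon>' p else 0)"
  have \<nu>: "\<nu> a = 0" "\<nu> b = 1 - \<epsilon>' b" "\<nu> c = 1 - \<epsilon>' c" using ne by (auto simp: \<nu>_def)
  have rec: "frob_at (He'.khat \<nu>) 0 (icoeff a h) n" for n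
    using He'.product_solution_iff[of "{b, c}" h] h(2) abc unfolding \<nu>_def by auto
  have q2: "n = D" if "quad (He'.khat \<nu>) 2 (of_nat n) = 0" for n
  proof -
    have "quad (He'.khat \<nu>) 2 (of_nat n) = of_int (int n + m) * (of_int (int n + 1 + m) - \<beta>)"
      unfolding coeff_simps unfolding \<nu> e' ec m by (simp add: algebra_simps)
    then have "int n + m = 0" using that not_Ints_add(4)[OF \<beta>] by (metis mult_eq_0_iff of_int_eq_0_iff)
    then show ?thesis using D by simp
  qed
  note sup = frob_poly_support[OF h(1) rec q2]
  define c' where "c' n = icoeff a h (int D - n)" for n
  have rec': "frob_at (reflect (He'.khat \<nu>)) (of_int m) c' n" for n
    using frob_at_reverse[OF rec, of "int D" n] by (simp add: c'_def[abs_def] D)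
  define x where "x n = of_int (n - 1) + \<beta>" for n :: int
  define y where "y n = (b - a) * (c - a) * of_int (n - 1 + m)" for n :: int
  have y0: "y n \<noteq> 0 \<longleftrightarrow> n \<noteq> 1 - m" for n unfolding y_def mult_eq_0_iff of_int_eq_0_iff using uv by auto
  define d where "d n = gprod x y n * c' n" for n
  have fd: "frob_at He.k 0 d n" if n: "n \<le> int N" for n
    unfolding d_def
  proof (rule frob_transfer[OF _ rec'])
    show "quad He.k 0 0 = 0" unfolding quad_heunk by simp
    show "quad He.k 0 (0 + of_int j) * x j = quad (reflect (He'.khat \<nu>)) 0 (of_int m + of_int j) * y j" for j
      unfolding coeff_simps unfolding \<nu> e' x_def y_def ec m by (simp add: algebra_simps)
    show "quad He.k 1 (0 + of_int j) = quad (reflect (He'.khat \<nu>)) 1 (of_int m + of_int j)" for j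
      unfolding coeff_simps unfolding \<nu> e' q'_sym ec m by (simp add: algebra_simps)
    show "quad He.k 2 (0 + of_int j) * y (j + 1) = quad (reflect (He'.khat \<nu>)) 2 (of_int m + of_int j) * x (j + 1)" for j
      unfolding coeff_simps unfolding \<nu> e' x_def y_def ec m by (simp add: algebra_simps)
    show "y j \<noteq> 0" if "1 \<le> j" "j < n" for j using that n N y0 by auto
    show "y n \<noteq> 0 \<or> c' n = 0" using y0[of n] D by (auto simp: c'_def icoeff_def)
    show "c' n = 0" if "n < 0" for n using sup(3) that by (simp add: c'_def)
  qed
  show ?thesis
  proof (rule He.frob_imp_apparent[OF N(1) _ _ _ fd])
    show "\<rho> * (\<rho> - 1 + \<epsilon> a) = (\<rho> - 0) * (\<rho> - 0 - of_nat N)" for \<rho>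
      unfolding m N by (simp add: algebra_simps)
    show "d n = 0" if "n < 0" for n using that sup(3) by (simp add: d_def c'_def)
    show "d 0 \<noteq> 0" using sup(2) by (simp add: d_def c'_def)
  qed
qed

text \<open>With \<open>\<beta> = m\<close> the first equation has exponent \<open>m\<close> at
  infinity, the behaviour of a polynomial of degree \<open>- m\<close>. It is matched with the lower
  exponent \<open>m + 1 - \<alpha>\<close> of the second; \<open>x\<close> vanishes at
  \<open>1 - m\<close>, the index of the upper exponent \<open>2 - \<alpha>\<close>.\<close>

lemma part_v:
  assumes a: "a = 0" and m: "\<beta> = of_int m" "m \<le> 0" and \<alpha>: "\<alpha> \<notin> \<int>"
    and ap: "heun_apparent_at_infinity t \<epsilon>' (2 - \<alpha>) (\<beta> - \<alpha> + 1) q'"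
  shows "\<exists>h. h \<noteq> 0 \<and> heun_polynomial_solution t \<epsilon> \<alpha> \<beta> q h \<and> int (degree h) = - m"
proof -
  define N where "N = nat (1 - m)"
  have N: "N > 0" "int N = 1 - m" "of_nat N = (1 - of_int m :: complex)" using m by (auto simp: N_def)
  define D where "D = nat (- m)"
  have D: "int D = - m" using m by (simp add: D_def)
  obtain c' where c: "\<And>n. n < 0 \<Longrightarrow> c' n = 0" "c' 0 \<noteq> 0" "\<And>n. frob_at (reflect He'.k) (of_int m + 1 - \<alpha>) c' n"
    using He'.apparent_at_infinity_imp_frob[OF ap a N(1), of "of_int m + 1 - \<alpha>"] by (auto simp: m N algebra_simps)
  define x where "x n = (of_int n + of_int m - 1 :: complex)" for n :: int
  define y where "y n = of_int (n + m) - \<alpha>" for n :: int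
  have y0: "y n \<noteq> 0" for n unfolding y_def using not_Ints_add[OF \<alpha>] by blast
  define d where "d n = gprod x y n * c' n" for n
  have fd: "frob_at (reflect He.k) (of_int m) d n" for n
    unfolding d_def
  proof (rule frob_transfer[OF c(1) c(3)])
    show "quad (reflect He.k) 0 (of_int m) = 0"
      unfolding coeff_simps unfolding ec m by (simp add: algebra_simps)
    show "quad (reflect He.k) 0 (of_int m + of_int j) * x j = quad (reflect He'.k) 0 (of_int m + 1 - \<alpha> + of_int j) * y j" for j
      unfolding coeff_simps unfolding e' x_def y_def m ec by (simp add: algebra_simps)
    show "quad (reflect He.k) 1 (of_int m + of_int j) = quad (reflect He'.k) 1 (of_int m + 1 - \<alpha> + of_int j)" for j
      unfolding coeff_simps unfolding e' q'_sym ec m by (simp add: algebra_simps)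
    show "quad (reflect He.k) 2 (of_int m + of_int j) * y (j + 1) = quad (reflect He'.k) 2 (of_int m + 1 - \<alpha> + of_int j) * x (j + 1)" for j
      unfolding coeff_simps unfolding e' x_def y_def ec m by (simp add: algebra_simps)
  qed (use y0 in auto)
  have dneg: "d n = 0" if "n < 0" for n using c(1)[OF that] by (simp add: d_def)
  have dtop: "d n = 0" if "n > int D" for n
    unfolding d_def by (subst gprod_zero[of "1 - m"]) (use that D m in \<open>auto simp: x_def\<close>)
  have "\<exists>h. icoeff a h = (\<lambda>n. d (int D - n)) \<and> degree h \<le> D"
    by (rule icoeff_exists) (auto intro: dneg dtop)
  then obtain h where h: "icoeff a h = (\<lambda>n. d (int D - n))" "degree h \<le> D" by blast
  have hD: "icoeff a h (int D) \<noteq> 0" using c(2) by (simp add: h d_def)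
  have "frob_at He.k 0 (icoeff a h) n" for n
    unfolding h by (rule frob_at_unreverse) (use fd in \<open>simp add: D\<close>)
  then have "heun_polynomial_solution t \<epsilon> \<alpha> \<beta> q h" using He.polynomial_solution_iff by blast
  moreover have "degree h = D" by (rule degree_eq_if_icoeff[OF h(2) hD])
  moreover have "h \<noteq> 0" using hD by (auto simp: icoeff_def)
  ultimately show ?thesis using D by (intro exI[of _ h]) simp
qed

text \<open>The series at infinity of the second equation, from its lower exponent
  \<open>2 - \<alpha>\<close>, becomes the coefficients of \<open>h\<close> in ascending powers of z
  once all three power factors are removed; \<open>x\<close> cuts it at
  \<open>m - 1\<close>.\<close>

lemma part_vi:
  assumes a: "a = 0" and m: "\<beta> = of_int m" "m \<ge> 2" and \<alpha>: "\<alpha> \<notin> \<int>" and \<epsilon>a: "\<epsilon> a \<notin> \<int>"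
    and ap: "heun_apparent_at_infinity t \<epsilon>' (2 - \<alpha>) (\<beta> - \<alpha> + 1) q'"
  shows "\<exists>h. h \<noteq> 0 \<and> heun_product_solution t \<epsilon> \<alpha> \<beta> q {0, 1, t} (\<lambda>p. 1 - \<epsilon> p) h \<and> int (degree h) = m - 2"
proof -
  define N where "N = nat (m - 1)"
  have N: "N > 0" "int N = m - 1" "of_nat N = (of_int m - 1 :: complex)" using m by (auto simp: N_def)
  define D where "D = nat (m - 2)"
  have D: "int D = m - 2" using m by (simp add: D_def)
  obtain c' where c: "\<And>n. n < 0 \<Longrightarrow> c' n = 0" "c' 0 \<noteq> 0" "\<And>n. frob_at (reflect He'.k) (2 - \<alpha>) c' n"
    using He'.apparent_at_infinity_imp_frob[OF ap a N(1), of "2 - \<alpha>"] by (auto simp: m N algebra_simps)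
  define x where "x n = (of_int n + 1 - of_int m :: complex)" for n :: int
  define y where "y n = (b - a) * (c - a) * (of_int (n + 1) - \<epsilon> a)" for n :: int
  have y0: "y n \<noteq> 0" for n unfolding y_def using not_Ints_add(4)[OF \<epsilon>a, of "n + 1"] uv by simp
  define \<nu> where "\<nu> = (\<lambda>p. if p \<in> {0, 1, t} then 1 - \<epsilon> p else 0)"
  have \<nu>: "\<nu> a = 1 - \<epsilon> a" "\<nu> b = 1 - \<epsilon> b" "\<nu> c = 1 - \<epsilon> c" using abc by (auto simp: \<nu>_def)
  define d where "d n = gprod x y n * c' n" for n
  have fd: "frob_at (He.khat \<nu>) 0 d n" for n
    unfolding d_def
  proof (rule frob_transfer[OF c(1) c(3)])
    show "quad (He.khat \<nu>) 0 0 = 0" by (simp add: He.khat_def quad_heunk)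
    show "quad (He.khat \<nu>) 0 (0 + of_int j) * x j = quad (reflect He'.k) 0 (2 - \<alpha> + of_int j) * y j" for j
      unfolding coeff_simps unfolding \<nu> e' x_def y_def m ec by (simp add: algebra_simps)
    show "quad (He.khat \<nu>) 1 (0 + of_int j) = quad (reflect He'.k) 1 (2 - \<alpha> + of_int j)" for j
      unfolding coeff_simps unfolding \<nu> e' q'_sym ec m by (simp add: algebra_simps)
    show "quad (He.khat \<nu>) 2 (0 + of_int j) * y (j + 1) = quad (reflect He'.k) 2 (2 - \<alpha> + of_int j) * x (j + 1)" for j
      unfolding coeff_simps unfolding \<nu> e' x_def y_def ec m by (simp add: algebra_simps)
  qed (use y0 in auto)
  have dneg: "d n = 0" if "n < 0" for n using c(1)[OF that] by (simp add: d_def)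
  have dtop: "d n = 0" if "n > int D" for n
    unfolding d_def by (subst gprod_zero[of "m - 1"]) (use that D m in \<open>auto simp: x_def\<close>)
  have "\<exists>h. icoeff a h = d \<and> degree h \<le> D" by (rule icoeff_exists) (fact dneg dtop)+
  then obtain h where h: "icoeff a h = d" "degree h \<le> D" by blast
  have "heun_product_solution t \<epsilon> \<alpha> \<beta> q {0, 1, t} (\<lambda>p. 1 - \<epsilon> p) h"
    using He.product_solution_iff[of "{0, 1, t}" h] fd unfolding h \<nu>_def by auto
  \<comment> \<open>Nonintegral \<open>\<alpha>\<close> and \<open>\<epsilon> a\<close> let the
    recurrence be read downwards, so the degree does not drop.\<close>
  moreover have "c' (int D) \<noteq> 0"
  proof (rule frob_top_nonzero[OF c])
    show "quad (reflect He'.k) 0 (2 - \<alpha> + of_int (int D + 1)) = 0"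
      unfolding D quad_reflect_simps quad_heunk unfolding e' ec m by (simp add: algebra_simps)
    show "quad (reflect He'.k) 2 (2 - \<alpha> + of_int j) \<noteq> 0" for j :: int
    proof -
      have "quad (reflect He'.k) 2 (2 - \<alpha> + of_int j) = (b - a) * (c - a) * (\<alpha> - of_int (2 + j)) * (\<epsilon> a - of_int (2 + j))"
        unfolding coeff_simps unfolding e' by (simp add: algebra_simps)
      then show ?thesis using not_Ints_add(3)[OF \<alpha>, of "2 + j"] not_Ints_add(3)[OF \<epsilon>a, of "2 + j"] uv by simp
    qed
  qed
  moreover have "gprod x y (int D) \<noteq> 0"
  proof (rule gprod_nonzero)
    fix j assume "1 \<le> j" "j \<le> int D"
    then have "j + 1 - m \<noteq> 0" using D by simp
    then have "x j \<noteq> 0" unfolding x_def by (metis of_int_1 of_int_add of_int_diff of_int_eq_0_iff)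
    with y0 show "x j \<noteq> 0 \<and> y j \<noteq> 0" by blast
  qed
  ultimately have hD: "icoeff a h (int D) \<noteq> 0" and sol: "heun_product_solution t \<epsilon> \<alpha> \<beta> q {0, 1, t} (\<lambda>p. 1 - \<epsilon> p) h"
    by (simp_all add: h d_def)
  have "degree h = D" by (rule degree_eq_if_icoeff[OF h(2) hD])
  moreover have "h \<noteq> 0" using hD by (auto simp: icoeff_def)
  ultimately show ?thesis using D sol by (intro exI[of _ h]) simp
qed

text \<open>Since \<open>m\<close> is negative, \<open>\<beta>\<close> is the lower exponent of the
  first equation at infinity. The integer exponent \<open>m + 1\<close> of the second forces degree
  \<open>- m - 1\<close>, and the zero of \<open>y\<close> at \<open>- m\<close> meets the
  coefficient of index -1 of \<open>h\<close>.\<close>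

lemma part_vii:
  assumes a: "a = 0" and m: "\<beta> = \<alpha> + of_int m" "m \<le> -1" and \<alpha>: "\<alpha> \<notin> \<int>"
    and h: "h \<noteq> 0" "heun_polynomial_solution t \<epsilon>' (2 - \<alpha>) (\<beta> - \<alpha> + 1) q' h"
  shows "heun_apparent_at_infinity t \<epsilon> \<alpha> \<beta> q"
proof -
  define N where "N = nat (- m)"
  have N: "N > 0" "int N = - m" "of_nat N = (- of_int m :: complex)" using m by (auto simp: N_def)
  define D where "D = nat (- m - 1)"
  have D: "int D = - m - 1" using m by (simp add: D_def)
  have rec: "frob_at He'.k 0 (icoeff a h) n" for n
    using He'.polynomial_solution_iff h(2) by blast
  have q2: "n = D" if "quad He'.k 2 (of_nat n) = 0" for n
  proof -
    have "quad He'.k 2 (of_nat n) = (of_int (int n + 2) - \<alpha>) * of_int (int n + m + 1)"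
      unfolding coeff_simps unfolding e' ec m by (simp add: algebra_simps)
    then have "int n + m + 1 = 0" using that not_Ints_add(4)[OF \<alpha>] by (metis mult_eq_0_iff of_int_eq_0_iff)
    then show ?thesis using D by simp
  qed
  note sup = frob_poly_support[OF h(1) rec q2]
  define c' where "c' n = icoeff a h (int D - n)" for n
  have rec': "frob_at (reflect He'.k) (of_int m + 1) c' n" for n
    using frob_at_reverse[OF rec, of "int D" n] by (simp add: c'_def[abs_def] D add.commute)
  define x where "x n = of_int n + of_int m - 1 + \<alpha>" for n :: int
  define y where "y n = (of_int (n + m) :: complex)" for n :: int
  have y0: "y n \<noteq> 0 \<longleftrightarrow> n \<noteq> - m" for n unfolding y_def of_int_eq_0_iff by auto
  define d where "d n = gprod x y n * c' n" for n
  have fd: "frob_at (reflect He.k) \<beta> d n" if n: "n \<le> int N" for n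
    unfolding d_def
  proof (rule frob_transfer[OF _ rec'])
    show "quad (reflect He.k) 0 \<beta> = 0" unfolding coeff_simps unfolding ec m by (simp add: algebra_simps)
    show "quad (reflect He.k) 0 (\<beta> + of_int j) * x j = quad (reflect He'.k) 0 (of_int m + 1 + of_int j) * y j" for j
      unfolding coeff_simps unfolding e' x_def y_def ec m by (simp add: algebra_simps)
    show "quad (reflect He.k) 1 (\<beta> + of_int j) = quad (reflect He'.k) 1 (of_int m + 1 + of_int j)" for j
      unfolding coeff_simps unfolding e' q'_sym ec m by (simp add: algebra_simps)
    show "quad (reflect He.k) 2 (\<beta> + of_int j) * y (j + 1) = quad (reflect He'.k) 2 (of_int m + 1 + of_int j) * x (j + 1)" for j
      unfolding coeff_simps unfolding e' x_def y_def ec m by (simp add: algebra_simps)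
    show "y j \<noteq> 0" if "1 \<le> j" "j < n" for j using that n N y0 by auto
    show "y n \<noteq> 0 \<or> c' n = 0" using y0[of n] D by (auto simp: c'_def icoeff_def)
    show "c' n = 0" if "n < 0" for n using sup(3) that by (simp add: c'_def)
  qed
  show ?thesis
  proof (rule He.frob_imp_apparent_at_infinity[OF a N(1) _ _ _ fd])
    show "(\<rho> - \<alpha>) * (\<rho> - \<beta>) = (\<rho> - \<beta>) * (\<rho> - \<beta> - of_nat N)" for \<rho>
      unfolding m N by (simp add: algebra_simps)
    show "d n = 0" if "n < 0" for n using that sup(3) by (simp add: d_def c'_def)
    show "d 0 \<noteq> 0" using sup(2) by (simp add: d_def c'_def)
  qed
qed

text \<open>Now \<open>\<alpha>\<close> is the lower exponent, and \<open>h\<close> enters through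
  its ascending coefficients; its forced degree \<open>m - 1\<close> ends just before the zero of
  \<open>y\<close> at \<open>m\<close>. Nonintegral \<open>\<epsilon>' a\<close> ensures a nonzero
  constant term to start the series.\<close>

lemma part_viii:
  assumes a: "a = 0" and m: "\<beta> = \<alpha> + of_int m" "m \<ge> 1" and \<alpha>: "\<alpha> \<notin> \<int>" and \<epsilon>a: "\<epsilon>' a \<notin> \<int>"
    and h: "h \<noteq> 0" "heun_product_solution t \<epsilon>' (2 - \<alpha>) (\<beta> - \<alpha> + 1) q' {0, 1, t} (\<lambda>p. 1 - \<epsilon>' p) h"
  shows "heun_apparent_at_infinity t \<epsilon> \<alpha> \<beta> q"
proof -
  define N where "N = nat m"
  have N: "N > 0" "int N = m" "of_nat N = (of_int m :: complex)" using m by (auto simp: N_def)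
  define D where "D = nat (m - 1)"
  have D: "int D = m - 1" using m by (simp add: D_def)
  define \<nu> where "\<nu> = (\<lambda>p. if p \<in> {0, 1, t} then 1 - \<epsilon>' p else 0)"
  have \<nu>: "\<nu> a = 1 - \<epsilon>' a" "\<nu> b = 1 - \<epsilon>' b" "\<nu> c = 1 - \<epsilon>' c" using abc by (auto simp: \<nu>_def)
  have rec: "frob_at (He'.khat \<nu>) 0 (icoeff a h) n" for n
    using He'.product_solution_iff[of "{0, 1, t}" h] h(2) unfolding \<nu>_def by auto
  have q2: "n = D" if "quad (He'.khat \<nu>) 2 (of_nat n) = 0" for n
  proof -
    have "quad (He'.khat \<nu>) 2 (of_nat n) = of_int (int n + 1 - m) * (of_int (int n) + \<alpha>)"
      unfolding coeff_simps unfolding \<nu> e' ec m by (simp add: algebra_simps)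
    then have "int n + 1 - m = 0" using that not_Ints_add(2)[OF \<alpha>] by (metis mult_eq_0_iff of_int_eq_0_iff)
    then show ?thesis using D by simp
  qed
  note sup = frob_poly_support[OF h(1) rec q2]
  have c0: "icoeff a h 0 \<noteq> 0"
  proof (rule frob_poly_bottom[OF h(1) rec])
    fix n :: int assume n: "n \<noteq> 0"
    have "quad (He'.khat \<nu>) 0 (of_int n) = (b - a) * (c - a) * of_int n * (of_int (n + 1) - \<epsilon>' a)"
      unfolding coeff_simps unfolding \<nu> by (simp add: algebra_simps)
    then show "quad (He'.khat \<nu>) 0 (of_int n) \<noteq> 0" using n uv not_Ints_add(4)[OF \<epsilon>a, of "n + 1"] by simp
  qed
  define x where "x n = (b - a) * (c - a) * (of_int n + \<alpha> - \<epsilon> a)" for n :: int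
  define y where "y n = (of_int (n - m) :: complex)" for n :: int
  have y0: "y n \<noteq> 0 \<longleftrightarrow> n \<noteq> m" for n unfolding y_def of_int_eq_0_iff by auto
  define d where "d n = gprod x y n * icoeff a h n" for n
  have fd: "frob_at (reflect He.k) \<alpha> d n" if n: "n \<le> int N" for n
    unfolding d_def
  proof (rule frob_transfer[OF _ rec])
    show "quad (reflect He.k) 0 \<alpha> = 0" unfolding coeff_simps unfolding ec m by (simp add: algebra_simps)
    show "quad (reflect He.k) 0 (\<alpha> + of_int j) * x j = quad (He'.khat \<nu>) 0 (0 + of_int j) * y j" for j
      unfolding coeff_simps unfolding \<nu> e' x_def y_def ec m by (simp add: algebra_simps)
    show "quad (reflect He.k) 1 (\<alpha> + of_int j) = quad (He'.khat \<nu>) 1 (0 + of_int j)" for j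
      unfolding coeff_simps unfolding \<nu> e' q'_sym ec m by (simp add: algebra_simps)
    show "quad (reflect He.k) 2 (\<alpha> + of_int j) * y (j + 1) = quad (He'.khat \<nu>) 2 (0 + of_int j) * x (j + 1)" for j
      unfolding coeff_simps unfolding \<nu> e' x_def y_def ec m by (simp add: algebra_simps)
    show "y j \<noteq> 0" if "1 \<le> j" "j < n" for j using that n N y0 by auto
    show "y n \<noteq> 0 \<or> icoeff a h n = 0" using y0[of n] sup(3)[of n] D by auto
  qed (simp add: icoeff_def)
  show ?thesis
  proof (rule He.frob_imp_apparent_at_infinity[OF a N(1) _ _ _ fd])
    show "(\<rho> - \<alpha>) * (\<rho> - \<beta>) = (\<rho> - \<alpha>) * (\<rho> - \<alpha> - of_nat N)" for \<rho>
      unfolding m N by (simp add: algebra_simps)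
    show "d n = 0" if "n < 0" for n using that by (simp add: d_def icoeff_def)
    show "d 0 \<noteq> 0" using c0 by (simp add: d_def)
  qed
qed

end

section \<open>Reduction of the general case to \<open>\<eta> = \<alpha>\<close>\<close>

lemma heun_commute:
  "heun_product_solution t \<epsilon> \<alpha> \<beta> q = heun_product_solution t \<epsilon> \<beta> \<alpha> q"
  "heun_polynomial_solution t \<epsilon> \<alpha> \<beta> q = heun_polynomial_solution t \<epsilon> \<beta> \<alpha> q"
  "heun_apparent_at t \<epsilon> \<alpha> \<beta> q = heun_apparent_at t \<epsilon> \<beta> \<alpha> q"
  "heun_apparent_at_infinity t \<epsilon> \<alpha> \<beta> q = heun_apparent_at_infinity t \<epsilon> \<beta> \<alpha> q"
proof -
  \<comment> \<open>Only the product of \<open>\<alpha>\<close> and \<open>\<beta>\<close> enters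
    the equation.\<close>
  have Q: "heun_Q t \<alpha> \<beta> q = heun_Q t \<beta> \<alpha> q" by (simp add: heun_Q_def fun_eq_iff mult.commute)
  show "heun_product_solution t \<epsilon> \<alpha> \<beta> q = heun_product_solution t \<epsilon> \<beta> \<alpha> q"
    "heun_polynomial_solution t \<epsilon> \<alpha> \<beta> q = heun_polynomial_solution t \<epsilon> \<beta> \<alpha> q"
    "heun_apparent_at t \<epsilon> \<alpha> \<beta> q = heun_apparent_at t \<epsilon> \<beta> \<alpha> q"
    "heun_apparent_at_infinity t \<epsilon> \<alpha> \<beta> q = heun_apparent_at_infinity t \<epsilon> \<beta> \<alpha> q"
    by (simp_all add: fun_eq_iff heun_product_solution_def heun_polynomial_solution_def heun_solution_on_def
        heun_apparent_at_def heun_apparent_at_infinity_def Q)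
qed

theorem theorem4p2:
  fixes t \<alpha> \<beta> q \<eta> \<alpha>' \<beta>' q' a b c :: complex
    and \<epsilon> \<epsilon>' :: "complex \<Rightarrow> complex"
  assumes "t \<noteq> 0" and "t \<noteq> 1"
    and "\<epsilon> 0 + \<epsilon> 1 + \<epsilon> t = \<alpha> + \<beta> + 1"
    and "\<eta> \<in> {\<alpha>, \<beta>}"
    and "\<And>p. p \<in> {0, 1, t} \<Longrightarrow> \<epsilon>' p = \<epsilon> p - \<eta> + 1"
    and "{\<alpha>', \<beta>'} = {2 - \<eta>, \<alpha> + \<beta> - 2 * \<eta> + 1}"
    and "q' = q + (1 - \<eta>) * (\<epsilon> t + \<epsilon> 1 * t + (\<epsilon> 0 - \<eta>) * (t + 1))"
    and "{a, b, c} = {0, 1, t}" and "a \<noteq> b" and "b \<noteq> c" and "c \<noteq> a"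
  shows
    "(\<forall>m::int. \<epsilon>' a = of_int m \<and> m \<ge> 2 \<and> \<eta> \<notin> \<int> \<and> heun_apparent_at t \<epsilon>' \<alpha>' \<beta>' q' a \<longrightarrow>
        (\<exists>h. h \<noteq> 0 \<and> heun_product_solution t \<epsilon> \<alpha> \<beta> q {a} (\<lambda>p. 1 - \<epsilon> p) h \<and>
             int (degree h) \<le> m - 2 \<and>
             (\<alpha>' \<notin> \<int> \<and> \<beta>' \<notin> \<int> \<longrightarrow> int (degree h) = m - 2))) \<and>
     (\<forall>m::int. \<epsilon>' a = of_int m \<and> m \<le> 0 \<and> \<eta> \<notin> \<int> \<and> \<alpha>' \<notin> \<int> \<and> \<beta>' \<notin> \<int> \<and>
          \<epsilon> b \<notin> \<int> \<and> \<epsilon> c \<notin> \<int> \<and> heun_apparent_at t \<epsilon>' \<alpha>' \<beta>' q' a \<longrightarrow>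
        (\<exists>h. h \<noteq> 0 \<and> heun_product_solution t \<epsilon> \<alpha> \<beta> q {b, c} (\<lambda>p. 1 - \<epsilon> p) h \<and>
             int (degree h) = - m)) \<and>
     (\<forall>m::int. \<epsilon> a = of_int m \<and> m \<ge> 2 \<and> \<alpha> \<notin> \<int> \<and> \<beta> \<notin> \<int> \<and>
          (\<exists>h. h \<noteq> 0 \<and> heun_product_solution t \<epsilon>' \<alpha>' \<beta>' q' {a} (\<lambda>p. 1 - \<epsilon>' p) h) \<longrightarrow>
        heun_apparent_at t \<epsilon> \<alpha> \<beta> q a) \<and>
     (\<forall>m::int. \<epsilon> a = of_int m \<and> m \<le> 0 \<and> \<alpha> \<notin> \<int> \<and> \<beta> \<notin> \<int> \<and> \<epsilon>' b \<notin> \<int> \<and> \<epsilon>' c \<notin> \<int> \<and>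
          (\<exists>h. h \<noteq> 0 \<and> heun_product_solution t \<epsilon>' \<alpha>' \<beta>' q' {b, c} (\<lambda>p. 1 - \<epsilon>' p) h) \<longrightarrow>
        heun_apparent_at t \<epsilon> \<alpha> \<beta> q a) \<and>
     (\<forall>m::int. \<alpha> + \<beta> - \<eta> = of_int m \<and> m \<le> 0 \<and> \<eta> \<notin> \<int> \<and>
          heun_apparent_at_infinity t \<epsilon>' \<alpha>' \<beta>' q' \<longrightarrow>
        (\<exists>h. h \<noteq> 0 \<and> heun_polynomial_solution t \<epsilon> \<alpha> \<beta> q h \<and> int (degree h) = - m)) \<and>
     (\<forall>m::int. \<alpha> + \<beta> - \<eta> = of_int m \<and> m \<ge> 2 \<and>
          \<eta> \<notin> \<int> \<and> \<epsilon> 0 \<notin> \<int> \<and> \<epsilon> 1 \<notin> \<int> \<and> \<epsilon> t \<notin> \<int> \<and>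
          heun_apparent_at_infinity t \<epsilon>' \<alpha>' \<beta>' q' \<longrightarrow>
        (\<exists>h. h \<noteq> 0 \<and> heun_product_solution t \<epsilon> \<alpha> \<beta> q {0, 1, t} (\<lambda>p. 1 - \<epsilon> p) h \<and>
             int (degree h) = m - 2)) \<and>
     (\<forall>m::int. \<alpha> + \<beta> - 2 * \<eta> = of_int m \<and> m \<le> -1 \<and> \<eta> \<notin> \<int> \<and> \<epsilon>' 0 \<notin> \<int> \<and>
          (\<exists>h. h \<noteq> 0 \<and> heun_polynomial_solution t \<epsilon>' \<alpha>' \<beta>' q' h) \<longrightarrow>
        heun_apparent_at_infinity t \<epsilon> \<alpha> \<beta> q) \<and>
     (\<forall>m::int. \<alpha> + \<beta> - 2 * \<eta> = of_int m \<and> m \<ge> 1 \<and>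
          \<eta> \<notin> \<int> \<and> \<epsilon>' 0 \<notin> \<int> \<and> \<epsilon>' 1 \<notin> \<int> \<and> \<epsilon>' t \<notin> \<int> \<and>
          (\<exists>h. h \<noteq> 0 \<and> heun_product_solution t \<epsilon>' \<alpha>' \<beta>' q' {0, 1, t} (\<lambda>p. 1 - \<epsilon>' p) h) \<longrightarrow>
        heun_apparent_at_infinity t \<epsilon> \<alpha> \<beta> q)"
proof -
  \<comment> \<open>The partner of \<open>\<eta>\<close> in the pair; by symmetry
    \<open>\<eta>\<close> can always play the role of \<open>\<alpha>\<close>.\<close>
  define \<beta>0 where "\<beta>0 = \<alpha> + \<beta> - \<eta>"
  have b0: "\<eta> = \<alpha> \<and> \<beta>0 = \<beta> \<or> \<eta> = \<beta> \<and> \<beta>0 = \<alpha>" using assms(4) by (auto simp: \<beta>0_def)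
  have "{\<alpha>', \<beta>'} = {2 - \<eta>, \<beta>0 - \<eta> + 1}"
    using assms(6) by (simp add: \<beta>0_def algebra_simps)
  then have ab': "\<alpha>' = 2 - \<eta> \<and> \<beta>' = \<beta>0 - \<eta> + 1 \<or> \<alpha>' = \<beta>0 - \<eta> + 1 \<and> \<beta>' = 2 - \<eta>"
    by (auto simp: doubleton_eq_iff)
  have He: "heun_product_solution t \<epsilon> \<alpha> \<beta> q = heun_product_solution t \<epsilon> \<eta> \<beta>0 q"
    "heun_polynomial_solution t \<epsilon> \<alpha> \<beta> q = heun_polynomial_solution t \<epsilon> \<eta> \<beta>0 q"
    "heun_apparent_at t \<epsilon> \<alpha> \<beta> q = heun_apparent_at t \<epsilon> \<eta> \<beta>0 q"
    "heun_apparent_at_infinity t \<epsilon> \<alpha> \<beta> q = heun_apparent_at_infinity t \<epsilon> \<eta> \<beta>0 q"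
    using b0 heun_commute by metis+
  have He': "heun_product_solution t \<epsilon>' \<alpha>' \<beta>' q' = heun_product_solution t \<epsilon>' (2 - \<eta>) (\<beta>0 - \<eta> + 1) q'"
    "heun_polynomial_solution t \<epsilon>' \<alpha>' \<beta>' q' = heun_polynomial_solution t \<epsilon>' (2 - \<eta>) (\<beta>0 - \<eta> + 1) q'"
    "heun_apparent_at t \<epsilon>' \<alpha>' \<beta>' q' = heun_apparent_at t \<epsilon>' (2 - \<eta>) (\<beta>0 - \<eta> + 1) q'"
    "heun_apparent_at_infinity t \<epsilon>' \<alpha>' \<beta>' q' = heun_apparent_at_infinity t \<epsilon>' (2 - \<eta>) (\<beta>0 - \<eta> + 1) q'"
    using ab' heun_commute by metis+
  have nI: "\<alpha> \<notin> \<int> \<and> \<beta> \<notin> \<int> \<longleftrightarrow> \<eta> \<notin> \<int> \<and> \<beta>0 \<notin> \<int>"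
    "\<alpha>' \<notin> \<int> \<and> \<beta>' \<notin> \<int> \<longleftrightarrow> 2 - \<eta> \<notin> \<int> \<and> \<beta>0 - \<eta> + 1 \<notin> \<int>"
    using b0 ab' by auto
  have fuchs: "\<epsilon> 0 + \<epsilon> 1 + \<epsilon> t = \<eta> + \<beta>0 + 1" using assms(3) by (simp add: \<beta>0_def)
  \<comment> \<open>\<open>A\<close> keeps the arbitrary order for the finite points;
    \<open>B\<close> fixes \<open>a = 0\<close>, as the charts at infinity require.\<close>
  interpret A: heun_pair t \<epsilon> \<epsilon>' \<eta> \<beta>0 q q' a b c
    by unfold_locales (fact assms fuchs)+
  interpret B: heun_pair t \<epsilon> \<epsilon>' \<eta> \<beta>0 q q' 0 1 t
    by unfold_locales (use assms fuchs in auto)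
  have \<beta>0: "\<alpha> + \<beta> - \<eta> = \<beta>0" "\<And>z. \<alpha> + \<beta> - 2 * \<eta> = z \<longleftrightarrow> \<beta>0 = \<eta> + z"
    by (auto simp: \<beta>0_def algebra_simps)
  show ?thesis
    unfolding He He' \<beta>0 nI(2)
    by (intro conjI; intro allI impI; elim conjE exE)
      ((rule A.part_i A.part_ii A.part_iii A.part_iv B.part_v[OF refl] B.part_vi[OF refl] B.part_vii[OF refl] B.part_viii[OF refl];
        (assumption | use nI in blast))+)
qed

end
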